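(* Let $A$ be a Noetherian ring and let $\mathcal{R}\subseteq\mathcal{S}$ be an inclusion of graded rings, where $\mathcal{R},\mathcal{S}$ are standard graded with $\mathcal{R}_0=\mathcal{S}_0=A$. Let $M$ be a finitely generated graded $\mathcal{R}$-module and $N$ a finitely generated graded $\mathcal{S}$-module with an inclusion $M\subseteq N$ of graded $\mathcal{R}$-modules. Then: (1) $\operatorname{Ass}_A(N/M)$ is a finite set. (2) If $A$ is local and $\ell_A(N_n/M_n)<\infty$ for all $n$, then there is a polynomial $P(z)\in\mathbb{Q}[z]$ of degree at most $\dim\mathcal{S}-1$ with $P(n)=\ell_A(N_n/M_n)$ for all $n\gg0$.
   Context: A standard graded ring $\mathcal{R}=\bigoplus_{n\ge0}\mathcal{R}_n$ with $\mathcal{R}_0=A$ is a Noetherian $\mathbb{N}$-graded commutative ring generated as an $A$-algebra by finitely many elements of $\mathcal{R}_1$. $N/M$ is regarded as an $A$-module; $\ell_A$ denotes length. *)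

theory Defs
  imports "HOL-Algebra.Algebra" "HOL-Library.Extended_Nat"
    "HOL-Computational_Algebra.Polynomial"
begin

definition homog_decomp :: "('b, 'm) ring_scheme \<Rightarrow> ('i \<Rightarrow> 'b set) \<Rightarrow> 'b \<Rightarrow> ('i \<Rightarrow> 'b) \<Rightarrow> bool"
  where "homog_decomp M G x c \<longleftrightarrow>
     (\<forall>n. c n \<in> G n) \<and> finite {n. c n \<noteq> \<zero>\<^bsub>M\<^esub>} \<and>
     x = finsum M c {n. c n \<noteq> \<zero>\<^bsub>M\<^esub>}"

definition graded_ring :: "('a, 'm) ring_scheme \<Rightarrow> (nat \<Rightarrow> 'a set) \<Rightarrow> bool"
  where "graded_ring S G \<longleftrightarrow> cring S \<and>
     (\<forall>n. subgroup (G n) (add_monoid S)) \<and>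
     (\<forall>m n x y. x \<in> G m \<longrightarrow> y \<in> G n \<longrightarrow> x \<otimes>\<^bsub>S\<^esub> y \<in> G (m + n)) \<and>
     (\<forall>x \<in> carrier S. \<exists>!c. homog_decomp S G x c)"

definition standard_graded :: "('a, 'm) ring_scheme \<Rightarrow> (nat \<Rightarrow> 'a set) \<Rightarrow> bool"
  where "standard_graded S G \<longleftrightarrow> graded_ring S G \<and> noetherian_ring S \<and>
     (\<exists>Y. finite Y \<and> Y \<subseteq> G 1 \<and> carrier S = generate_ring S (G 0 \<union> Y))"

definition graded_module ::
  "('a, 'm) ring_scheme \<Rightarrow> (nat \<Rightarrow> 'a set) \<Rightarrow> ('a, 'b, 'n) module_scheme \<Rightarrow> (int \<Rightarrow> 'b set) \<Rightarrow> bool"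
  where "graded_module S GS N GN \<longleftrightarrow> module S N \<and>
     (\<forall>n. subgroup (GN n) (add_monoid N)) \<and>
     (\<forall>m n a x. a \<in> GS m \<longrightarrow> x \<in> GN n \<longrightarrow> a \<odot>\<^bsub>N\<^esub> x \<in> GN (int m + n)) \<and>
     (\<forall>x \<in> carrier N. \<exists>!c. homog_decomp N GN x c)"

definition fin_gen_module :: "('a, 'm) ring_scheme \<Rightarrow> ('a, 'b, 'n) module_scheme \<Rightarrow> bool"
  where "fin_gen_module R M \<longleftrightarrow>
     (\<exists>Y. finite Y \<and> Y \<subseteq> carrier M \<and> carrier M = \<Inter>{H. submodule H R M \<and> Y \<subseteq> H})"

definition local_ring :: "('a, 'm) ring_scheme \<Rightarrow> bool"
  where "local_ring A \<longleftrightarrow> cring A \<and> (\<exists>!m. maximalideal m A)"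

definition krull_dim :: "('a, 'm) ring_scheme \<Rightarrow> enat"
  where "krull_dim S = Sup {enat k | k. \<exists>p :: nat \<Rightarrow> 'a set.
     (\<forall>i \<le> k. primeideal (p i) S) \<and> (\<forall>i < k. p i \<subset> p (Suc i))}"

text \<open>Length of the A-module Q/P, where P \<subseteq> Q are A-submodules of N: the supremum of the
  lengths k of strict chains P = L_0 < L_1 < ... < L_k = Q of A-submodules (these correspond
  exactly to chains of submodules of Q/P).\<close>
definition quot_length :: "('a, 'm) ring_scheme \<Rightarrow> ('a, 'b, 'n) module_scheme \<Rightarrow> 'b set \<Rightarrow> 'b set \<Rightarrow> enat"
  where "quot_length A N P Q = Sup {enat k | k. \<exists>L :: nat \<Rightarrow> 'b set.
     L 0 = P \<and> L k = Q \<and> (\<forall>i \<le> k. submodule (L i) A N) \<and> (\<forall>i < k. L i \<subset> L (Suc i))}"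

text \<open>Ass_A(N/M) for an A-submodule M of N: the prime ideals of A of the form
  ann_A(x + M) = {a. a x \<in> M} for some x \<in> N.\<close>
definition ass_quot :: "('a, 'm) ring_scheme \<Rightarrow> ('a, 'b, 'n) module_scheme \<Rightarrow> 'b set \<Rightarrow> 'a set set"
  where "ass_quot A N M = {p. primeideal p A \<and>
     (\<exists>x \<in> carrier N. p = {a \<in> carrier A. a \<odot>\<^bsub>N\<^esub> x \<in> M})}"

end

theory Submission
  imports Defs
begin

text \<open>
  Everything takes place inside \<open>N\<close>. Adjoining to \<open>R\<close> one algebra generator \<open>y\<close> of \<open>S\<close> at a time leads
  from \<open>M\<close> to \<open>SM\<close>, and \<open>N / SM\<close> is a finitely generated \<open>S\<close>-module. In one such step \<open>M\<close> is replaced by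
  \<open>M' = M + yM + y\<^sup>2M + \<dots>\<close>; the factors of the filtration by the powers of \<open>y\<close> are quotients \<open>M / K\<^sub>i\<close> with
  \<open>K\<^sub>i\<close> increasing, hence only finitely many \<open>K\<^sub>i\<close> occur. This gives the finiteness of the associated
  primes, and it turns the Hilbert function of \<open>M' / M\<close> into finitely many shifted Hilbert functions and
  one sum function of a Hilbert function, all of them eventually polynomial.

  For the degree, the same filtration shows \<open>\<mm>\<^bsup>cn\<^esup> N\<^sub>n \<subseteq> M\<^sub>n\<close> for some \<open>c\<close>, so it suffices to bound the length of
  \<open>N\<^sub>n / \<mm>\<^bsup>cn\<^esup> N\<^sub>n\<close>. This quantity is subadditive, so graded prime filtrations reduce it to \<open>S / Q\<close> with \<open>Q\<close> a
  homogeneous prime. There one divides by an element of \<open>\<mm>\<close> or of \<open>S\<^sub>1\<close> outside \<open>Q\<close>, which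
  lowers the dimension and costs at most a factor \<open>O(n)\<close>.
\<close>

section \<open>Submodules and lengths\<close>

text \<open>The obstacle is that \<open>N / M\<close> is in general finitely generated over neither
  ring: \<open>M\<close> need not be stable under \<open>S\<close>, and \<open>N\<close> need not be
  finite over \<open>R\<close>. The classical results on associated primes and Hilbert functions
  therefore apply only to the pieces of the tower. Those pieces make the length eventually
  polynomial but say nothing about the dimension. The degree bound is a second, independent estimate
  of the same function, compared with the polynomial at the very end. The exponent \<open>cn\<close>
  is linear because each power of \<open>y\<close> costs a fixed power of \<open>mm\<close>, and in
  degree \<open>n\<close> only about \<open>n\<close> powers of \<open>y\<close> occur, as
  \<open>M\<close> vanishes below some degree. A linear exponent is just affordable: dividing by
  \<open>t \<in> mm\<close> yields at most \<open>cn + 1\<close> colons by powers of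
  \<open>t\<close>, each contributing one Hilbert function of smaller dimension, while dividing by
  an element of degree one sums such a function over the degrees. Either way the dimension drops,
  and undoing the division raises the order of growth by at most one.\<close>

locale operator_module = module S N
  for S :: "('a, 'm) ring_scheme" (structure) and N :: "('a, 'b, 'n) module_scheme" (structure) +
  fixes A0 :: "'a set"
  assumes A0_subring: "subring A0 S"
begin

abbreviation nadd (infixl "\<boxplus>" 65) where "x \<boxplus> y \<equiv> x \<oplus>\<^bsub>N\<^esub> y"
abbreviation nsub (infixl "\<boxminus>" 65) where "x \<boxminus> y \<equiv> x \<ominus>\<^bsub>N\<^esub> y"
abbreviation nsmult (infixr "\<boxdot>" 75) where "a \<boxdot> x \<equiv> a \<odot>\<^bsub>N\<^esub> x"

lemma A0_carrier: "a \<in> A0 \<Longrightarrow> a \<in> carrier S"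
  using subringE(1)[OF A0_subring] by auto

text \<open>A ring generated over \<open>A0\<close> by \<open>Y\<close> enters only through its operator set \<open>A0 \<union> Y\<close>, so that no
  intermediate ring has to be constructed.\<close>

definition opsub :: "'a set \<Rightarrow> 'b set \<Rightarrow> bool" where
  "opsub Y P \<longleftrightarrow> subgroup P (add_monoid N) \<and> (\<forall>a \<in> A0 \<union> Y. \<forall>x \<in> P. a \<boxdot> x \<in> P)"

lemma opsub_carrier: "opsub Y P \<Longrightarrow> x \<in> P \<Longrightarrow> x \<in> carrier N"
  unfolding opsub_def using subgroup.subset by fastforce

lemma opsub_subset: "opsub Y P \<Longrightarrow> P \<subseteq> carrier N"
  using opsub_carrier by blast

lemma opsub_zero: "opsub Y P \<Longrightarrow> \<zero>\<^bsub>N\<^esub> \<in> P"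
  unfolding opsub_def using subgroup.one_closed by fastforce

lemma opsub_add: "opsub Y P \<Longrightarrow> x \<in> P \<Longrightarrow> y \<in> P \<Longrightarrow> x \<boxplus> y \<in> P"
  unfolding opsub_def using subgroup.m_closed by fastforce

lemma opsub_uminus: "opsub Y P \<Longrightarrow> x \<in> P \<Longrightarrow> \<ominus>\<^bsub>N\<^esub> x \<in> P"
  unfolding opsub_def a_inv_def using subgroup.m_inv_closed by fastforce

lemma opsub_minus: "opsub Y P \<Longrightarrow> x \<in> P \<Longrightarrow> y \<in> P \<Longrightarrow> x \<boxminus> y \<in> P"
  unfolding a_minus_def using opsub_uminus opsub_add by blast

lemma opsub_A0: "opsub Y P \<Longrightarrow> a \<in> A0 \<Longrightarrow> x \<in> P \<Longrightarrow> a \<boxdot> x \<in> P"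
  unfolding opsub_def by auto

lemma opsub_op: "opsub Y P \<Longrightarrow> a \<in> Y \<Longrightarrow> x \<in> P \<Longrightarrow> a \<boxdot> x \<in> P"
  unfolding opsub_def by auto

lemma opsub_antimono: "opsub Y P \<Longrightarrow> Z \<subseteq> Y \<Longrightarrow> opsub Z P"
  unfolding opsub_def by blast

lemma opsub_base: "opsub Y P \<Longrightarrow> opsub {} P"
  by (rule opsub_antimono) auto

lemma opsub_add_iff: "opsub Y P \<Longrightarrow> x \<in> P \<Longrightarrow> y \<in> carrier N \<Longrightarrow> x \<boxplus> y \<in> P \<longleftrightarrow> y \<in> P"
proof
  assume *: "opsub Y P" "x \<in> P" "y \<in> carrier N" "x \<boxplus> y \<in> P"
  have "(x \<boxplus> y) \<boxminus> x = y"
    using * opsub_carrier[OF *(1,2)]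
    by (metis M.add.inv_solve_right' M.add.m_comm M.add.m_closed a_minus_def)
  then show "y \<in> P" using opsub_minus[OF *(1,4,2)] by simp
qed (auto intro: opsub_add)

lemma opsub_minus_iff: "opsub Y P \<Longrightarrow> y \<in> P \<Longrightarrow> x \<in> carrier N \<Longrightarrow> x \<boxminus> y \<in> P \<longleftrightarrow> x \<in> P"
  unfolding a_minus_def
  using opsub_add_iff[of Y P "\<ominus>\<^bsub>N\<^esub> y" x] opsub_uminus[of Y P y] opsub_carrier[of Y P y]
  by (simp add: M.a_comm)

text \<open>Closure under negation comes for free: it is multiplication by
  \<open>\<ominus> \<one>\<close>, which lies in the subring \<open>A0\<close>.\<close>

lemma opsubI:
  assumes "P \<subseteq> carrier N" "\<zero>\<^bsub>N\<^esub> \<in> P" "\<And>x y. x \<in> P \<Longrightarrow> y \<in> P \<Longrightarrow> x \<boxplus> y \<in> P"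
    and "\<And>a x. a \<in> A0 \<Longrightarrow> x \<in> P \<Longrightarrow> a \<boxdot> x \<in> P" "\<And>a x. a \<in> Y \<Longrightarrow> x \<in> P \<Longrightarrow> a \<boxdot> x \<in> P"
  shows "opsub Y P"
proof -
  have "\<ominus>\<^bsub>N\<^esub> x \<in> P" if "x \<in> P" for x
  proof -
    have "(\<ominus> \<one>) \<boxdot> x \<in> P"
      using assms(4) subringE(3,5)[OF A0_subring] that by blast
    then show ?thesis
      using smult_l_minus[of \<one> x] that assms(1) by auto
  qed
  then have "subgroup P (add_monoid N)"
    using assms(1-3) by (intro subgroup.intro) (auto simp: a_inv_def)
  then show ?thesis unfolding opsub_def using assms(4,5) by auto
qed

lemma submodule_iff_opsub: "submodule P (S\<lparr>carrier := A0\<rparr>) N \<longleftrightarrow> opsub {} P"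
  unfolding opsub_def submodule_def submodule_axioms_def by auto

lemma opsub_Int: "opsub Y P \<Longrightarrow> opsub Z Q \<Longrightarrow> opsub (Y \<inter> Z) (P \<inter> Q)"
  by (rule opsubI)
     (auto intro: opsub_add opsub_zero opsub_A0 opsub_op dest: opsub_carrier)

lemma opsub_zero_set: "Y \<subseteq> carrier S \<Longrightarrow> opsub Y {\<zero>\<^bsub>N\<^esub>}"
  by (rule opsubI) (use A0_carrier in auto)

lemma opsub_carrier_set: "Y \<subseteq> carrier S \<Longrightarrow> opsub Y (carrier N)"
  by (rule opsubI) (use A0_carrier in auto)

section \<open>Sums \<open>P + sQ\<close> and colons\<close>

definition plus_mult :: "'b set \<Rightarrow> 'a \<Rightarrow> 'b set \<Rightarrow> 'b set" where
  "plus_mult P s Q = {p \<boxplus> s \<boxdot> q | p q. p \<in> P \<and> q \<in> Q}"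

text \<open>The kernel of multiplication by \<open>s\<close> from \<open>Q\<close> to
  \<open>N / P\<close>. Together with \<open>plus_mult\<close> it serves both for multiplication by
  a ring element and, at \<open>s = \<one>\<close>, for intersections and sums.\<close>

definition pre_mult :: "'a \<Rightarrow> 'b set \<Rightarrow> 'b set \<Rightarrow> 'b set" where
  "pre_mult s P Q = {x \<in> Q. s \<boxdot> x \<in> P}"

lemma smult_comm: "a \<in> carrier S \<Longrightarrow> b \<in> carrier S \<Longrightarrow> x \<in> carrier N \<Longrightarrow> a \<boxdot> b \<boxdot> x = b \<boxdot> a \<boxdot> x"
  by (metis m_comm smult_assoc1)

lemma opsub_plus_mult:
  assumes "opsub Y P" "opsub Y Q" "s \<in> carrier S" "Y \<subseteq> carrier S"
  shows "opsub Y (plus_mult P s Q)"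
proof -
  note c = opsub_carrier[OF assms(1)] opsub_carrier[OF assms(2)]
  have sm: "a \<boxdot> x \<in> plus_mult P s Q" if a: "a \<in> A0 \<union> Y" and x: "x \<in> plus_mult P s Q" for a x
  proof -
    obtain p q where pq: "x = p \<boxplus> s \<boxdot> q" "p \<in> P" "q \<in> Q" using x unfolding plus_mult_def by auto
    have ac: "a \<in> carrier S" using a assms(4) A0_carrier by blast
    have "a \<boxdot> x = a \<boxdot> p \<boxplus> s \<boxdot> (a \<boxdot> q)"
      using pq c assms(3) ac smult_comm by (simp add: smult_r_distr)
    moreover have "a \<boxdot> p \<in> P" "a \<boxdot> q \<in> Q" using a pq assms(1,2) unfolding opsub_def by auto
    ultimately show ?thesis unfolding plus_mult_def by blast
  qed
  show ?thesis
  proof (rule opsubI)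
    show "plus_mult P s Q \<subseteq> carrier N" unfolding plus_mult_def using c assms(3) by auto
    show "\<zero>\<^bsub>N\<^esub> \<in> plus_mult P s Q"
      unfolding plus_mult_def using opsub_zero[OF assms(1)] opsub_zero[OF assms(2)] assms(3) by force
    fix x y assume "x \<in> plus_mult P s Q" "y \<in> plus_mult P s Q"
    then obtain p q p' q' where pq: "x = p \<boxplus> s \<boxdot> q" "p \<in> P" "q \<in> Q" "y = p' \<boxplus> s \<boxdot> q'" "p' \<in> P" "q' \<in> Q"
      unfolding plus_mult_def by auto
    have "x \<boxplus> y = (p \<boxplus> p') \<boxplus> s \<boxdot> (q \<boxplus> q')"
      using pq c assms(3) by (simp add: smult_r_distr M.a_ac)
    then show "x \<boxplus> y \<in> plus_mult P s Q"
      unfolding plus_mult_def using opsub_add[OF assms(1)] opsub_add[OF assms(2)] pq by blast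
  qed (use sm in auto)
qed

lemma opsub_pre_mult:
  assumes "opsub Y P" "opsub Y Q" "s \<in> carrier S" "Y \<subseteq> carrier S"
  shows "opsub Y (pre_mult s P Q)"
proof (rule opsubI)
  note c = opsub_carrier[OF assms(1)] opsub_carrier[OF assms(2)]
  show "pre_mult s P Q \<subseteq> carrier N" unfolding pre_mult_def using c by auto
  show "\<zero>\<^bsub>N\<^esub> \<in> pre_mult s P Q"
    unfolding pre_mult_def using opsub_zero[OF assms(1)] opsub_zero[OF assms(2)] assms(3) by auto
  show "x \<boxplus> y \<in> pre_mult s P Q" if "x \<in> pre_mult s P Q" "y \<in> pre_mult s P Q" for x y
    using that c assms(3) opsub_add[OF assms(1)] opsub_add[OF assms(2)]
    unfolding pre_mult_def by (auto simp: smult_r_distr)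
  have "a \<boxdot> x \<in> pre_mult s P Q" if "a \<in> A0 \<union> Y" "x \<in> pre_mult s P Q" for a x
    using that c assms A0_carrier smult_comm[of s a x] unfolding pre_mult_def opsub_def by auto
  then show "a \<boxdot> x \<in> pre_mult s P Q" if "a \<in> A0" "x \<in> pre_mult s P Q" for a x using that by blast
  show "a \<boxdot> x \<in> pre_mult s P Q" if "a \<in> Y" "x \<in> pre_mult s P Q" for a x
    using \<open>\<And>x a. a \<in> A0 \<union> Y \<Longrightarrow> x \<in> pre_mult s P Q \<Longrightarrow> a \<boxdot> x \<in> pre_mult s P Q\<close> that by blast
qed

lemma plus_mult_left: "opsub Y P \<Longrightarrow> opsub Z Q \<Longrightarrow> s \<in> carrier S \<Longrightarrow> P \<subseteq> plus_mult P s Q"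
proof
  fix x assume *: "opsub Y P" "opsub Z Q" "s \<in> carrier S" "x \<in> P"
  then have "x = x \<boxplus> s \<boxdot> \<zero>\<^bsub>N\<^esub>" using opsub_carrier by simp
  then show "x \<in> plus_mult P s Q" unfolding plus_mult_def using * opsub_zero by blast
qed

lemma plus_mult_right: "opsub Y P \<Longrightarrow> opsub Z Q \<Longrightarrow> s \<in> carrier S \<Longrightarrow> q \<in> Q \<Longrightarrow> s \<boxdot> q \<in> plus_mult P s Q"
proof -
  assume *: "opsub Y P" "opsub Z Q" "s \<in> carrier S" "q \<in> Q"
  then have "s \<boxdot> q = \<zero>\<^bsub>N\<^esub> \<boxplus> s \<boxdot> q" using opsub_carrier by simp
  then show "s \<boxdot> q \<in> plus_mult P s Q" unfolding plus_mult_def using * opsub_zero by blast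
qed

lemma plus_mult_least:
  "opsub Y L \<Longrightarrow> P \<subseteq> L \<Longrightarrow> (\<And>q. q \<in> Q \<Longrightarrow> s \<boxdot> q \<in> L) \<Longrightarrow> plus_mult P s Q \<subseteq> L"
  unfolding plus_mult_def using opsub_add by blast

lemma plus_mult_mono: "P \<subseteq> P' \<Longrightarrow> Q \<subseteq> Q' \<Longrightarrow> plus_mult P s Q \<subseteq> plus_mult P' s Q'"
  unfolding plus_mult_def by blast

section \<open>Strict chains and the additivity of length\<close>

inductive schain :: "nat \<Rightarrow> 'b set \<Rightarrow> 'b set \<Rightarrow> bool" where
  refl: "opsub {} P \<Longrightarrow> schain 0 P P"
| step: "schain k P Q \<Longrightarrow> opsub {} R \<Longrightarrow> Q \<subset> R \<Longrightarrow> schain (Suc k) P R"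

lemma schain_opsub: "schain k P Q \<Longrightarrow> opsub {} P \<and> opsub {} Q \<and> P \<subseteq> Q"
  by (induction rule: schain.induct) auto

lemma schain_trans: "schain l Q R \<Longrightarrow> schain k P Q \<Longrightarrow> schain (k + l) P R"
  by (induction rule: schain.induct) (auto intro: schain.intros)

lemma schain_extend: "schain k P Q \<Longrightarrow> opsub {} R \<Longrightarrow> Q \<subseteq> R \<Longrightarrow> \<exists>k' \<ge> k. schain k' P R"
  using schain.step[of k P Q R] le_SucI[of k k] by (cases "Q = R") blast+

lemma schain_single: "opsub {} P \<Longrightarrow> opsub {} Q \<Longrightarrow> P \<subset> Q \<Longrightarrow> schain 1 P Q"
  by (metis One_nat_def schain.intros)

text \<open>Gluing and refining chains are inductions on \<open>schain\<close>; this is the bridge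
  to the indexed chains in \<open>quot_length\<close>.\<close>

lemma schain_iff:
  "schain k P Q \<longleftrightarrow> (\<exists>L. L 0 = P \<and> L k = Q \<and> (\<forall>i \<le> k. submodule (L i) (S\<lparr>carrier := A0\<rparr>) N) \<and>
      (\<forall>i < k. L i \<subset> L (Suc i)))" (is "_ \<longleftrightarrow> (\<exists>L. ?C k P Q L)")
proof
  show "schain k P Q \<Longrightarrow> \<exists>L. ?C k P Q L"
  proof (induction rule: schain.induct)
    case (refl P)
    then show ?case by (intro exI[of _ "\<lambda>_. P"]) (auto simp: submodule_iff_opsub)
  next
    case (step k P Q R)
    then obtain L where L: "?C k P Q L" by blast
    then show ?case
      using step by (intro exI[of _ "L(Suc k := R)"]) (auto simp: submodule_iff_opsub le_Suc_eq less_Suc_eq)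
  qed
  show "\<exists>L. ?C k P Q L \<Longrightarrow> schain k P Q"
  proof (induction k arbitrary: Q)
    case 0
    then show ?case by (auto simp: submodule_iff_opsub intro: schain.refl)
  next
    case (Suc k)
    then obtain L where L: "?C (Suc k) P Q L" by blast
    then have "schain k P (L k)" by (intro Suc.IH exI[of _ L]) auto
    then show ?case using L schain.step[of k P "L k" Q] by (auto simp: submodule_iff_opsub)
  qed
qed

definition len :: "'b set \<Rightarrow> 'b set \<Rightarrow> enat" where
  "len P Q = quot_length (S\<lparr>carrier := A0\<rparr>) N P Q"

lemma len_eq_Sup: "len P Q = Sup {enat k | k. schain k P Q}"
  unfolding len_def quot_length_def schain_iff by simp

lemma len_ge_schain: "schain k P Q \<Longrightarrow> enat k \<le> len P Q"
  unfolding len_eq_Sup by (rule Sup_upper) auto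

text \<open>Lengths may be infinite, so they are compared below through their finite lower bounds.
  The assumption \<open>P \<subseteq> Q\<close> guarantees that there is a chain at all, which
  matters at \<open>j = 0\<close>.\<close>

lemma len_ge_iff:
  assumes "opsub {} P" "opsub {} Q" "P \<subseteq> Q"
  shows "enat j \<le> len P Q \<longleftrightarrow> (\<exists>k \<ge> j. schain k P Q)"
proof
  assume le: "enat j \<le> len P Q"
  show "\<exists>k \<ge> j. schain k P Q"
  proof (cases j)
    case 0
    show ?thesis
    proof (cases "P = Q")
      case True then show ?thesis using schain.refl assms 0 by auto
    next
      case False then show ?thesis using schain_single assms 0 by auto
    qed
  next
    case (Suc i)
    then have "enat i < len P Q" using le by (simp add: Suc_ile_eq)
    then obtain k where "schain k P Q" "enat i < enat k"
      unfolding len_eq_Sup less_Sup_iff by blast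
    then show ?thesis using Suc by (intro exI[of _ k]) auto
  qed
next
  assume "\<exists>k \<ge> j. schain k P Q"
  then obtain k where "k \<ge> j" "schain k P Q" by blast
  then show "enat j \<le> len P Q"
    by (intro order_trans[OF _ len_ge_schain[of k]]) auto
qed

lemma enat_leI: "(\<And>j. enat j \<le> x \<Longrightarrow> enat j \<le> y) \<Longrightarrow> x \<le> y"
proof (rule ccontr)
  assume *: "\<And>j. enat j \<le> x \<Longrightarrow> enat j \<le> y" and "\<not> x \<le> y"
  then obtain m where "y = enat m" "enat m < x" by (cases y) auto
  then show False using *[of "Suc m"] by (simp add: Suc_ile_eq)
qed

lemma enat_le_plusD: "enat j \<le> x + y \<Longrightarrow> \<exists>a b. j = a + b \<and> enat a \<le> x \<and> enat b \<le> y"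
proof -
  assume j: "enat j \<le> x + y"
  show ?thesis
  proof (cases "enat j \<le> x")
    case True then show ?thesis by (intro exI[of _ j] exI[of _ 0]) (auto simp: enat_0)
  next
    case False
    then obtain a where a: "x = enat a" "a < j" by (cases x) auto
    then have "enat (j - a) \<le> y" using j by (cases y) auto
    then show ?thesis using a by (intro exI[of _ a] exI[of _ "j - a"]) auto
  qed
qed

text \<open>The modular law: a strict step must show either in the intersection with
  \<open>Q\<close> or in the sum with \<open>Q\<close>. Indeed, if \<open>p \<boxplus> q\<close>
  lies in \<open>U'\<close> with \<open>p \<in> U\<close> and \<open>q \<in> Q\<close>, then
  \<open>q \<in> U' \<inter> Q \<subseteq> U\<close>.\<close>

lemma modular_eq:
  assumes "opsub {} U" "opsub {} U'" "opsub {} Q" "U \<subseteq> U'" "U' \<inter> Q \<subseteq> U"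
    and "U' \<subseteq> plus_mult U \<one> Q"
  shows "U = U'"
proof
  show "U' \<subseteq> U"
  proof
    fix x assume x: "x \<in> U'"
    then obtain p q where pq: "x = p \<boxplus> q" "p \<in> U" "q \<in> Q"
      using assms(6) opsub_carrier[OF assms(3)] unfolding plus_mult_def by force
    then have "q \<in> U'" using opsub_add_iff[OF assms(2), of p q] assms x opsub_carrier by blast
    then show "x \<in> U" using pq assms opsub_add by blast
  qed
qed (use assms in auto)

text \<open>Chains can be glued at \<open>Q\<close>, which gives one inequality. Conversely, a chain
  from \<open>P\<close> to \<open>R\<close> is projected to its intersections with \<open>Q\<close>
  and its sums with \<open>Q\<close>; by \<open>modular_eq\<close> every strict step survives in one
  of them.\<close>

theorem len_add:
  assumes o: "opsub {} P" "opsub {} Q" "opsub {} R" and sub: "P \<subseteq> Q" "Q \<subseteq> R"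
  shows "len P R = len P Q + len Q R"
proof (rule antisym)
  show "len P Q + len Q R \<le> len P R"
  proof (rule enat_leI)
    fix j assume "enat j \<le> len P Q + len Q R"
    then obtain a b where ab: "j = a + b" "enat a \<le> len P Q" "enat b \<le> len Q R"
      using enat_le_plusD by blast
    then obtain k l where kl: "k \<ge> a" "schain k P Q" "l \<ge> b" "schain l Q R"
      using len_ge_iff[OF o(1,2) sub(1)] len_ge_iff[OF o(2,3) sub(2)] by blast
    have "enat (k + l) \<le> len P R" using len_ge_schain[OF schain_trans] kl by blast
    moreover have "enat j \<le> enat (k + l)" using ab(1) kl by simp
    ultimately show "enat j \<le> len P R" by (rule order_trans[rotated])
  qed
  \<comment> \<open>Only \<open>k \<le> a + b\<close>, since a step may stay strict in both
    projections.\<close>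
  have split: "schain k P' U \<Longrightarrow> P' = P \<Longrightarrow>
      \<exists>a b. k \<le> a + b \<and> schain a P (U \<inter> Q) \<and> schain b Q (plus_mult U \<one> Q)" for k P' U
  proof (induction rule: schain.induct)
    case (refl P')
    have "plus_mult P \<one> Q = Q"
      using plus_mult_least[OF o(2) sub(1), of Q \<one>] plus_mult_right[OF o(1) o(2), of \<one>]
        opsub_carrier[OF o(2)] by (simp add: subset_antisym subset_iff)
    moreover have "P \<inter> Q = P" using sub by auto
    ultimately show ?case using refl o schain.refl by auto
  next
    case (step k P' U R)
    then obtain a b where ab: "k \<le> a + b" "schain a P (U \<inter> Q)" "schain b Q (plus_mult U \<one> Q)"
      by blast
    have U: "opsub {} U" using schain_opsub step by blast
    have m: "U \<inter> Q \<subseteq> R \<inter> Q" "plus_mult U \<one> Q \<subseteq> plus_mult R \<one> Q"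
      using step(3) plus_mult_mono[of U R Q Q \<one>] by auto
    have oo: "opsub {} (R \<inter> Q)" "opsub {} (plus_mult R \<one> Q)"
      using opsub_Int[OF step(2) o(2)] opsub_plus_mult[OF step(2) o(2)] by auto
    have "U \<inter> Q \<subset> R \<inter> Q \<or> plus_mult U \<one> Q \<subset> plus_mult R \<one> Q"
      using modular_eq[OF U step(2) o(2)] step(3) m plus_mult_left[OF step(2) o(2), of \<one>] by blast
    then show ?case
    proof
      assume s: "U \<inter> Q \<subset> R \<inter> Q"
      obtain b' where "b' \<ge> b" "schain b' Q (plus_mult R \<one> Q)"
        using schain_extend[OF ab(3) oo(2) m(2)] by blast
      then show ?thesis using schain.step[OF ab(2) oo(1) s] ab by (intro exI[of _ "Suc a"] exI[of _ b']) auto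
    next
      assume s: "plus_mult U \<one> Q \<subset> plus_mult R \<one> Q"
      obtain a' where "a' \<ge> a" "schain a' P (R \<inter> Q)"
        using schain_extend[OF ab(2) oo(1) m(1)] by blast
      then show ?thesis using schain.step[OF ab(3) oo(2) s] ab by (intro exI[of _ a'] exI[of _ "Suc b"]) auto
    qed
  qed
  show "len P R \<le> len P Q + len Q R"
  proof (rule enat_leI)
    fix j assume "enat j \<le> len P R"
    then obtain k where k: "k \<ge> j" "schain k P R" using len_ge_iff[OF o(1,3)] sub by blast
    have "plus_mult R \<one> Q = R"
      using plus_mult_least[OF o(3) order_refl, of Q \<one>] plus_mult_left[OF o(3) o(2), of \<one>] sub
        opsub_carrier[OF o(2)] by (simp add: subset_antisym subset_iff)
    moreover have "R \<inter> Q = Q" using sub by auto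
    ultimately obtain a b where "k \<le> a + b" "schain a P Q" "schain b Q R"
      using split[OF k(2) HOL.refl] by metis
    then have "enat j \<le> enat a + enat b" "enat a + enat b \<le> len P Q + len Q R"
      using k(1) add_mono[OF len_ge_schain[of a P Q] len_ge_schain[of b Q R]] by simp_all
    then show "enat j \<le> len P Q + len Q R" by (rule order_trans)
  qed
qed

lemma len_self: "opsub {} P \<Longrightarrow> len P P = 0"
proof -
  assume P: "opsub {} P"
  have "k = 0" if "schain k P P" for k
    using that by cases (use schain_opsub in blast)+
  then have "\<not> enat 1 \<le> len P P" using len_ge_iff[OF P P, of 1] by force
  then show ?thesis by (cases "len P P") (auto simp: enat_0_iff)
qed

lemma len_pos: "opsub {} P \<Longrightarrow> opsub {} Q \<Longrightarrow> P \<subset> Q \<Longrightarrow> 1 \<le> len P Q"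
  using len_ge_schain[OF schain_single] by (simp add: one_enat_def)

text \<open>With \<open>s = \<one>\<close> this is the second isomorphism theorem.\<close>

theorem len_plus_mult:
  assumes o: "opsub {} L" "opsub {} Q" and s: "s \<in> carrier S"
  shows "len L (plus_mult L s Q) = len (pre_mult s L Q) Q"
proof (rule antisym)
  have oL: "opsub {} (plus_mult L s Q)" and oQ: "opsub {} (pre_mult s L Q)"
    using opsub_plus_mult opsub_pre_mult o s by auto
  have subL: "L \<subseteq> plus_mult L s Q" using plus_mult_left o s by blast
  have subQ: "pre_mult s L Q \<subseteq> Q" unfolding pre_mult_def by auto
  \<comment> \<open>The isomorphism from \<open>Q / (L : s)\<close> to \<open>(L + sQ) / L\<close>
    acts on chains by preimage (\<open>down\<close>) and image (\<open>up\<close>). Preimages stay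
    distinct because modulo \<open>L\<close> every element of \<open>L + sQ\<close> has the form
    \<open>s \<boxdot> q\<close>; images stay distinct because each member of the chain contains the
    kernel \<open>L : s\<close>.\<close>
  have down: "schain k L' U \<Longrightarrow> L' = L \<Longrightarrow> U \<subseteq> plus_mult L s Q \<Longrightarrow>
      schain k (pre_mult s L Q) (pre_mult s U Q)" for k L' U
  proof (induction rule: schain.induct)
    case (refl P) then show ?case using oQ schain.refl by auto
  next
    case (step k P U R)
    obtain z where z: "z \<in> R" "z \<notin> U" using step by blast
    obtain p q where pq: "z = p \<boxplus> s \<boxdot> q" "p \<in> L" "q \<in> Q" using step z unfolding plus_mult_def by blast
    have LU: "L \<subseteq> U" "opsub {} U" using schain_opsub step by auto
    have c: "s \<boxdot> q \<in> carrier N" using s pq opsub_carrier[OF o(2)] by blast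
    have "s \<boxdot> q \<in> R" using opsub_add_iff[OF step(2) _ c, of p] z pq LU step by blast
    moreover have "s \<boxdot> q \<notin> U" using opsub_add_iff[OF LU(2) _ c, of p] z pq LU by blast
    ultimately have "pre_mult s U Q \<subset> pre_mult s R Q"
      using pq step(3) unfolding pre_mult_def by blast
    moreover have "schain k (pre_mult s L Q) (pre_mult s U Q)" using step by blast
    moreover have "opsub {} (pre_mult s R Q)" using opsub_pre_mult[OF step(2) o(2) s] by simp
    ultimately show ?case using schain.step by blast
  qed
  have up: "schain k K U \<Longrightarrow> K = pre_mult s L Q \<Longrightarrow> U \<subseteq> Q \<Longrightarrow> schain k L (plus_mult L s U)" for k K U
  proof (induction rule: schain.induct)
    case (refl P)
    have "plus_mult L s P = L"
      using plus_mult_left[OF o(1) refl(1) s] plus_mult_least[OF o(1) order_refl, of P s] refl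
      unfolding pre_mult_def by blast
    then show ?case using o schain.refl by auto
  next
    case (step k P U R)
    have U: "opsub {} U" "P \<subseteq> U" using schain_opsub step(1) by auto
    obtain z where z: "z \<in> R" "z \<notin> U" using step by blast
    have "s \<boxdot> z \<in> plus_mult L s R" using plus_mult_right[OF o(1) step(2) s z(1)] .
    moreover have "s \<boxdot> z \<notin> plus_mult L s U"
    proof
      assume "s \<boxdot> z \<in> plus_mult L s U"
      then obtain p q where pq: "s \<boxdot> z = p \<boxplus> s \<boxdot> q" "p \<in> L" "q \<in> U" unfolding plus_mult_def by blast
      have c: "p \<in> carrier N" "q \<in> carrier N" "z \<in> carrier N"
        using pq opsub_carrier[OF o(1)] opsub_carrier[OF U(1)] opsub_carrier[OF step(2)] z by auto
      have "s \<boxdot> (z \<boxminus> q) = p"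
        using c s pq(1) unfolding a_minus_def
        by (simp add: smult_r_distr smult_r_minus M.a_assoc M.r_neg)
      moreover have "z \<boxminus> q \<in> Q" using opsub_minus[OF o(2)] z pq step U by blast
      ultimately have "z \<boxminus> q \<in> U" using U step(5) pq unfolding pre_mult_def by auto
      then show False using opsub_minus_iff[OF U(1) pq(3) c(3)] z by blast
    qed
    moreover have "plus_mult L s U \<subseteq> plus_mult L s R" using step plus_mult_mono by blast
    moreover have "schain k L (plus_mult L s U)" using step by blast
    moreover have "opsub {} (plus_mult L s R)" using opsub_plus_mult[OF o(1) step(2) s] by simp
    ultimately show ?case using schain.step by blast
  qed
  show "len L (plus_mult L s Q) \<le> len (pre_mult s L Q) Q"
  proof (rule enat_leI)
    fix j assume "enat j \<le> len L (plus_mult L s Q)"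
    then obtain k where k: "k \<ge> j" "schain k L (plus_mult L s Q)" using len_ge_iff[OF o(1) oL subL] by blast
    have "pre_mult s (plus_mult L s Q) Q = Q" 
      using plus_mult_right[OF o s] unfolding pre_mult_def by auto
    then have "schain k (pre_mult s L Q) Q" using down[OF k(2)] by simp
    then show "enat j \<le> len (pre_mult s L Q) Q" using k(1) len_ge_iff[OF oQ o(2) subQ] by blast
  qed
  show "len (pre_mult s L Q) Q \<le> len L (plus_mult L s Q)"
  proof (rule enat_leI)
    fix j assume "enat j \<le> len (pre_mult s L Q) Q"
    then obtain k where "k \<ge> j" "schain k (pre_mult s L Q) Q" using len_ge_iff[OF oQ o(2) subQ] by blast
    then show "enat j \<le> len L (plus_mult L s Q)"
      using up[of k] len_ge_iff[OF o(1) oL subL] by blast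
  qed
qed

lemma len_mono:
  assumes "opsub {} P" "opsub {} P'" "opsub {} Q'" "opsub {} Q" "P \<subseteq> P'" "P' \<subseteq> Q'" "Q' \<subseteq> Q"
  shows "len P' Q' \<le> len P Q"
proof -
  have "len P Q = len P P' + (len P' Q' + len Q' Q)"
    using len_add[of P P' Q] len_add[of P' Q' Q] assms by (metis order_trans)
  then show ?thesis by (cases "len P P'"; cases "len P' Q'"; cases "len Q' Q") auto
qed

end

section \<open>Chain conditions\<close>

lemma noetherian_ring_maximal:
  assumes "noetherian_ring R" "F \<noteq> {}" "\<And>I. I \<in> F \<Longrightarrow> ideal I R"
  shows "\<exists>I \<in> F. \<forall>J \<in> F. I \<subseteq> J \<longrightarrow> J = I"
proof (rule subset_Zorn_nonempty[OF assms(2)])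
  fix C assume C: "C \<noteq> {}" "subset.chain F C"
  have CF: "C \<subseteq> F" using C(2) by (simp add: subset_chain_def)
  have "subset.chain {I. ideal I R} C"
    using C(2) assms(3) by (auto simp: subset_chain_def)
  then have "\<Union>C \<in> C" by (rule noetherian_ring.ideal_chain_is_trivial[OF assms(1) C(1)])
  then show "\<Union>C \<in> F" using CF by (rule subsetD[rotated])
qed

lemma noetherian_ring_acc:
  fixes I :: "nat \<Rightarrow> 'a set"
  assumes "noetherian_ring R" "\<And>i. ideal (I i) R" "\<And>i. I i \<subseteq> I (Suc i)"
  shows "\<exists>k. \<forall>i \<ge> k. I i = I k"
proof -
  have mono: "I i \<subseteq> I j" if "i \<le> j" for i j using lift_Suc_mono_le[of I, OF assms(3) that] .
  have "\<exists>J \<in> range I. \<forall>K \<in> range I. J \<subseteq> K \<longrightarrow> K = J"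
    by (rule noetherian_ring_maximal[OF assms(1)]) (use assms(2) in auto)
  then obtain k where k: "\<And>i. I k \<subseteq> I i \<Longrightarrow> I i = I k" by auto
  have "\<forall>i \<ge> k. I i = I k" using k mono by simp
  then show ?thesis ..
qed

context operator_module
begin

text \<open>The chain condition for \<open>Q / P\<close> without forming the quotient. The version
  with sequences applies directly to the families of truncations and colons whose stabilisation is
  wanted later.\<close>

definition noeth :: "'a set \<Rightarrow> 'b set \<Rightarrow> 'b set \<Rightarrow> bool" where
  "noeth Y P Q \<longleftrightarrow> (\<forall>L :: nat \<Rightarrow> 'b set.
     (\<forall>i. opsub Y (L i) \<and> P \<subseteq> L i \<and> L i \<subseteq> Q \<and> L i \<subseteq> L (Suc i)) \<longrightarrow> (\<exists>k. \<forall>i \<ge> k. L i = L k))"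

lemma noethD:
  assumes "noeth Y P Q" "\<And>i. opsub Y (L i)" "\<And>i. P \<subseteq> L i" "\<And>i. L i \<subseteq> Q" "\<And>i. L i \<subseteq> L (Suc i)"
  shows "\<exists>k. \<forall>i \<ge> k. L i = L (k :: nat)"
  using assms unfolding noeth_def by blast

lemma noethI:
  assumes "\<And>L :: nat \<Rightarrow> 'b set. (\<And>i. opsub Y (L i)) \<Longrightarrow> (\<And>i. P \<subseteq> L i) \<Longrightarrow> (\<And>i. L i \<subseteq> Q) \<Longrightarrow>
     (\<And>i. L i \<subseteq> L (Suc i)) \<Longrightarrow> (\<exists>k. \<forall>i \<ge> k. L i = L k)"
  shows "noeth Y P Q"
  using assms unfolding noeth_def by blast

lemma noeth_mono:
  assumes "noeth Y P Q" "P \<subseteq> P'" "Q' \<subseteq> Q" "\<And>L. opsub Y' L \<Longrightarrow> P' \<subseteq> L \<Longrightarrow> L \<subseteq> Q' \<Longrightarrow> opsub Y L"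
  shows "noeth Y' P' Q'"
proof (rule noethI)
  fix L :: "nat \<Rightarrow> 'b set"
  assume L: "\<And>i. opsub Y' (L i)" "\<And>i. P' \<subseteq> L i" "\<And>i. L i \<subseteq> Q'" "\<And>i. L i \<subseteq> L (Suc i)"
  show "\<exists>k. \<forall>i \<ge> k. L i = L k"
    by (rule noethD[OF assms(1)])
       (use assms(4)[OF L(1-3)] L(4) order_trans[OF assms(2) L(2)] order_trans[OF L(3) assms(3)] in auto)
qed

lemma noeth_induct:
  assumes n: "noeth Y P Q" and P: "opsub Y P" "P \<subseteq> Q"
    and step: "\<And>L. opsub Y L \<Longrightarrow> P \<subseteq> L \<Longrightarrow> L \<subseteq> Q \<Longrightarrow>
       (\<And>L'. opsub Y L' \<Longrightarrow> L \<subset> L' \<Longrightarrow> L' \<subseteq> Q \<Longrightarrow> \<Phi> L') \<Longrightarrow> \<Phi> L"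
  shows "\<Phi> P"
proof (rule ccontr)
  assume "\<not> \<Phi> P"
  let ?B = "\<lambda>L. opsub Y L \<and> P \<subseteq> L \<and> L \<subseteq> Q \<and> \<not> \<Phi> L"
  have "\<exists>f. \<forall>i. ?B (f i) \<and> f i \<subset> f (Suc i)"
  proof (rule dependent_nat_choice)
    show "\<exists>L. ?B L" using P \<open>\<not> \<Phi> P\<close> by blast
    fix L and i :: nat assume B: "?B L"
    then obtain L' where "opsub Y L'" "L \<subset> L'" "L' \<subseteq> Q" "\<not> \<Phi> L'" using step[of L] by blast
    then show "\<exists>L'. ?B L' \<and> L \<subset> L'" using B by blast
  qed
  then obtain f where f: "\<And>i. ?B (f i)" "\<And>i. f i \<subset> f (Suc i)" by blast
  have "\<exists>k. \<forall>i \<ge> k. f i = f k" by (rule noethD[OF n]) (use f(1) psubset_imp_subset[OF f(2)] in auto)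
  then obtain k where "f (Suc k) = f k" by (metis le_SucI order_refl)
  then show False using f(2)[of k] by auto
qed

text \<open>The intersections with \<open>Q\<close> and the sums with \<open>Q\<close> both become
  stationary, and by the modular law so does the sequence itself.\<close>

lemma noeth_trans:
  assumes n: "noeth Y P Q" "noeth Y Q R" and o: "opsub Y Q" "opsub Y R" and Y: "Y \<subseteq> carrier S"
    and sub: "P \<subseteq> Q" "Q \<subseteq> R"
  shows "noeth Y P R"
proof (rule noethI)
  fix L :: "nat \<Rightarrow> 'b set"
  assume L: "\<And>i. opsub Y (L i)" "\<And>i. P \<subseteq> L i" "\<And>i. L i \<subseteq> R" "\<And>i. L i \<subseteq> L (Suc i)"
  have mono: "L i \<subseteq> L j" if "i \<le> j" for i j using lift_Suc_mono_le[of L, OF L(4) that] .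
  have "\<exists>k. \<forall>i \<ge> k. L i \<inter> Q = L k \<inter> Q"
  proof (rule noethD[OF n(1)])
    fix i
    show "opsub Y (L i \<inter> Q)" using opsub_Int[OF L(1) o(1)] by simp
    show "P \<subseteq> L i \<inter> Q" using L(2)[of i] sub by simp
    show "L i \<inter> Q \<subseteq> L (Suc i) \<inter> Q" using L(4)[of i] by auto
  qed simp
  then obtain k where k: "\<And>i. i \<ge> k \<Longrightarrow> L i \<inter> Q = L k \<inter> Q" by blast
  have "\<exists>k. \<forall>i \<ge> k. plus_mult (L i) \<one> Q = plus_mult (L k) \<one> Q"
  proof (rule noethD[OF n(2)])
    fix i
    show "opsub Y (plus_mult (L i) \<one> Q)" using opsub_plus_mult[OF L(1) o(1) _ Y] by simp
    show "Q \<subseteq> plus_mult (L i) \<one> Q"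
      using plus_mult_right[OF L(1) o(1), of \<one>] opsub_carrier[OF o(1)] by fastforce
    show "plus_mult (L i) \<one> Q \<subseteq> R"
      using plus_mult_least[OF o(2) L(3), of Q \<one>] sub(2) opsub_carrier[OF o(1)] by auto
    show "plus_mult (L i) \<one> Q \<subseteq> plus_mult (L (Suc i)) \<one> Q" using plus_mult_mono[OF L(4)] by simp
  qed
  then obtain l where l: "\<And>i. i \<ge> l \<Longrightarrow> plus_mult (L i) \<one> Q = plus_mult (L l) \<one> Q" by blast
  have "L (max k l) = L i" if "i \<ge> max k l" for i
  proof (rule modular_eq)
    show "opsub {} (L (max k l))" "opsub {} (L i)" "opsub {} Q"
      using L(1) o(1) opsub_base by blast+
    show "L (max k l) \<subseteq> L i" using mono that .
    show "L i \<inter> Q \<subseteq> L (max k l)" using k[of i] k[of "max k l"] that by auto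
    show "L i \<subseteq> plus_mult (L (max k l)) \<one> Q"
      using plus_mult_left[OF L(1) o(1), of \<one> i] l[of i] l[of "max k l"] that by auto
  qed
  then show "\<exists>k. \<forall>i \<ge> k. L i = L k" by metis
qed

text \<open>Of ring generation by \<open>A0 \<union> Y\<close>, only its effect on submodules of
  \<open>N\<close> is recorded: stability under the generators already gives stability under
  \<open>T\<close>. The passage from \<open>generate_ring\<close> is
  \<open>generatesI\<close>.\<close>

definition generates :: "'a set \<Rightarrow> 'a set \<Rightarrow> bool" where
  "generates Y T \<longleftrightarrow> subring T S \<and> A0 \<subseteq> T \<and> Y \<subseteq> T \<and> (\<forall>P. opsub Y P \<longrightarrow> (\<forall>t \<in> T. \<forall>x \<in> P. t \<boxdot> x \<in> P))"

definition ann :: "'a set \<Rightarrow> 'b set \<Rightarrow> 'b \<Rightarrow> 'a set" where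
  "ann T P x = {t \<in> T. t \<boxdot> x \<in> P}"

lemma generates_A0: "generates {} A0"
  unfolding generates_def using A0_subring opsub_A0 by auto

lemma generatesD:
  assumes "generates Y T"
  shows "subring T S" "A0 \<subseteq> T" "Y \<subseteq> T" "T \<subseteq> carrier S" "\<And>t. t \<in> T \<Longrightarrow> t \<in> carrier S"
    "\<And>P t x. opsub Y P \<Longrightarrow> t \<in> T \<Longrightarrow> x \<in> P \<Longrightarrow> t \<boxdot> x \<in> P"
  using assms subringE(1) unfolding generates_def by blast+

lemma a_inv_subring:
  assumes "subring T S" "t \<in> T" shows "\<ominus>\<^bsub>S\<lparr>carrier := T\<rparr>\<^esub> t = \<ominus> t"
proof -
  have "subgroup T (add_monoid S)" using assms(1) unfolding subring_def by auto
  then show ?thesis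
    using group.m_inv_consistent[of "add_monoid S" T t] R.add.is_group assms(2)
    unfolding a_inv_def by auto
qed

lemma ideal_ann:
  assumes g: "generates Y T" and P: "opsub Y P" and x: "x \<in> carrier N"
  shows "ideal (ann T P x) (S\<lparr>carrier := T\<rparr>)"
proof -
  note T = generatesD[OF g]
  have ring: "ring (S\<lparr>carrier := T\<rparr>)" using subring_is_ring[OF T(1)] .
  have inv: "inv\<^bsub>add_monoid (S\<lparr>carrier := T\<rparr>)\<^esub> t = \<ominus> t" if "t \<in> T" for t
    using a_inv_subring[OF T(1) that] unfolding a_inv_def .
  show ?thesis
  proof (rule idealI[OF ring])
    show "subgroup (ann T P x) (add_monoid (S\<lparr>carrier := T\<rparr>))"
    proof
      show "ann T P x \<subseteq> carrier (add_monoid (S\<lparr>carrier := T\<rparr>))" unfolding ann_def by auto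
      show "a \<otimes>\<^bsub>add_monoid (S\<lparr>carrier := T\<rparr>)\<^esub> b \<in> ann T P x" if "a \<in> ann T P x" "b \<in> ann T P x" for a b
        using that x T(5) subringE(7)[OF T(1)] opsub_add[OF P] unfolding ann_def
        by (auto simp: smult_l_distr)
      show "\<one>\<^bsub>add_monoid (S\<lparr>carrier := T\<rparr>)\<^esub> \<in> ann T P x"
        unfolding ann_def using subringE(2)[OF T(1)] x opsub_zero[OF P] by auto
      show "inv\<^bsub>add_monoid (S\<lparr>carrier := T\<rparr>)\<^esub> a \<in> ann T P x" if "a \<in> ann T P x" for a
        using that inv x T(5) subringE(5)[OF T(1)] opsub_uminus[OF P] unfolding ann_def
        by (auto simp: smult_l_minus)
    qed
    fix a t assume a: "a \<in> ann T P x" and t: "t \<in> carrier (S\<lparr>carrier := T\<rparr>)"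
    then have c: "a \<in> T" "t \<in> T" "a \<boxdot> x \<in> P" unfolding ann_def by auto
    have "(t \<otimes> a) \<boxdot> x \<in> P"
      using c x T(5,6) P by (simp add: smult_assoc1)
    moreover have "t \<otimes> a = a \<otimes> t" using c T(5) m_comm by blast
    ultimately show "t \<otimes>\<^bsub>S\<lparr>carrier := T\<rparr>\<^esub> a \<in> ann T P x" "a \<otimes>\<^bsub>S\<lparr>carrier := T\<rparr>\<^esub> t \<in> ann T P x"
      unfolding ann_def using c subringE(6)[OF T(1)] by auto
  qed
qed

definition plus_cyclic :: "'b set \<Rightarrow> 'a set \<Rightarrow> 'b \<Rightarrow> 'b set" where
  "plus_cyclic P T x = {p \<boxplus> t \<boxdot> x | p t. p \<in> P \<and> t \<in> T}"

lemma plus_cyclic: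
  assumes g: "generates Y T" and P: "opsub Y P" and x: "x \<in> carrier N"
  shows "opsub Y (plus_cyclic P T x)"
    and "P \<subseteq> plus_cyclic P T x"
    and "x \<in> plus_cyclic P T x"
    and "\<And>L. opsub Y L \<Longrightarrow> P \<subseteq> L \<Longrightarrow> x \<in> L \<Longrightarrow> plus_cyclic P T x \<subseteq> L"
proof -
  note T = generatesD[OF g]
  note c = opsub_carrier[OF P] T(5)
  show left: "P \<subseteq> plus_cyclic P T x"
  proof
    fix p assume "p \<in> P"
    then have "p = p \<boxplus> \<zero> \<boxdot> x" "\<zero> \<in> T" using c x subringE(2)[OF T(1)] by auto
    then show "p \<in> plus_cyclic P T x" unfolding plus_cyclic_def using \<open>p \<in> P\<close> by blast
  qed
  have "x = \<zero>\<^bsub>N\<^esub> \<boxplus> \<one> \<boxdot> x" using x by simp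
  then show "x \<in> plus_cyclic P T x"
    unfolding plus_cyclic_def using opsub_zero[OF P] subringE(3)[OF T(1)] by blast
  show "plus_cyclic P T x \<subseteq> L" if "opsub Y L" "P \<subseteq> L" "x \<in> L" for L
    unfolding plus_cyclic_def using opsub_add[OF that(1)] T(6)[OF that(1)] that by blast
  have sm: "a \<boxdot> z \<in> plus_cyclic P T x" if a: "a \<in> A0 \<union> Y" and z: "z \<in> plus_cyclic P T x" for a z
  proof -
    obtain p t where pt: "z = p \<boxplus> t \<boxdot> x" "p \<in> P" "t \<in> T" using z unfolding plus_cyclic_def by auto
    have aT: "a \<in> T" using a T by blast
    have "a \<boxdot> z = a \<boxdot> p \<boxplus> (a \<otimes> t) \<boxdot> x"
      using pt c x aT by (simp add: smult_r_distr smult_assoc1)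
    moreover have "a \<boxdot> p \<in> P" "a \<otimes> t \<in> T" using T(6)[OF P aT pt(2)] subringE(6)[OF T(1) aT pt(3)] by auto
    ultimately show ?thesis unfolding plus_cyclic_def by blast
  qed
  show "opsub Y (plus_cyclic P T x)"
  proof (rule opsubI)
    show "plus_cyclic P T x \<subseteq> carrier N" unfolding plus_cyclic_def using c x by auto
    show "\<zero>\<^bsub>N\<^esub> \<in> plus_cyclic P T x" using left opsub_zero[OF P] by blast
    fix z w assume "z \<in> plus_cyclic P T x" "w \<in> plus_cyclic P T x"
    then obtain p t p' t' where pt: "z = p \<boxplus> t \<boxdot> x" "p \<in> P" "t \<in> T" "w = p' \<boxplus> t' \<boxdot> x" "p' \<in> P" "t' \<in> T"
      unfolding plus_cyclic_def by auto
    have "z \<boxplus> w = (p \<boxplus> p') \<boxplus> (t \<oplus> t') \<boxdot> x"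
      using pt c x by (simp add: smult_l_distr M.a_ac)
    then show "z \<boxplus> w \<in> plus_cyclic P T x"
      unfolding plus_cyclic_def using opsub_add[OF P pt(2,5)] subringE(7)[OF T(1) pt(3,6)] by blast
  qed (use sm in auto)
qed

text \<open>\<open>(P + Tx) / P\<close> is a quotient of \<open>T\<close>: a submodule
  \<open>L\<close> in this interval is recovered from the ideal \<open>ann T L x\<close>, so the
  chain condition on ideals carries over.\<close>

lemma noeth_plus_cyclic:
  assumes g: "generates Y T" and noe: "noetherian_ring (S\<lparr>carrier := T\<rparr>)"
    and P: "opsub Y P" and x: "x \<in> carrier N"
  shows "noeth Y P (plus_cyclic P T x)"
proof (rule noethI)
  fix L :: "nat \<Rightarrow> 'b set"
  assume L: "\<And>i. opsub Y (L i)" "\<And>i. P \<subseteq> L i" "\<And>i. L i \<subseteq> plus_cyclic P T x" "\<And>i. L i \<subseteq> L (Suc i)"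
  have mono: "L i \<subseteq> L j" if "i \<le> j" for i j using lift_Suc_mono_le[of L, OF L(4) that] .
  have "\<exists>k. \<forall>i \<ge> k. ann T (L i) x = ann T (L k) x"
    by (rule noetherian_ring_acc[OF noe]) (use ideal_ann[OF g L(1) x] L(4) in \<open>auto simp: ann_def\<close>)
  then obtain k where k: "\<And>i. i \<ge> k \<Longrightarrow> ann T (L i) x = ann T (L k) x" by blast
  have "L i \<subseteq> L k" if i: "i \<ge> k" for i
  proof
    fix z assume z: "z \<in> L i"
    then obtain p t where pt: "z = p \<boxplus> t \<boxdot> x" "p \<in> P" "t \<in> T" using L(3) unfolding plus_cyclic_def by blast
    have c: "t \<boxdot> x \<in> carrier N" using generatesD(5)[OF g pt(3)] x by simp
    have "t \<boxdot> x \<in> L i" using opsub_add_iff[OF L(1) _ c, of p i] L(2) z pt by blast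
    then have "t \<boxdot> x \<in> L k" using k[OF i] pt(3) unfolding ann_def by blast
    then show "z \<in> L k" using pt opsub_add[OF L(1)] L(2) by blast
  qed
  then show "\<exists>k. \<forall>i \<ge> k. L i = L k" using mono by (intro exI[of _ k]) blast
qed

lemma noeth_finitely_generated:
  assumes g: "generates Y T" and noe: "noetherian_ring (S\<lparr>carrier := T\<rparr>)"
    and "finite Z" "Z \<subseteq> carrier N"
  shows "\<exists>P. opsub Y P \<and> Z \<subseteq> P \<and> noeth Y {\<zero>\<^bsub>N\<^esub>} P"
  using assms(3,4)
proof (induction Z rule: finite_induct)
  case empty
  have "noeth Y {\<zero>\<^bsub>N\<^esub>} {\<zero>\<^bsub>N\<^esub>}"
    by (rule noethI) (metis subset_antisym)
  moreover have "opsub Y {\<zero>\<^bsub>N\<^esub>}" using opsub_zero_set generatesD[OF g] by blast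
  ultimately show ?case by blast
next
  case (insert x Z)
  then obtain P where P: "opsub Y P" "Z \<subseteq> P" "noeth Y {\<zero>\<^bsub>N\<^esub>} P" by blast
  have x: "x \<in> carrier N" using insert by auto
  note pc = plus_cyclic[OF g P(1) x]
  have "noeth Y {\<zero>\<^bsub>N\<^esub>} (plus_cyclic P T x)"
    using noeth_trans[OF P(3) noeth_plus_cyclic[OF g noe P(1) x] P(1) pc(1)] pc(2)
      generatesD[OF g] opsub_zero[OF P(1)] by blast
  then show ?case using pc P by blast
qed

section \<open>Associated primes\<close>

definition assq :: "'b set \<Rightarrow> 'b set \<Rightarrow> 'a set set" where
  "assq P Q = {p. primeideal p (S\<lparr>carrier := A0\<rparr>) \<and> (\<exists>x \<in> Q. p = ann A0 P x)}"

lemma ann_eq_A0: "opsub Y P \<Longrightarrow> x \<in> P \<Longrightarrow> ann A0 P x = A0"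
  unfolding ann_def using opsub_A0 by auto

lemma assqE:
  assumes "p \<in> assq P Q" "opsub Y P"
  obtains x where "x \<in> Q" "x \<notin> P" "p = ann A0 P x" "primeideal p (S\<lparr>carrier := A0\<rparr>)"
proof -
  obtain x where x: "x \<in> Q" "p = ann A0 P x" "primeideal p (S\<lparr>carrier := A0\<rparr>)"
    using assms unfolding assq_def by auto
  moreover have "x \<notin> P" using ann_eq_A0[OF assms(2)] primeideal.I_notcarr[OF x(3)] x(2) by auto
  ultimately show thesis using that by blast
qed

text \<open>Let \<open>p\<close> be the annihilator of \<open>x\<close> modulo \<open>P\<close>. If
  some multiple \<open>a \<boxdot> x\<close> lies in \<open>P1\<close> but not in \<open>P\<close>,
  then \<open>a \<notin> p\<close>, and primeness gives \<open>a \<boxdot> x\<close> the same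
  annihilator \<open>p\<close>. If there is no such multiple, the annihilators of \<open>x\<close>
  modulo \<open>P\<close> and modulo \<open>P1\<close> agree.\<close>

lemma assq_split:
  assumes o: "opsub {} P" "opsub {} P1" "opsub {} Q" and "P \<subseteq> P1" "P1 \<subseteq> Q"
  shows "assq P Q \<subseteq> assq P P1 \<union> assq P1 Q"
proof
  fix p assume "p \<in> assq P Q"
  then obtain x where x: "x \<in> Q" "p = ann A0 P x" "primeideal p (S\<lparr>carrier := A0\<rparr>)"
    using assqE[OF _ o(1)] by metis
  have xc: "x \<in> carrier N" using x opsub_carrier o by blast
  show "p \<in> assq P P1 \<union> assq P1 Q"
  proof (cases "\<exists>a \<in> A0. a \<boxdot> x \<in> P1 \<and> a \<boxdot> x \<notin> P")
    case True
    then obtain a where a: "a \<in> A0" "a \<boxdot> x \<in> P1" "a \<boxdot> x \<notin> P" by blast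
    have ap: "a \<notin> p" using a x unfolding ann_def by blast
    have "b \<in> p \<longleftrightarrow> b \<boxdot> a \<boxdot> x \<in> P" if b: "b \<in> A0" for b
    proof -
      have e: "b \<boxdot> a \<boxdot> x = (b \<otimes> a) \<boxdot> x" using A0_carrier a b xc by (simp add: smult_assoc1)
      have "b \<otimes> a \<in> A0" using subringE(6)[OF A0_subring] a b by blast
      then have "b \<boxdot> a \<boxdot> x \<in> P \<longleftrightarrow> b \<otimes> a \<in> p" using e x unfolding ann_def by auto
      also have "\<dots> \<longleftrightarrow> b \<in> p"
        using primeideal.I_prime[OF x(3), of b a] ideal.I_r_closed[OF primeideal.axioms(1)[OF x(3)], of b a]
          a b ap by auto
      finally show ?thesis by blast
    qed
    then have "p = ann A0 P (a \<boxdot> x)" using x(2) unfolding ann_def by auto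
    then show ?thesis unfolding assq_def using a x by blast
  next
    case False
    then have "p = ann A0 P1 x" using x assms unfolding ann_def by blast
    then show ?thesis unfolding assq_def using x by blast
  qed
qed

text \<open>A maximal element \<open>p\<close> among the annihilators of elements outside \<open>P\<close> is the only associated
  prime of \<open>{x. p x \<subseteq> P} / P\<close>, whatever the ring acting besides \<open>A0\<close>.\<close>

theorem finite_assq:
  assumes noe: "noetherian_ring (S\<lparr>carrier := A0\<rparr>)" and Y: "Y \<subseteq> carrier S"
    and n: "noeth Y P Q" and o: "opsub Y P" "opsub Y Q" and "P \<subseteq> Q"
  shows "finite (assq P Q)"
  using n o(1) assms(6)
proof (rule noeth_induct)
  fix L assume L: "opsub Y L" "P \<subseteq> L" "L \<subseteq> Q"
    and IH: "\<And>L'. opsub Y L' \<Longrightarrow> L \<subset> L' \<Longrightarrow> L' \<subseteq> Q \<Longrightarrow> finite (assq L' Q)"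
  note cL = opsub_carrier[OF L(1)] and cQ = opsub_carrier[OF o(2)]
  show "finite (assq L Q)"
  proof (cases "L = Q")
    case True
    then have "assq L Q = {}" using assqE[OF _ L(1)] by blast
    then show ?thesis by simp
  next
    case False
    have "\<exists>I \<in> ann A0 L ` (Q - L). \<forall>J \<in> ann A0 L ` (Q - L). I \<subseteq> J \<longrightarrow> J = I"
      using False L cQ ideal_ann[OF generates_A0 opsub_base[OF L(1)]]
      by (intro noetherian_ring_maximal[OF noe]) auto
    then obtain I where I: "I \<in> ann A0 L ` (Q - L)" "\<forall>J \<in> ann A0 L ` (Q - L). I \<subseteq> J \<longrightarrow> J = I"
      by (elim bexE)
    obtain x where xQL: "x \<in> Q - L" and Ix: "I = ann A0 L x" using I(1) by (elim imageE)
    have max: "ann A0 L z = ann A0 L x" if "z \<in> Q" "z \<notin> L" "ann A0 L x \<subseteq> ann A0 L z" for z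
      using I(2) imageI[of z "Q - L" "ann A0 L"] that unfolding Ix by simp
    note x = DiffD1[OF xQL] DiffD2[OF xQL] max
    define p where "p = ann A0 L x"
    \<comment> \<open>The annihilators are ideals of \<open>A0\<close>, while the induction runs
      over \<open>Y\<close>-stable submodules; \<open>L'\<close> is one of these because
      \<open>Y\<close> commutes with \<open>p\<close>. Hence \<open>Q / P\<close> may be far from
      noetherian over \<open>A0\<close>.\<close>
    define L' where "L' = {z \<in> Q. \<forall>a \<in> p. a \<boxdot> z \<in> L}"
    have pA: "a \<in> carrier S" if "a \<in> p" for a using that A0_carrier unfolding p_def ann_def by blast
    have oL': "opsub Y L'"
    proof (rule opsubI)
      show "L' \<subseteq> carrier N" unfolding L'_def using cQ by auto
      show "\<zero>\<^bsub>N\<^esub> \<in> L'" unfolding L'_def using opsub_zero[OF o(2)] opsub_zero[OF L(1)] pA by auto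
      show "z \<boxplus> w \<in> L'" if "z \<in> L'" "w \<in> L'" for z w
        using that opsub_add[OF o(2)] opsub_add[OF L(1)] cQ pA unfolding L'_def by (auto simp: smult_r_distr)
      have sm: "a \<boxdot> z \<in> L'" if "a \<in> A0 \<union> Y" "z \<in> L'" for a z
      proof -
        have "a \<in> carrier S" using that Y A0_carrier by blast
        moreover have "a \<boxdot> z \<in> Q" using that o(2) unfolding L'_def opsub_def by auto
        moreover have "a \<boxdot> b \<boxdot> z \<in> L" if "b \<in> p" for b
          using that \<open>a \<in> A0 \<union> Y\<close> \<open>z \<in> L'\<close> L(1) unfolding L'_def opsub_def by auto
        ultimately show ?thesis using that cQ pA smult_comm[of _ a z] unfolding L'_def by auto
      qed
      show "a \<boxdot> z \<in> L'" if "a \<in> A0" "z \<in> L'" for a z using sm that by blast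
      show "a \<boxdot> z \<in> L'" if "a \<in> Y" "z \<in> L'" for a z using sm that by blast
    qed
    have "x \<in> L'" using x unfolding L'_def p_def ann_def by auto
    moreover have "L \<subseteq> L'" using L(3) opsub_A0[OF L(1)] unfolding L'_def p_def ann_def by auto
    ultimately have "L \<subset> L'" using x by blast
    moreover have "L' \<subseteq> Q" unfolding L'_def by auto
    ultimately have fin: "finite (assq L' Q)" using IH oL' by blast
    have "assq L L' \<subseteq> {p}"
    proof
      fix q assume "q \<in> assq L L'"
      then obtain z where z: "z \<in> L'" "z \<notin> L" "q = ann A0 L z" using assqE[OF _ L(1)] by metis
      then have "p \<subseteq> q" unfolding L'_def p_def ann_def by auto
      then show "q \<in> {p}" using x(3)[of z] z unfolding L'_def p_def by auto
    qed
    then have "finite (assq L L')" by (rule finite_subset) auto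
    then show ?thesis
      using fin assq_split[OF opsub_base[OF L(1)] opsub_base[OF oL'] opsub_base[OF o(2)] \<open>L \<subseteq> L'\<close> \<open>L' \<subseteq> Q\<close>]
      by (meson finite_Un finite_subset)
  qed
qed

end

section \<open>Adjoining one operator\<close>

context operator_module
begin

text \<open>\<open>adj y M\<close> is the submodule \<open>M + yM + y\<^sup>2M + \<dots>\<close>, filtered by \<open>adjF y M i = M + \<dots> + y\<^sup>i\<^sup>-\<^sup>1M\<close>;
  the factor number \<open>i\<close> of this filtration is isomorphic to \<open>M / adjK y M i\<close>.\<close>

primrec adjF :: "'a \<Rightarrow> 'b set \<Rightarrow> nat \<Rightarrow> 'b set" where
  "adjF y M 0 = {\<zero>\<^bsub>N\<^esub>}"
| "adjF y M (Suc i) = plus_mult (adjF y M i) (y [^] i) M"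

definition adjK :: "'a \<Rightarrow> 'b set \<Rightarrow> nat \<Rightarrow> 'b set" where
  "adjK y M i = pre_mult (y [^] i) (adjF y M i) M"

definition adj :: "'a \<Rightarrow> 'b set \<Rightarrow> 'b set" where
  "adj y M = (\<Union>i. adjF y M i)"

context
  fixes Y y M
  assumes Y: "Y \<subseteq> carrier S" and y: "y \<in> carrier S" and M: "opsub Y M"
begin

lemma ypow: "y [^] (i :: nat) \<in> carrier S"
  using y by simp

lemma M_carrier: "m \<in> M \<Longrightarrow> m \<in> carrier N"
  using opsub_carrier[OF M] .

lemma opsub_adjF: "opsub Y (adjF y M i)"
proof (induction i)
  case 0 show ?case using opsub_zero_set[OF Y] by simp
next
  case (Suc i) then show ?case using opsub_plus_mult[OF Suc M ypow Y] by simp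
qed

lemma adjF_Suc: "adjF y M i \<subseteq> adjF y M (Suc i)"
  using plus_mult_left[OF opsub_adjF M ypow] by simp

lemma adjF_mono: "i \<le> j \<Longrightarrow> adjF y M i \<subseteq> adjF y M j"
  using lift_Suc_mono_le[of "adjF y M", OF adjF_Suc] .

lemma adjF_1: "adjF y M (Suc 0) = M"
proof -
  have "plus_mult {\<zero>\<^bsub>N\<^esub>} \<one> M = M"
    unfolding plus_mult_def using M_carrier by force
  then show ?thesis by simp
qed

lemma adjF_smult: "x \<in> adjF y M i \<Longrightarrow> y \<boxdot> x \<in> adjF y M (Suc i)"
proof (induction i arbitrary: x)
  case 0
  then show ?case using y opsub_zero[OF opsub_adjF] by (simp del: adjF.simps(2))
next
  case (Suc i)
  then obtain p m where pm: "x = p \<boxplus> (y [^] i) \<boxdot> m" "p \<in> adjF y M i" "m \<in> M"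
    unfolding adjF.simps plus_mult_def by blast
  have c: "p \<in> carrier N" "m \<in> carrier N"
    using opsub_carrier[OF opsub_adjF pm(2)] M_carrier[OF pm(3)] .
  have "y \<boxdot> x = y \<boxdot> p \<boxplus> (y [^] Suc i) \<boxdot> m"
    using c pm(1) y by (simp add: smult_r_distr smult_assoc1 smult_comm)
  then show ?case
    using Suc.IH[OF pm(2)] pm(3) unfolding adjF.simps(2)[of y M "Suc i"] plus_mult_def by blast
qed

lemma opsub_adj: "opsub (insert y Y) (adj y M)"
proof (rule opsubI)
  show "adj y M \<subseteq> carrier N" unfolding adj_def using opsub_subset[OF opsub_adjF] by blast
  show "\<zero>\<^bsub>N\<^esub> \<in> adj y M" unfolding adj_def using opsub_zero[OF opsub_adjF] by blast
  show "x \<boxplus> z \<in> adj y M" if xz: "x \<in> adj y M" "z \<in> adj y M" for x z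
  proof -
    obtain i j where ij: "x \<in> adjF y M i" "z \<in> adjF y M j" using xz unfolding adj_def by blast
    then have "x \<in> adjF y M (max i j)" "z \<in> adjF y M (max i j)"
      using adjF_mono[of i "max i j"] adjF_mono[of j "max i j"] by auto
    then show ?thesis unfolding adj_def using opsub_add[OF opsub_adjF] by blast
  qed
  show "a \<boxdot> x \<in> adj y M" if "a \<in> A0" "x \<in> adj y M" for a x
    using that opsub_A0[OF opsub_adjF] unfolding adj_def by blast
  show "a \<boxdot> x \<in> adj y M" if "a \<in> insert y Y" "x \<in> adj y M" for a x
    using that opsub_op[OF opsub_adjF] adjF_smult unfolding adj_def by blast
qed

lemma adjF_adj: "adjF y M i \<subseteq> adj y M"
  unfolding adj_def by blast

lemma M_adj: "M \<subseteq> adj y M"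
  using adjF_adj[of "Suc 0"] unfolding adjF_1 .

lemma opsub_adjK: "opsub Y (adjK y M i)"
  unfolding adjK_def using opsub_pre_mult[OF opsub_adjF M ypow Y] .

lemma adjK_subset: "adjK y M i \<subseteq> M"
  unfolding adjK_def pre_mult_def by auto

lemma adjK_Suc: "adjK y M i \<subseteq> adjK y M (Suc i)"
proof
  fix m assume "m \<in> adjK y M i"
  then have m: "m \<in> M" "(y [^] i) \<boxdot> m \<in> adjF y M i" unfolding adjK_def pre_mult_def by auto
  have "(y [^] Suc i) \<boxdot> m = y \<boxdot> (y [^] i) \<boxdot> m"
    using M_carrier[OF m(1)] y by (simp add: smult_assoc1 smult_comm)
  then show "m \<in> adjK y M (Suc i)"
    using m adjF_smult[OF m(2)] unfolding adjK_def pre_mult_def by (simp del: nat_pow_Suc adjF.simps)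
qed

lemma adjK_stable:
  assumes "noeth Y {\<zero>\<^bsub>N\<^esub>} M"
  shows "\<exists>k. \<forall>i \<ge> k. adjK y M i = adjK y M k"
  by (rule noethD[where L = "adjK y M", OF assms opsub_adjK _ adjK_subset adjK_Suc]) (use opsub_zero[OF opsub_adjK] in auto)

lemma assq_adj:
  assumes n: "noeth Y {\<zero>\<^bsub>N\<^esub>} M" and noe: "noetherian_ring (S\<lparr>carrier := A0\<rparr>)"
  shows "finite (assq M (adj y M))"
proof -
  \<comment> \<open>The class of \<open>f \<boxplus> (y [^] i) \<boxdot> m\<close> corresponds to
    the class of \<open>m\<close> in \<open>M / adjK y M i\<close>, with the same
    annihilator.\<close>
  have factor: "assq (adjF y M i) (adjF y M (Suc i)) \<subseteq> assq (adjK y M i) M" for i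
  proof
    fix p assume "p \<in> assq (adjF y M i) (adjF y M (Suc i))"
    then obtain x where x: "x \<in> adjF y M (Suc i)" "p = ann A0 (adjF y M i) x" "primeideal p (S\<lparr>carrier := A0\<rparr>)"
      unfolding assq_def by blast
    then obtain f m where fm: "x = f \<boxplus> (y [^] i) \<boxdot> m" "f \<in> adjF y M i" "m \<in> M"
      unfolding adjF.simps plus_mult_def by blast
    have c: "f \<in> carrier N" "m \<in> carrier N"
      using opsub_carrier[OF opsub_adjF fm(2)] M_carrier[OF fm(3)] .
    have "a \<boxdot> x \<in> adjF y M i \<longleftrightarrow> a \<boxdot> m \<in> adjK y M i" if a: "a \<in> A0" for a
    proof -
      have ac: "a \<in> carrier S" using A0_carrier[OF a] .
      have "a \<boxdot> x = a \<boxdot> f \<boxplus> (y [^] i) \<boxdot> a \<boxdot> m"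
        using c fm(1) ac ypow by (simp add: smult_r_distr smult_comm)
      moreover have "a \<boxdot> f \<in> adjF y M i" using opsub_A0[OF opsub_adjF a fm(2)] .
      ultimately have "a \<boxdot> x \<in> adjF y M i \<longleftrightarrow> (y [^] i) \<boxdot> a \<boxdot> m \<in> adjF y M i"
        using opsub_add_iff[OF opsub_adjF] c ac ypow by simp
      then show ?thesis unfolding adjK_def pre_mult_def using opsub_A0[OF M a fm(3)] by simp
    qed
    then have "p = ann A0 (adjK y M i) m" using x(2) unfolding ann_def by blast
    then show "p \<in> assq (adjK y M i) M" using x(3) fm(3) unfolding assq_def by blast
  qed
  have filt: "assq M (adjF y M (Suc i)) \<subseteq> (\<Union>j. assq (adjK y M j) M)" for i
  proof (induction i)
    case 0
    have "assq M (adjF y M (Suc 0)) = {}" using assqE[OF _ M] unfolding adjF_1 by blast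
    then show ?case by blast
  next
    case (Suc i)
    have "assq M (adjF y M (Suc (Suc i))) \<subseteq>
        assq M (adjF y M (Suc i)) \<union> assq (adjF y M (Suc i)) (adjF y M (Suc (Suc i)))"
      using adjF_mono[of "Suc 0" "Suc i"] unfolding adjF_1
      by (intro assq_split opsub_base[OF opsub_adjF] opsub_base[OF M] adjF_Suc) auto
    then show ?case using Suc factor by blast
  qed
  \<comment> \<open>The union adds no primes: a witness for \<open>p\<close> already lies in some
    finite stage \<open>adjF y M i\<close>.\<close>
  have "assq M (adj y M) \<subseteq> (\<Union>j. assq (adjK y M j) M)"
  proof
    fix p assume "p \<in> assq M (adj y M)"
    then obtain x i where x: "x \<in> adjF y M i" "p = ann A0 M x" "primeideal p (S\<lparr>carrier := A0\<rparr>)"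
      unfolding assq_def adj_def by blast
    then have "p \<in> assq M (adjF y M (Suc i))" using adjF_Suc unfolding assq_def by blast
    then show "p \<in> (\<Union>j. assq (adjK y M j) M)" using filt by blast
  qed
  moreover have "finite (\<Union>j. assq (adjK y M j) M)"
  proof -
    obtain k where k: "\<And>i. i \<ge> k \<Longrightarrow> adjK y M i = adjK y M k" using adjK_stable[OF n] by blast
    have fin: "finite (assq (adjK y M j) M)" for j
    proof (rule finite_assq[OF noe Y _ opsub_adjK M adjK_subset])
      show "noeth Y (adjK y M j) M"
        by (rule noeth_mono[OF n]) (use opsub_zero[OF opsub_adjK] in auto)
    qed
    have "(\<Union>j. assq (adjK y M j) M) = (\<Union>j \<in> {..k}. assq (adjK y M j) M)"
    proof -
      have "\<exists>j' \<in> {..k}. adjK y M j = adjK y M j'" for j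
        using k[of j] by (cases "j \<le> k") auto
      then show ?thesis by (metis (no_types, lifting) SUP_eq UNIV_I order_refl)
    qed
    then show ?thesis using fin by simp
  qed
  ultimately show ?thesis by (rule finite_subset)
qed

text \<open>As in Hilbert's basis theorem, a submodule \<open>L\<close> of \<open>adj y M\<close> is controlled by the modules of
  leading coefficients \<open>{m \<in> M. y\<^sup>i m \<in> adjF y M i + L}\<close>.\<close>

theorem noeth_adj:
  assumes n: "noeth Y {\<zero>\<^bsub>N\<^esub>} M"
  shows "noeth (insert y Y) {\<zero>\<^bsub>N\<^esub>} (adj y M)"
proof (rule noethI)
  fix L :: "nat \<Rightarrow> 'b set"
  assume L: "\<And>i. opsub (insert y Y) (L i)" "\<And>i. {\<zero>\<^bsub>N\<^esub>} \<subseteq> L i" "\<And>i. L i \<subseteq> adj y M" "\<And>i. L i \<subseteq> L (Suc i)"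
  have LY: "opsub Y (L i)" for i using opsub_antimono[OF L(1)] by blast
  have Lmono: "L i \<subseteq> L j" if "i \<le> j" for i j using lift_Suc_mono_le[of L, OF L(4) that] .
  \<comment> \<open>\<open>C j i\<close> collects the leading coefficients in front of
    \<open>y [^] i\<close> of elements of \<open>L j\<close>, up to terms of lower order. It
    increases with \<open>j\<close>, and also with \<open>i\<close> because \<open>L j\<close> is
    stable under \<open>y\<close>.\<close>
  define C where "C j i = pre_mult (y [^] i) (plus_mult (adjF y M i) \<one> (L j)) M" for j i :: nat
  have oP: "opsub Y (plus_mult (adjF y M i) \<one> (L j))" for i j
    using opsub_plus_mult[OF opsub_adjF LY _ Y] by simp
  have oC: "opsub Y (C j i)" for j i
    unfolding C_def using opsub_pre_mult[OF oP M ypow Y] .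
  have CM: "C j i \<subseteq> M" for j i unfolding C_def pre_mult_def by auto
  have C0: "{\<zero>\<^bsub>N\<^esub>} \<subseteq> C j i" for j i using opsub_zero[OF oC] by simp
  have C1: "C j i \<subseteq> C (Suc j) i" for j i
    unfolding C_def pre_mult_def using plus_mult_mono[OF order_refl L(4)] by blast
  have C2: "C j i \<subseteq> C j (Suc i)" for j i
  proof
    fix m assume "m \<in> C j i"
    then have m: "m \<in> M" "(y [^] i) \<boxdot> m \<in> plus_mult (adjF y M i) \<one> (L j)"
      unfolding C_def pre_mult_def by auto
    then obtain f l where fl: "(y [^] i) \<boxdot> m = f \<boxplus> \<one> \<boxdot> l" "f \<in> adjF y M i" "l \<in> L j"
      unfolding plus_mult_def by blast
    have c: "f \<in> carrier N" "l \<in> carrier N" "m \<in> carrier N"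
      using opsub_carrier[OF opsub_adjF fl(2)] opsub_carrier[OF LY fl(3)] M_carrier[OF m(1)] .
    have "(y [^] Suc i) \<boxdot> m = y \<boxdot> (y [^] i) \<boxdot> m"
      using c y by (simp add: smult_assoc1 smult_comm)
    also have "\<dots> = y \<boxdot> f \<boxplus> \<one> \<boxdot> y \<boxdot> l"
      unfolding fl(1) using c y by (simp add: smult_r_distr)
    finally have e: "(y [^] Suc i) \<boxdot> m = y \<boxdot> f \<boxplus> \<one> \<boxdot> y \<boxdot> l" .
    moreover have "y \<boxdot> f \<in> adjF y M (Suc i)" "y \<boxdot> l \<in> L j"
      using adjF_smult[OF fl(2)] opsub_op[OF L(1) _ fl(3)] by blast+
    ultimately have "(y [^] Suc i) \<boxdot> m \<in> plus_mult (adjF y M (Suc i)) \<one> (L j)"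
      unfolding plus_mult_def by blast
    then show "m \<in> C j (Suc i)" unfolding C_def pre_mult_def using m(1) by blast
  qed
  have Cj: "C j i \<subseteq> C j' i" if "j \<le> j'" for j j' i
    using lift_Suc_mono_le[of "\<lambda>j. C j i", OF C1 that] .
  have Ci: "C j i \<subseteq> C j i'" if "i \<le> i'" for j i i'
    using lift_Suc_mono_le[of "C j", OF C2 that] .
  \<comment> \<open>The diagonal becomes stationary at \<open>k0\<close>, which controls all columns
    \<open>i \<ge> k0\<close> at once. The finitely many columns below \<open>k0\<close> are
    stabilised one by one, and \<open>k\<close> is the maximum of all these bounds.\<close>
  have "\<exists>k. \<forall>i \<ge> k. C i i = C k k"
    by (rule noethD[where L = "\<lambda>i. C i i", OF n oC C0 CM]) (use C1 C2 in blast)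
  then obtain k0 where k0: "\<And>i. i \<ge> k0 \<Longrightarrow> C i i = C k0 k0" by blast
  have "\<forall>i. \<exists>k. \<forall>j \<ge> k. C j i = C k i"
    using noethD[where L = "\<lambda>j. C j i" for i, OF n oC C0 CM C1] by blast
  then obtain kk where kk: "\<And>i j. j \<ge> kk i \<Longrightarrow> C j i = C (kk i) i" by metis
  define k where "k = Max (insert k0 (kk ` {..<k0}))"
  have kge: "k0 \<le> k" "\<And>i. i < k0 \<Longrightarrow> kk i \<le> k" unfolding k_def by auto
  have Ck: "C j i \<subseteq> C k i" if j: "j \<ge> k" for j i
  proof (cases "i < k0")
    case True
    then show ?thesis using kk[of i j] kk[of i k] kge(2)[OF True] j by simp
  next
    case False
    have "C j i \<subseteq> C (max j i) (max j i)" using Cj[of j "max j i" i] Ci[of i "max j i" "max j i"] by simp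
    also have "\<dots> = C k0 k0" using k0[of "max j i"] False by simp
    also have "\<dots> \<subseteq> C k i" using Cj[OF kge(1), of k0] Ci[of k0 i k] False by simp
    finally show ?thesis .
  qed
  \<comment> \<open>Induction on the order in \<open>y\<close>: since the leading coefficients
    agree, subtracting a suitable \<open>l \<in> L k\<close> from \<open>z\<close> lowers the
    order.\<close>
  have main: "L j \<inter> adjF y M i \<subseteq> L k" if j: "j \<ge> k" for j i
  proof (induction i)
    case 0 show ?case using L(2) by auto
  next
    case (Suc i)
    show ?case
    proof
      fix z assume z: "z \<in> L j \<inter> adjF y M (Suc i)"
      then obtain f m where fm: "z = f \<boxplus> (y [^] i) \<boxdot> m" "f \<in> adjF y M i" "m \<in> M"
        unfolding adjF.simps plus_mult_def by blast
      have zL: "z \<in> L j" using z by blast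
      have c: "f \<in> carrier N" "m \<in> carrier N" "z \<in> carrier N"
        using opsub_carrier[OF opsub_adjF fm(2)] M_carrier[OF fm(3)] opsub_carrier[OF LY zL] .
      have ym: "(y [^] i) \<boxdot> m \<in> carrier N" using c ypow by simp
      have "(y [^] i) \<boxdot> m = \<ominus>\<^bsub>N\<^esub> f \<boxplus> \<one> \<boxdot> z"
        using c ym unfolding fm(1) by (simp add: M.r_neg1)
      moreover have "\<ominus>\<^bsub>N\<^esub> f \<in> adjF y M i" using opsub_uminus[OF opsub_adjF fm(2)] .
      ultimately have "m \<in> C j i" unfolding C_def pre_mult_def plus_mult_def using fm(3) zL by blast
      then have "m \<in> C k i" using Ck[OF j] by blast
      then obtain f' l where fl: "(y [^] i) \<boxdot> m = f' \<boxplus> \<one> \<boxdot> l" "f' \<in> adjF y M i" "l \<in> L k"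
        unfolding C_def pre_mult_def plus_mult_def by blast
      have c': "f' \<in> carrier N" "l \<in> carrier N"
        using opsub_carrier[OF opsub_adjF fl(2)] opsub_carrier[OF LY fl(3)] .
      have lj: "l \<in> L j" using Lmono[OF j] fl(3) by blast
      have "z \<boxminus> l = f \<boxplus> f'"
        unfolding fm(1) fl(1) using c(1) c' by (simp add: a_minus_def M.a_assoc M.r_neg)
      then have "z \<boxminus> l \<in> L j \<inter> adjF y M i"
        using opsub_add[OF opsub_adjF fm(2) fl(2)] opsub_minus[OF LY zL lj] by simp
      then have "z \<boxminus> l \<in> L k" using Suc by blast
      then show "z \<in> L k" using opsub_minus_iff[OF LY fl(3) c(3)] by blast
    qed
  qed
  have "L j = L k" if j: "j \<ge> k" for j
  proof
    show "L k \<subseteq> L j" using Lmono[OF j] .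
    show "L j \<subseteq> L k" using L(3)[of j] main[OF j] unfolding adj_def by blast
  qed
  then show "\<exists>k. \<forall>i \<ge> k. L i = L k" by blast
qed

end

end

section \<open>Homogeneous components\<close>

locale graded_operator_module = operator_module S N "GS 0"
  for S :: "('a, 'm) ring_scheme" (structure) and N :: "('a, 'b, 'n) module_scheme" (structure)
    and GS :: "nat \<Rightarrow> 'a set" +
  fixes GN :: "int \<Rightarrow> 'b set"
  assumes GS_carrier: "\<And>n a. a \<in> GS n \<Longrightarrow> a \<in> carrier S"
    and GS_mult: "\<And>m n a b. a \<in> GS m \<Longrightarrow> b \<in> GS n \<Longrightarrow> a \<otimes> b \<in> GS (m + n)"
    and GS_decomp: "\<And>a. a \<in> carrier S \<Longrightarrow> \<exists>c. homog_decomp S GS a c"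
    and GN_subgroup: "\<And>n. subgroup (GN n) (add_monoid N)"
    and GN_smult: "\<And>m n a x. a \<in> GS m \<Longrightarrow> x \<in> GN n \<Longrightarrow> a \<boxdot> x \<in> GN (int m + n)"
    and GN_decomp: "\<And>x. x \<in> carrier N \<Longrightarrow> \<exists>!c. homog_decomp N GN x c"
begin

definition hcomp :: "int \<Rightarrow> 'b \<Rightarrow> 'b" where
  "hcomp n x = (THE c. homog_decomp N GN x c) n"

definition homog :: "'b set \<Rightarrow> bool" where
  "homog P \<longleftrightarrow> (\<forall>x \<in> P. \<forall>n. hcomp n x \<in> P)"

lemma opsub_GN: "opsub {} (GN n)"
  unfolding opsub_def using GN_subgroup GN_smult[of _ 0 _ n] by auto

lemma GN_carrier: "x \<in> GN n \<Longrightarrow> x \<in> carrier N"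
  using opsub_carrier[OF opsub_GN] .

lemma GN_zero: "\<zero>\<^bsub>N\<^esub> \<in> GN n"
  using opsub_zero[OF opsub_GN] .

lemma homog_decompI:
  assumes "\<And>n. c n \<in> GN n" "finite F" "\<And>n. n \<notin> F \<Longrightarrow> c n = \<zero>\<^bsub>N\<^esub>"
  shows "homog_decomp N GN (finsum N c F) c"
proof -
  have sub: "{n. c n \<noteq> \<zero>\<^bsub>N\<^esub>} \<subseteq> F" using assms(3) by blast
  have "finsum N c {n. c n \<noteq> \<zero>\<^bsub>N\<^esub>} = finsum N c F"
    by (rule M.add.finprod_mono_neutral_cong_left) (use sub assms GN_carrier[OF assms(1)] in auto)
  then show ?thesis unfolding homog_decomp_def using assms(1) finite_subset[OF sub assms(2)] by simp
qed

lemma hcomp_eq: "x \<in> carrier N \<Longrightarrow> homog_decomp N GN x c \<Longrightarrow> hcomp n x = c n"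
  unfolding hcomp_def using the1_equality[OF GN_decomp] by metis

lemma hcomp_decomp: "x \<in> carrier N \<Longrightarrow> homog_decomp N GN x (\<lambda>n. hcomp n x)"
  unfolding hcomp_def using theI'[OF GN_decomp] by simp

lemma hcomp_GN: "x \<in> carrier N \<Longrightarrow> hcomp n x \<in> GN n"
  using hcomp_decomp unfolding homog_decomp_def by blast

lemma hcomp_carrier: "x \<in> carrier N \<Longrightarrow> hcomp n x \<in> carrier N"
  using hcomp_GN GN_carrier by blast

lemma finite_hcomp: "x \<in> carrier N \<Longrightarrow> finite {n. hcomp n x \<noteq> \<zero>\<^bsub>N\<^esub>}"
  using hcomp_decomp unfolding homog_decomp_def by blast

lemma hcomp_homogeneous:
  assumes "x \<in> GN d" shows "hcomp n x = (if n = d then x else \<zero>\<^bsub>N\<^esub>)"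
proof -
  let ?c = "\<lambda>n. if n = d then x else \<zero>\<^bsub>N\<^esub>"
  have "finsum N ?c {d} = x" using GN_carrier[OF assms] by simp
  moreover have "homog_decomp N GN (finsum N ?c {d}) ?c"
    by (rule homog_decompI) (use assms GN_zero in auto)
  ultimately show ?thesis using hcomp_eq[OF GN_carrier[OF assms]] by simp
qed

lemma hcomp_add:
  assumes x: "x \<in> carrier N" and z: "z \<in> carrier N"
  shows "hcomp n (x \<boxplus> z) = hcomp n x \<boxplus> hcomp n z"
proof -
  let ?F = "{n. hcomp n x \<noteq> \<zero>\<^bsub>N\<^esub>} \<union> {n. hcomp n z \<noteq> \<zero>\<^bsub>N\<^esub>}"
  have F: "finite ?F" using finite_hcomp x z by blast
  have c: "hcomp n x \<in> carrier N" "hcomp n z \<in> carrier N" for n using hcomp_carrier x z by auto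
  have sx: "finsum N (\<lambda>n. hcomp n w) ?F = w" if w: "w \<in> carrier N" and sub: "{n. hcomp n w \<noteq> \<zero>\<^bsub>N\<^esub>} \<subseteq> ?F" for w
  proof -
    have "finsum N (\<lambda>n. hcomp n w) {n. hcomp n w \<noteq> \<zero>\<^bsub>N\<^esub>} = finsum N (\<lambda>n. hcomp n w) ?F"
      by (rule M.add.finprod_mono_neutral_cong_left) (use F sub hcomp_carrier[OF w] in auto)
    then show ?thesis using hcomp_decomp[OF w] unfolding homog_decomp_def by simp
  qed
  have "finsum N (\<lambda>n. hcomp n x \<boxplus> hcomp n z) ?F = x \<boxplus> z"
    using M.finsum_addf[of "\<lambda>n. hcomp n x" ?F "\<lambda>n. hcomp n z"] c sx[OF x] sx[OF z] by auto
  moreover have "homog_decomp N GN (finsum N (\<lambda>n. hcomp n x \<boxplus> hcomp n z) ?F) (\<lambda>n. hcomp n x \<boxplus> hcomp n z)"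
    by (rule homog_decompI) (use F hcomp_GN[OF x] hcomp_GN[OF z] opsub_add[OF opsub_GN] in auto)
  ultimately show ?thesis using hcomp_eq[of "x \<boxplus> z"] x z by simp
qed

lemma hcomp_zero [simp]: "hcomp n \<zero>\<^bsub>N\<^esub> = \<zero>\<^bsub>N\<^esub>"
  using hcomp_homogeneous[OF GN_zero] by simp

lemma finsum_hcomp:
  assumes "x \<in> carrier N" shows "finsum N (\<lambda>n. hcomp n x) {n. hcomp n x \<noteq> \<zero>\<^bsub>N\<^esub>} = x"
  using hcomp_decomp[OF assms] unfolding homog_decomp_def by simp

lemma homogeneous_induct:
  assumes x: "x \<in> carrier N" and zero: "\<Phi> \<zero>\<^bsub>N\<^esub>"
    and add: "\<And>x z. x \<in> carrier N \<Longrightarrow> z \<in> carrier N \<Longrightarrow> \<Phi> x \<Longrightarrow> \<Phi> z \<Longrightarrow> \<Phi> (x \<boxplus> z)"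
    and hom: "\<And>n. \<Phi> (hcomp n x)"
  shows "\<Phi> x"
proof -
  have "\<Phi> (finsum N (\<lambda>n. hcomp n x) F)" if "finite F" for F
    using that
  proof (induction F rule: finite_induct)
    case empty then show ?case using zero by simp
  next
    case (insert n F)
    then show ?case using hom add hcomp_carrier[OF x] by (simp add: Pi_def)
  qed
  then show ?thesis using finsum_hcomp[OF x] finite_hcomp[OF x] by metis
qed

lemma hcomp_smult:
  assumes a: "a \<in> GS k" and x: "x \<in> carrier N"
  shows "hcomp n (a \<boxdot> x) = a \<boxdot> hcomp (n - int k) x"
proof (rule homogeneous_induct[OF x])
  note ac = GS_carrier[OF a]
  show "hcomp n (a \<boxdot> \<zero>\<^bsub>N\<^esub>) = a \<boxdot> hcomp (n - int k) \<zero>\<^bsub>N\<^esub>" using ac by simp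
  show "hcomp n (a \<boxdot> (z \<boxplus> w)) = a \<boxdot> hcomp (n - int k) (z \<boxplus> w)"
    if "z \<in> carrier N" "w \<in> carrier N" "hcomp n (a \<boxdot> z) = a \<boxdot> hcomp (n - int k) z"
      "hcomp n (a \<boxdot> w) = a \<boxdot> hcomp (n - int k) w" for z w
    using that ac hcomp_carrier by (simp add: smult_r_distr hcomp_add)
  fix j
  have "a \<boxdot> hcomp j x \<in> GN (int k + j)" using GN_smult[OF a hcomp_GN[OF x]] .
  then show "hcomp n (a \<boxdot> hcomp j x) = a \<boxdot> hcomp (n - int k) (hcomp j x)"
    using hcomp_homogeneous[of "a \<boxdot> hcomp j x"] hcomp_homogeneous[OF hcomp_GN[OF x], of "n - int k" j] ac
    by auto
qed

lemma mem_of_hcomp: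
  assumes P: "opsub Y P" and x: "x \<in> carrier N" and "\<And>n. hcomp n x \<in> P" shows "x \<in> P"
  using x by (rule homogeneous_induct) (use opsub_zero[OF P] opsub_add[OF P] assms in auto)

lemma homogD: "homog P \<Longrightarrow> x \<in> P \<Longrightarrow> hcomp n x \<in> P"
  unfolding homog_def by blast

lemma homog_subsetI:
  assumes "opsub Y P" "homog P" "opsub Z Q" "\<And>n. P \<inter> GN n \<subseteq> Q"
  shows "P \<subseteq> Q"
proof
  fix x assume x: "x \<in> P"
  have xc: "x \<in> carrier N" using opsub_carrier[OF assms(1) x] .
  show "x \<in> Q"
    using mem_of_hcomp[OF assms(3) xc] homogD[OF assms(2) x] hcomp_GN[OF xc] assms(4) by blast
qed

lemma homog_zero_set: "homog {\<zero>\<^bsub>N\<^esub>}"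
  unfolding homog_def by simp

lemma homog_carrier: "homog (carrier N)"
  unfolding homog_def using hcomp_carrier by simp

lemma homog_Int: "homog P \<Longrightarrow> homog Q \<Longrightarrow> homog (P \<inter> Q)"
  unfolding homog_def by blast

lemma homog_UN: "(\<And>i. homog (P i)) \<Longrightarrow> homog (\<Union>i. P i)"
  unfolding homog_def by blast

lemma homog_plus_mult:
  assumes "homog P" "homog Q" "s \<in> GS k" "opsub Y P" "opsub Z Q"
  shows "homog (plus_mult P s Q)"
  unfolding homog_def
proof (intro ballI allI)
  fix x n assume "x \<in> plus_mult P s Q"
  then obtain p q where pq: "x = p \<boxplus> s \<boxdot> q" "p \<in> P" "q \<in> Q" unfolding plus_mult_def by blast
  have c: "p \<in> carrier N" "q \<in> carrier N" "s \<in> carrier S"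
    using opsub_carrier[OF assms(4) pq(2)] opsub_carrier[OF assms(5) pq(3)] GS_carrier[OF assms(3)] .
  have "hcomp n x = hcomp n p \<boxplus> s \<boxdot> hcomp (n - int k) q"
    unfolding pq(1) using c hcomp_smult[OF assms(3)] by (simp add: hcomp_add)
  then show "hcomp n x \<in> plus_mult P s Q"
    using homogD[OF assms(1) pq(2)] homogD[OF assms(2) pq(3)] unfolding plus_mult_def by blast
qed

lemma homog_pre_mult:
  assumes "homog P" "homog Q" "s \<in> GS k" "opsub Z Q"
  shows "homog (pre_mult s P Q)"
  unfolding homog_def
proof (intro ballI allI)
  fix x n assume "x \<in> pre_mult s P Q"
  then have x: "x \<in> Q" "s \<boxdot> x \<in> P" unfolding pre_mult_def by auto
  have xc: "x \<in> carrier N" using opsub_carrier[OF assms(4) x(1)] .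
  have "s \<boxdot> hcomp n x = hcomp (n + int k) (s \<boxdot> x)" using hcomp_smult[OF assms(3) xc] by simp
  then show "hcomp n x \<in> pre_mult s P Q"
    using homogD[OF assms(1) x(2)] homogD[OF assms(2) x(1)] unfolding pre_mult_def by auto
qed

text \<open>Taking a homogeneous piece commutes with sums and, in \<open>pre_mult_piece\<close>,
  with colons, so \<open>len_plus_mult\<close> can be applied degree by degree. The shift by
  \<open>k\<close> is the degree of \<open>s\<close>.\<close>

lemma plus_mult_piece:
  assumes "homog P" "homog Q" "s \<in> GS k" "opsub Y P" "opsub Z Q"
  shows "plus_mult P s Q \<inter> GN (int k + n) = plus_mult (P \<inter> GN (int k + n)) s (Q \<inter> GN n)"
proof
  show "plus_mult (P \<inter> GN (int k + n)) s (Q \<inter> GN n) \<subseteq> plus_mult P s Q \<inter> GN (int k + n)"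
  proof
    fix x assume "x \<in> plus_mult (P \<inter> GN (int k + n)) s (Q \<inter> GN n)"
    then obtain p q where pq: "x = p \<boxplus> s \<boxdot> q" "p \<in> P" "p \<in> GN (int k + n)" "q \<in> Q" "q \<in> GN n"
      unfolding plus_mult_def by blast
    have "x \<in> GN (int k + n)"
      unfolding pq(1) using opsub_add[OF opsub_GN pq(3) GN_smult[OF assms(3) pq(5)]] .
    then show "x \<in> plus_mult P s Q \<inter> GN (int k + n)" using pq unfolding plus_mult_def by blast
  qed
  show "plus_mult P s Q \<inter> GN (int k + n) \<subseteq> plus_mult (P \<inter> GN (int k + n)) s (Q \<inter> GN n)"
  proof
    fix x assume x: "x \<in> plus_mult P s Q \<inter> GN (int k + n)"
    then obtain p q where pq: "x = p \<boxplus> s \<boxdot> q" "p \<in> P" "q \<in> Q" unfolding plus_mult_def by blast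
    have c: "p \<in> carrier N" "q \<in> carrier N" "s \<in> carrier S"
      using opsub_carrier[OF assms(4) pq(2)] opsub_carrier[OF assms(5) pq(3)] GS_carrier[OF assms(3)] .
    have "x = hcomp (int k + n) x" using hcomp_homogeneous[of x "int k + n"] x by simp
    also have "\<dots> = hcomp (int k + n) p \<boxplus> s \<boxdot> hcomp n q"
      unfolding pq(1) using c hcomp_smult[OF assms(3)] by (simp add: hcomp_add)
    finally show "x \<in> plus_mult (P \<inter> GN (int k + n)) s (Q \<inter> GN n)"
      using homogD[OF assms(1) pq(2)] homogD[OF assms(2) pq(3)] hcomp_GN[OF c(1)] hcomp_GN[OF c(2)]
      unfolding plus_mult_def by blast
  qed
qed

lemma pre_mult_piece:
  assumes "s \<in> GS k"
  shows "pre_mult s P Q \<inter> GN n = pre_mult s (P \<inter> GN (int k + n)) (Q \<inter> GN n)"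
  unfolding pre_mult_def using GN_smult[OF assms] by blast

lemma opsub_piece: "opsub Y P \<Longrightarrow> opsub {} (P \<inter> GN n)"
  using opsub_Int[OF _ opsub_GN, of Y P] by simp

definition glen :: "'b set \<Rightarrow> 'b set \<Rightarrow> int \<Rightarrow> enat" where
  "glen P Q n = len (P \<inter> GN n) (Q \<inter> GN n)"

lemma glen_add:
  assumes "opsub Y1 P" "opsub Y2 Q" "opsub Y3 R" "P \<subseteq> Q" "Q \<subseteq> R"
  shows "glen P R n = glen P Q n + glen Q R n"
  unfolding glen_def using assms(4,5)
  by (intro len_add opsub_piece[OF assms(1)] opsub_piece[OF assms(2)] opsub_piece[OF assms(3)]) auto

lemma glen_mono:
  assumes "opsub Y1 P" "opsub Y2 P'" "opsub Y3 Q'" "opsub Y4 Q" "P \<subseteq> P'" "P' \<subseteq> Q'" "Q' \<subseteq> Q"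
  shows "glen P' Q' n \<le> glen P Q n"
  unfolding glen_def using assms(5-7)
  by (intro len_mono opsub_piece[OF assms(1)] opsub_piece[OF assms(2)] opsub_piece[OF assms(3)]
      opsub_piece[OF assms(4)]) auto

lemma glen_plus_mult:
  assumes "homog P" "homog Q" "s \<in> GS k" "opsub Y P" "opsub Z Q"
  shows "glen P (plus_mult P s Q) (int k + n) = glen (pre_mult s P Q) Q n"
  unfolding glen_def plus_mult_piece[OF assms] pre_mult_piece[OF assms(3)]
  using len_plus_mult[OF opsub_piece[OF assms(4)] opsub_piece[OF assms(5)] GS_carrier[OF assms(3)]] .

lemma glen_eq_0: "opsub Y P \<Longrightarrow> P \<inter> GN n = Q \<inter> GN n \<Longrightarrow> glen P Q n = 0"
  unfolding glen_def using len_self[OF opsub_piece] by metis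

end

section \<open>Eventually polynomial functions\<close>

definition evpoly :: "(int \<Rightarrow> rat) \<Rightarrow> bool" where
  "evpoly f \<longleftrightarrow> (\<exists>p n0. \<forall>n \<ge> n0. f n = poly p (of_int n))"

lemma evpolyI: "(\<And>n. n \<ge> n0 \<Longrightarrow> f n = poly p (of_int n)) \<Longrightarrow> evpoly f"
  unfolding evpoly_def by blast

lemma evpoly_zero: "(\<And>n. n \<ge> n0 \<Longrightarrow> f n = 0) \<Longrightarrow> evpoly f"
  by (rule evpolyI[of n0 f 0]) simp

lemma evpoly_add:
  assumes "evpoly f" "evpoly g" shows "evpoly (\<lambda>n. f n + g n)"
proof -
  obtain p a q b where "\<And>n. n \<ge> a \<Longrightarrow> f n = poly p (of_int n)" "\<And>n. n \<ge> b \<Longrightarrow> g n = poly q (of_int n)"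
    using assms unfolding evpoly_def by blast
  then show ?thesis by (intro evpolyI[of "max a b" _ "p + q"]) auto
qed

lemma evpoly_diff:
  assumes "evpoly f" "evpoly g" shows "evpoly (\<lambda>n. f n - g n)"
proof -
  obtain p a q b where "\<And>n. n \<ge> a \<Longrightarrow> f n = poly p (of_int n)" "\<And>n. n \<ge> b \<Longrightarrow> g n = poly q (of_int n)"
    using assms unfolding evpoly_def by blast
  then show ?thesis by (intro evpolyI[of "max a b" _ "p - q"]) auto
qed

lemma evpoly_shift:
  assumes "evpoly f" shows "evpoly (\<lambda>n. f (n + c))"
proof -
  obtain p a where p: "\<And>n. n \<ge> a \<Longrightarrow> f n = poly p (of_int n)"
    using assms unfolding evpoly_def by blast
  show ?thesis
  proof (rule evpolyI[of "a - c" _ "pcompose p [:of_int c, 1:]"])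
    fix n assume "n \<ge> a - c"
    then show "f (n + c) = poly (pcompose p [:of_int c, 1:]) (of_int n)"
      using p[of "n + c"] by (simp add: poly_pcompose add.commute)
  qed
qed

text \<open>The difference of \<open>x ^ Suc d\<close> is \<open>Suc d\<close> times
  \<open>x ^ d\<close> plus lower powers. Those have antidifferences by induction; subtract them and
  divide by \<open>Suc d\<close>.\<close>

lemma power_antidifference: "\<exists>q :: rat poly. \<forall>x. poly q (x + 1) - poly q x = x ^ d"
proof (induction d rule: less_induct)
  case (less d)
  then obtain q where q: "\<And>k x. k < d \<Longrightarrow> poly (q k) (x + 1) - poly (q k) x = (x :: rat) ^ k" by metis
  define r where "r = smult (1 / of_nat (Suc d))
    (monom 1 (Suc d) - (\<Sum>k<d. smult (of_nat (Suc d choose k)) (q k)))"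
  have "poly r (x + 1) - poly r x = x ^ d" for x
  proof -
    have "(x + 1) ^ Suc d = (\<Sum>k\<le>Suc d. of_nat (Suc d choose k) * x ^ k)"
      using binomial_ring[of x 1 "Suc d"] by simp
    also have "\<dots> = x ^ Suc d + of_nat (Suc d) * x ^ d + (\<Sum>k<d. of_nat (Suc d choose k) * x ^ k)"
      by (simp add: lessThan_Suc_atMost[symmetric] del: binomial_Suc_Suc)
    finally have e: "(x + 1) ^ Suc d - x ^ Suc d - (\<Sum>k<d. of_nat (Suc d choose k) * x ^ k)
        = of_nat (Suc d) * x ^ d" by simp
    have "(\<Sum>k<d. of_nat (Suc d choose k) * x ^ k) =
        (\<Sum>k<d. of_nat (Suc d choose k) * poly (q k) (x + 1)) - (\<Sum>k<d. of_nat (Suc d choose k) * poly (q k) x)"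
      unfolding sum_subtractf[symmetric] by (rule sum.cong) (use q in \<open>auto simp: right_diff_distrib[symmetric]\<close>)
    then have "(x + 1) ^ Suc d - x ^ Suc d - (\<Sum>k<d. of_nat (Suc d choose k) * x ^ k) =
        ((x + 1) ^ Suc d - (\<Sum>k<d. of_nat (Suc d choose k) * poly (q k) (x + 1))) -
        (x ^ Suc d - (\<Sum>k<d. of_nat (Suc d choose k) * poly (q k) x))"
      by (simp del: binomial_Suc_Suc of_nat_Suc power_Suc)
    then have "poly r (x + 1) - poly r x = (1 / of_nat (Suc d)) *
        ((x + 1) ^ Suc d - x ^ Suc d - (\<Sum>k<d. of_nat (Suc d choose k) * x ^ k))"
      unfolding r_def poly_smult poly_diff poly_sum poly_monom right_diff_distrib[symmetric] by simp
    then show ?thesis unfolding e by (simp del: of_nat_Suc)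
  qed
  then show ?case by blast
qed

lemma poly_antidifference: "\<exists>q :: rat poly. \<forall>x. poly q (x + 1) - poly q x = poly p x"
proof -
  obtain q where q: "\<And>d x. poly (q d) (x + 1) - poly (q d) x = (x :: rat) ^ d"
    using power_antidifference by metis
  have "poly (\<Sum>i\<le>degree p. smult (coeff p i) (q i)) (x + 1) - poly (\<Sum>i\<le>degree p. smult (coeff p i) (q i)) x
      = poly p x" for x
    unfolding poly_sum poly_altdef[of p x] sum_subtractf[symmetric]
    by (rule sum.cong) (use q in \<open>auto simp: right_diff_distrib[symmetric]\<close>)
  then show ?thesis by blast
qed

lemma evpoly_antidifference:
  assumes "evpoly (\<lambda>n. f (n + 1) - f n)" shows "evpoly f"
proof -
  obtain p a where p: "\<And>n. n \<ge> a \<Longrightarrow> f (n + 1) - f n = poly p (of_int n)"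
    using assms unfolding evpoly_def by blast
  obtain q where q: "\<And>x. poly q (x + 1) - poly q x = poly p x" using poly_antidifference by blast
  have "f n = poly (q + [:f a - poly q (of_int a):]) (of_int n)" if "n \<ge> a" for n
    using that
  proof (induction n rule: int_ge_induct)
    case (step n)
    then show ?case using p[of n] q[of "of_int n"] by simp
  qed simp
  then show ?thesis by (rule evpolyI)
qed

lemma evpoly_cong: "(\<And>n. f n = g n) \<Longrightarrow> evpoly f \<Longrightarrow> evpoly g"
  unfolding evpoly_def by simp

section \<open>Hilbert functions\<close>

context graded_operator_module
begin

definition fin_quot :: "'b set \<Rightarrow> 'b set \<Rightarrow> bool" where
  "fin_quot P Q \<longleftrightarrow> (\<forall>n. glen P Q n \<noteq> \<infinity>)"

text \<open>The value at an infinite length is meaningless, so additivity is stated under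
  \<open>fin_quot\<close>.\<close>

definition hilb :: "'b set \<Rightarrow> 'b set \<Rightarrow> int \<Rightarrow> rat" where
  "hilb P Q n = of_nat (the_enat (glen P Q n))"

lemma fin_quot_sub:
  assumes "opsub Y1 P" "opsub Y2 P'" "opsub Y3 Q'" "opsub Y4 Q" "P \<subseteq> P'" "P' \<subseteq> Q'" "Q' \<subseteq> Q" "fin_quot P Q"
  shows "fin_quot P' Q'"
  unfolding fin_quot_def
proof
  fix n
  have "glen P' Q' n \<le> glen P Q n" by (rule glen_mono[OF assms(1-7)])
  then show "glen P' Q' n \<noteq> \<infinity>" using assms(8) unfolding fin_quot_def by (metis enat_ord_simps(5))
qed

lemma hilb_add:
  assumes "opsub Y1 P" "opsub Y2 Q" "opsub Y3 R" "P \<subseteq> Q" "Q \<subseteq> R" "fin_quot P R"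
  shows "hilb P R n = hilb P Q n + hilb Q R n"
proof -
  have "glen P R n = glen P Q n + glen Q R n" by (rule glen_add[OF assms(1-5)])
  moreover have "glen P R n \<noteq> \<infinity>" using assms(6) unfolding fin_quot_def by blast
  ultimately show ?thesis unfolding hilb_def
    by (cases "glen P Q n"; cases "glen Q R n") auto
qed

lemma hilb_plus_mult:
  assumes "homog P" "homog Q" "s \<in> GS k" "opsub Y P" "opsub Z Q"
  shows "hilb P (plus_mult P s Q) (int k + n) = hilb (pre_mult s P Q) Q n"
  unfolding hilb_def glen_plus_mult[OF assms] ..

text \<open>The Hilbert-Serre argument, by induction on the operators. Multiplication by
  \<open>y\<close> on \<open>Q / P\<close> has kernel \<open>K / P\<close> and cokernel
  \<open>Q / C\<close>, both killed by \<open>y\<close> and thus covered by the induction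
  hypothesis. The exact sequence expresses the difference of the Hilbert function through these
  two.\<close>

theorem evpoly_hilb:
  assumes "finite Y" "Y \<subseteq> GS 1" "opsub Y P" "opsub Y Q" "homog P" "homog Q" "P \<subseteq> Q"
    "noeth Y P Q" "fin_quot P Q"
  shows "evpoly (hilb P Q)"
  using assms
proof (induction Y arbitrary: P Q rule: finite_induct)
  case empty
  \<comment> \<open>Without operators of positive degree, a condition on the components above degree
    \<open>k\<close> defines a submodule. The chain condition then bounds the degrees in which
    \<open>Q / P\<close> is nonzero.\<close>
  define L where "L k = {x \<in> Q. \<forall>n > int k. hcomp n x \<in> P}" for k :: nat
  note cP = opsub_carrier[OF empty(2)] and cQ = opsub_carrier[OF empty(3)]
  have "\<exists>k. \<forall>i \<ge> k. L i = L k"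
  proof (rule noethD[OF empty(7)])
    fix k
    show "opsub {} (L k)"
    proof (rule opsubI)
      show "L k \<subseteq> carrier N" unfolding L_def using cQ by blast
      show "\<zero>\<^bsub>N\<^esub> \<in> L k" unfolding L_def using opsub_zero[OF empty(3)] opsub_zero[OF empty(2)] by simp
      show "x \<boxplus> z \<in> L k" if "x \<in> L k" "z \<in> L k" for x z
        using that opsub_add[OF empty(3)] opsub_add[OF empty(2)] cQ unfolding L_def by (simp add: hcomp_add)
      show "a \<boxdot> x \<in> L k" if "a \<in> GS 0" "x \<in> L k" for a x
        using that opsub_A0[OF empty(3)] opsub_A0[OF empty(2)] cQ hcomp_smult[of a 0] unfolding L_def by simp
    qed simp
    show "P \<subseteq> L k" unfolding L_def using empty(6) homogD[OF empty(4)] by blast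
    show "L k \<subseteq> Q" "L k \<subseteq> L (Suc k)" unfolding L_def by auto
  qed
  then obtain k where k: "\<And>i. i \<ge> k \<Longrightarrow> L i = L k" by blast
  have "hilb P Q n = 0" if n: "n \<ge> int k + 1" for n
  proof -
    have "x \<in> P" if x: "x \<in> Q" "x \<in> GN n" for x
    proof -
      have "x \<in> L (nat n)"
        unfolding L_def using x n hcomp_homogeneous[OF x(2)] opsub_zero[OF empty(2)] by simp
      then have "x \<in> L k" using k[of "nat n"] n by simp
      then have "hcomp n x \<in> P" using n unfolding L_def by simp
      then show ?thesis using hcomp_homogeneous[OF x(2), of n] by simp
    qed
    then have "P \<inter> GN n = Q \<inter> GN n" using empty(6) by blast
    then show ?thesis unfolding hilb_def using glen_eq_0[OF empty(2)] by (simp add: zero_enat_def)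
  qed
  then show ?case by (rule evpoly_zero)
next
  case (insert y Y)
  let ?Y = "insert y Y"
  define K where "K = pre_mult y P Q"
  define C where "C = plus_mult P y Q"
  have y: "y \<in> GS 1" and yc: "y \<in> carrier S" and Yc: "?Y \<subseteq> carrier S"
    using insert.prems(1) GS_carrier by auto
  note oP = insert.prems(2) and oQ = insert.prems(3)
  have oK: "opsub ?Y K" unfolding K_def using opsub_pre_mult[OF oP oQ yc Yc] .
  have oC: "opsub ?Y C" unfolding C_def using opsub_plus_mult[OF oP oQ yc Yc] .
  have hK: "homog K" unfolding K_def using homog_pre_mult[OF insert.prems(4,5) y oQ] .
  have hC: "homog C" unfolding C_def using homog_plus_mult[OF insert.prems(4,5) y oP oQ] .
  have PK: "P \<subseteq> K" unfolding K_def pre_mult_def using insert.prems(6) opsub_op[OF oP] by auto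
  have KQ: "K \<subseteq> Q" unfolding K_def pre_mult_def by auto
  have PC: "P \<subseteq> C" unfolding C_def using plus_mult_left[OF oP oQ yc] .
  have yQ: "y \<boxdot> x \<in> C" if "x \<in> Q" for x unfolding C_def using plus_mult_right[OF oP oQ yc that] .
  have CQ: "C \<subseteq> Q"
    unfolding C_def using plus_mult_least[OF oQ insert.prems(6), of Q y] opsub_op[OF oQ] by blast
  have closed: "opsub ?Y L" if "opsub Y L" "\<And>x. x \<in> L \<Longrightarrow> y \<boxdot> x \<in> L" for L
    using that unfolding opsub_def by blast
  have Y1: "Y \<subseteq> GS 1" using insert.prems(1) by blast
  have sub: "opsub Y P" "opsub Y Q" "opsub Y K" "opsub Y C"
    using opsub_antimono[OF oP] opsub_antimono[OF oQ] opsub_antimono[OF oK] opsub_antimono[OF oC] by blast+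
  have evK: "evpoly (hilb P K)"
  proof (rule insert.IH[OF Y1 sub(1,3) insert.prems(4) hK PK])
    \<comment> \<open>Between \<open>P\<close> and \<open>K\<close> multiplication by
      \<open>y\<close> lands in \<open>P\<close>, so stability under \<open>y\<close> is automatic
      and the chain condition survives the loss of this operator. Between \<open>C\<close> and
      \<open>Q\<close> the same holds because \<open>C\<close> contains \<open>yQ\<close>.\<close>
    show "noeth Y P K"
    proof (rule noeth_mono[OF insert.prems(7) order_refl KQ])
      fix L assume L: "opsub Y L" "P \<subseteq> L" "L \<subseteq> K"
      show "opsub ?Y L" by (rule closed[OF L(1)]) (use L in \<open>auto simp: K_def pre_mult_def\<close>)
    qed
    show "fin_quot P K" using fin_quot_sub[OF oP oP oK oQ order_refl PK KQ insert.prems(8)] .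
  qed
  have evC: "evpoly (hilb C Q)"
  proof (rule insert.IH[OF Y1 sub(4,2) hC insert.prems(5) CQ])
    show "noeth Y C Q"
    proof (rule noeth_mono[OF insert.prems(7) PC order_refl])
      fix L assume L: "opsub Y L" "C \<subseteq> L" "L \<subseteq> Q"
      show "opsub ?Y L" by (rule closed[OF L(1)]) (use L yQ in blast)
    qed
    show "fin_quot C Q" using fin_quot_sub[OF oP oC oQ oQ PC CQ order_refl insert.prems(8)] .
  qed
  have diff: "hilb P Q (n + 1) - hilb P Q n = hilb C Q (n + 1) - hilb P K n" for n
  proof -
    have "hilb P Q (n + 1) = hilb P C (n + 1) + hilb C Q (n + 1)"
      by (rule hilb_add[OF oP oC oQ PC CQ insert.prems(8)])
    moreover have "hilb P C (n + 1) = hilb K Q n"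
      unfolding C_def K_def using hilb_plus_mult[OF insert.prems(4,5) y oP oQ, of n] by (simp add: add.commute)
    moreover have "hilb P Q n = hilb P K n + hilb K Q n"
      by (rule hilb_add[OF oP oK oQ PK KQ insert.prems(8)])
    ultimately show ?thesis by simp
  qed
  show ?case
    by (rule evpoly_antidifference) (unfold diff, rule evpoly_diff[OF evpoly_shift[OF evC] evK])
qed

lemma GS_pow: "y \<in> GS 1 \<Longrightarrow> y [^] i \<in> GS i"
proof (induction i)
  case 0 then show ?case using subringE(3)[OF A0_subring] by simp
next
  case (Suc i) then show ?case using GS_mult[of "y [^] i" i y 1] by simp
qed

section \<open>The Hilbert function of one adjunction\<close>

context
  fixes Y y M
  assumes Y: "Y \<subseteq> GS 1" and y: "y \<in> GS 1" and M: "opsub Y M" "homog M"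
begin

lemma Y_carrier: "Y \<subseteq> carrier S" and y_carrier: "y \<in> carrier S"
  using Y y GS_carrier by auto

lemmas adj_rules = Y_carrier y_carrier M(1)

lemma homog_adjF: "homog (adjF y M i)"
proof (induction i)
  case 0 show ?case using homog_zero_set by simp
next
  case (Suc i)
  then show ?case using homog_plus_mult[OF Suc M(2) GS_pow[OF y] opsub_adjF[OF adj_rules] M(1)] by simp
qed

lemma homog_adj: "homog (adj y M)"
  unfolding adj_def using homog_UN[OF homog_adjF] .

lemma homog_adjK: "homog (adjK y M i)"
  unfolding adjK_def using homog_pre_mult[OF homog_adjF M(2) GS_pow[OF y] M(1)] .

lemma glen_adjF: "glen (adjF y M i) (adjF y M (Suc i)) (int i + n) = glen (adjK y M i) M n"
  unfolding adjK_def adjF.simps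
  using glen_plus_mult[OF homog_adjF M(2) GS_pow[OF y] opsub_adjF[OF adj_rules] M(1)] .

text \<open>The index \<open>0\<close> must be excluded: \<open>adjK y M 0\<close> is zero, so that
  factor is all of \<open>M\<close>, whose pieces may have infinite length.\<close>

lemma fin_quot_adjK:
  assumes "fin_quot M (adj y M)" "i \<ge> 1"
  shows "fin_quot (adjK y M i) M"
proof -
  have "M \<subseteq> adjF y M i"
    using adjF_mono[OF adj_rules, of "Suc 0" i] adjF_1[OF adj_rules] assms(2) by simp
  then have "fin_quot (adjF y M i) (adjF y M (Suc i))"
    using fin_quot_sub[OF M(1) opsub_adjF[OF adj_rules] opsub_adjF[OF adj_rules] opsub_adj[OF adj_rules]
        _ adjF_Suc[OF adj_rules] adjF_adj[OF adj_rules] assms(1)] by simp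
  then show ?thesis unfolding fin_quot_def using glen_adjF[of i] by metis
qed

lemma adjK_stable_pos:
  assumes "noeth Y {\<zero>\<^bsub>N\<^esub>} M"
  shows "\<exists>k \<ge> 1. \<forall>i \<ge> k. adjK y M i = adjK y M k"
proof -
  obtain k where k: "\<forall>i \<ge> k. adjK y M i = adjK y M k" using adjK_stable[OF adj_rules assms] by blast
  have "adjK y M i = adjK y M (Suc k)" if "i \<ge> Suc k" for i
    using k[rule_format, of i] k[rule_format, of "Suc k"] that by simp
  then show ?thesis using le_add1[of 1 k, unfolded plus_1_eq_Suc] by blast
qed

text \<open>Applied at \<open>Suc k\<close>, this is the surjective half of an isomorphism:
  multiplication by \<open>y\<close> carries \<open>adj y M / adjF y M k\<close> onto
  \<open>adj y M / adjF y M (Suc k)\<close> and shifts degrees by one.\<close>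

lemma adj_eq_plus_mult:
  assumes "k \<ge> 1"
  shows "plus_mult (adjF y M k) y (adj y M) = adj y M"
proof
  have oadj: "opsub Y (adj y M)" using opsub_antimono[OF opsub_adj[OF adj_rules]] by blast
  note oF = opsub_adjF[OF adj_rules]
  show "plus_mult (adjF y M k) y (adj y M) \<subseteq> adj y M"
    using plus_mult_least[OF oadj adjF_adj[OF adj_rules]] opsub_op[OF opsub_adj[OF adj_rules]] by blast
  let ?R = "plus_mult (adjF y M k) y (adj y M)"
  have oR: "opsub Y ?R" using opsub_plus_mult[OF oF oadj y_carrier Y_carrier] .
  have MR: "M \<subseteq> ?R"
    using plus_mult_left[OF oF oadj y_carrier, of k] adjF_mono[OF adj_rules, of "Suc 0" k]
      adjF_1[OF adj_rules] assms by auto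
  have "adjF y M i \<subseteq> ?R" for i
  proof (induction i)
    case 0 then show ?case using opsub_zero[OF oR] by simp
  next
    case (Suc i)
    have "(y [^] i) \<boxdot> m \<in> ?R" if m: "m \<in> M" for m
    proof (cases i)
      case 0 then show ?thesis using m MR opsub_carrier[OF M(1) m] by auto
    next
      case (Suc j)
      have mc: "m \<in> carrier N" using opsub_carrier[OF M(1) m] .
      have "(y [^] j) \<boxdot> m \<in> adjF y M (Suc j)"
        using plus_mult_right[OF oF M(1) _ m, of "y [^] j" j] y_carrier by simp
      then have "(y [^] j) \<boxdot> m \<in> adj y M" using adjF_adj[OF adj_rules] by blast
      then have "y \<boxdot> (y [^] j) \<boxdot> m \<in> ?R" using plus_mult_right[OF oF oadj y_carrier] by blast
      moreover have "y \<boxdot> (y [^] j) \<boxdot> m = (y [^] i) \<boxdot> m"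
        unfolding Suc using mc y_carrier by (simp add: smult_assoc1 smult_comm)
      ultimately show ?thesis by simp
    qed
    then show ?case unfolding adjF.simps using plus_mult_least[OF oR Suc.IH, of M "y [^] i"] by blast
  qed
  then show "adj y M \<subseteq> ?R" unfolding adj_def by blast
qed

text \<open>The injective half. If \<open>y \<boxdot> x\<close> lies in
  \<open>adjF y M (Suc k)\<close> and \<open>x\<close> has a top term
  \<open>(y [^] i) \<boxdot> m\<close> with \<open>i \<ge> k\<close>, then \<open>m\<close> lies in
  \<open>adjK y M (Suc i) = adjK y M i\<close>, so this term is already of lower order. Repeating
  this brings \<open>x\<close> down to \<open>adjF y M k\<close>.\<close>

lemma adj_pre_mult:
  assumes k: "\<And>i. i \<ge> k \<Longrightarrow> adjK y M i = adjK y M k"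
  shows "pre_mult y (adjF y M (Suc k)) (adj y M) = adjF y M k"
proof
  show "adjF y M k \<subseteq> pre_mult y (adjF y M (Suc k)) (adj y M)"
    unfolding pre_mult_def using adjF_adj[OF adj_rules] adjF_smult[OF adj_rules] by blast
  note oF = opsub_adjF[OF adj_rules]
  have "y \<boxdot> x \<in> adjF y M (Suc k) \<Longrightarrow> x \<in> adjF y M j \<Longrightarrow> x \<in> adjF y M k" for x j
  proof (induction j)
    case 0 then show ?case using adjF_mono[OF adj_rules, of 0 k] by blast
  next
    case (Suc i)
    show ?case
    proof (cases "Suc i \<le> k")
      case True then show ?thesis using adjF_mono[OF adj_rules True] Suc.prems by blast
    next
      case False
      obtain f m where fm: "x = f \<boxplus> (y [^] i) \<boxdot> m" "f \<in> adjF y M i" "m \<in> M"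
        using Suc.prems unfolding adjF.simps plus_mult_def by blast
      have c: "f \<in> carrier N" "m \<in> carrier N"
        using opsub_carrier[OF oF fm(2)] opsub_carrier[OF M(1) fm(3)] .
      have "y \<boxdot> x = y \<boxdot> f \<boxplus> (y [^] Suc i) \<boxdot> m"
        unfolding fm(1) using c y_carrier by (simp add: smult_r_distr smult_assoc1 smult_comm)
      moreover have "y \<boxdot> x \<in> adjF y M (Suc i)"
        using Suc.prems(1) adjF_mono[OF adj_rules, of "Suc k" "Suc i"] False by auto
      ultimately have "(y [^] Suc i) \<boxdot> m \<in> adjF y M (Suc i)"
        using opsub_add_iff[OF oF adjF_smult[OF adj_rules fm(2)]] c(2) y_carrier by simp
      then have "m \<in> adjK y M (Suc i)" unfolding adjK_def pre_mult_def using fm(3) by blast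
      then have "m \<in> adjK y M i" using k[of i] k[of "Suc i"] False by simp
      then have "x \<in> adjF y M i"
        unfolding fm(1) adjK_def pre_mult_def using opsub_add[OF oF fm(2)] by blast
      then show ?thesis using Suc.IH[OF Suc.prems(1)] by blast
    qed
  qed
  then show "pre_mult y (adjF y M (Suc k)) (adj y M) \<subseteq> adjF y M k"
    unfolding pre_mult_def adj_def by blast
qed

text \<open>Infinitely many factors remain beyond stage \<open>k\<close>, but they are shifts of one
  another. Multiplication by \<open>y\<close> turns their sum into a difference equation for
  \<open>hilb (adjF y M k) (adj y M)\<close> whose right-hand side is the Hilbert function of a
  single factor, up to a shift.\<close>

theorem evpoly_hilb_adj:
  assumes finY: "finite Y" and n: "noeth Y {\<zero>\<^bsub>N\<^esub>} M" and fin: "fin_quot M (adj y M)"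
  shows "evpoly (hilb M (adj y M))"
proof -
  obtain k where k: "k \<ge> 1" "\<And>i. i \<ge> k \<Longrightarrow> adjK y M i = adjK y M k"
    using adjK_stable_pos[OF n] by blast
  note oF = opsub_adjF[OF adj_rules] and oadj = opsub_adj[OF adj_rules]
  have MF: "M \<subseteq> adjF y M (Suc i)" for i
    using adjF_mono[OF adj_rules, of "Suc 0" "Suc i"] adjF_1[OF adj_rules] by simp
  have evK: "evpoly (hilb (adjK y M i) M)" if "i \<ge> 1" for i
  proof (rule evpoly_hilb[OF finY Y opsub_adjK[OF adj_rules] M(1) homog_adjK M(2) adjK_subset[OF adj_rules]])
    show "noeth Y (adjK y M i) M"
      by (rule noeth_mono[OF n]) (use opsub_zero[OF opsub_adjK[OF adj_rules]] in auto)
    show "fin_quot (adjK y M i) M" using fin_quot_adjK[OF fin that] .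
  qed
  have hF: "hilb (adjF y M i) (adjF y M (Suc i)) n = hilb (adjK y M i) M (n + (- int i))" for i n
    unfolding hilb_def using glen_adjF[of i "n - int i"] by simp
  have evF: "evpoly (hilb (adjF y M i) (adjF y M (Suc i)))" if "i \<ge> 1" for i
    unfolding hF by (rule evpoly_shift[OF evK[OF that]])
  have finF: "fin_quot M (adjF y M (Suc i))" for i
    using fin_quot_sub[OF M(1) M(1) oF oadj order_refl MF adjF_adj[OF adj_rules] fin] .
  have evMF: "evpoly (hilb M (adjF y M (Suc i)))" for i
  proof (induction i)
    case 0
    have "hilb M (adjF y M (Suc 0)) n = 0" for n
      unfolding adjF_1[OF adj_rules] hilb_def using glen_eq_0[OF M(1)] by (simp add: zero_enat_def)
    then show ?case by (intro evpoly_zero)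
  next
    case (Suc i)
    show ?case
      by (rule evpoly_cong[OF _ evpoly_add[OF Suc evF[of "Suc i"]]])
         (use hilb_add[OF M(1) oF oF MF adjF_Suc[OF adj_rules] finF] in simp_all)
  qed
  have pm: "pre_mult y (adjF y M (Suc k)) (adj y M) = adjF y M k"
    by (rule adj_pre_mult) (rule k(2))
  have Suck: "1 \<le> Suc k" by simp
  have fink: "fin_quot (adjF y M k) (adj y M)"
    using fin_quot_sub[OF M(1) oF oadj oadj _ adjF_adj[OF adj_rules] order_refl fin] MF[of "k - 1"] k(1) by simp
  have "hilb (adjF y M k) (adj y M) (n + 1) - hilb (adjF y M k) (adj y M) n
      = hilb (adjF y M k) (adjF y M (Suc k)) (n + 1)" for n
  proof -
    have "hilb (adjF y M k) (adj y M) (n + 1)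
        = hilb (adjF y M k) (adjF y M (Suc k)) (n + 1) + hilb (adjF y M (Suc k)) (adj y M) (n + 1)"
      by (rule hilb_add[OF oF oF oadj adjF_Suc[OF adj_rules] adjF_adj[OF adj_rules] fink])
    moreover have "hilb (adjF y M (Suc k)) (adj y M) (n + 1) = hilb (adjF y M k) (adj y M) n"
      using hilb_plus_mult[OF homog_adjF homog_adj y oF oadj, of "Suc k" n]
      unfolding adj_eq_plus_mult[OF Suck] pm by (simp add: add.commute del: adjF.simps)
    ultimately show ?thesis by simp
  qed
  then have "evpoly (\<lambda>n. hilb (adjF y M k) (adj y M) (n + 1) - hilb (adjF y M k) (adj y M) n)"
    using evpoly_shift[OF evF[OF k(1)], of 1] by simp
  then have ev: "evpoly (hilb (adjF y M k) (adj y M))" by (rule evpoly_antidifference)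
  have "hilb M (adj y M) n = hilb M (adjF y M (Suc (k - 1))) n + hilb (adjF y M k) (adj y M) n" for n
    using hilb_add[OF M(1) oF oadj MF[of "k - 1"] adjF_adj[OF adj_rules] fin] k(1) by simp
  then show ?thesis by (rule evpoly_cong[OF sym evpoly_add[OF evMF ev]])
qed

end

end

section \<open>Powers of the maximal ideal\<close>

text \<open>Locality of \<open>GS 0\<close> is expressed through units: elements outside
  \<open>mm\<close> are invertible, and \<open>mm\<close> lies in the Jacobson radical, which is
  what the Nakayama argument needs.\<close>

locale local_graded_module = graded_operator_module S N GS GN
  for S :: "('a, 'm) ring_scheme" (structure) and N :: "('a, 'b, 'n) module_scheme" (structure)
    and GS :: "nat \<Rightarrow> 'a set" and GN :: "int \<Rightarrow> 'b set" +
  fixes mm :: "'a set"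
  assumes mm_subset: "mm \<subseteq> GS 0"
    and unit_if_not_mm: "\<And>a. a \<in> GS 0 \<Longrightarrow> a \<notin> mm \<Longrightarrow> \<exists>b \<in> GS 0. b \<otimes> a = \<one>"
    and unit_one_minus: "\<And>t a. t \<in> mm \<Longrightarrow> a \<in> GS 0 \<Longrightarrow> \<exists>b \<in> GS 0. b \<otimes> (\<one> \<ominus> a \<otimes> t) = \<one>"
begin

lemma mm_A0: "t \<in> mm \<Longrightarrow> t \<in> GS 0"
  using mm_subset by blast

lemma mm_carrier: "t \<in> mm \<Longrightarrow> t \<in> carrier S"
  using mm_A0 A0_carrier by blast

text \<open>The equation reads \<open>(\<one> \<ominus> a \<otimes> t) \<boxdot> x = p\<close>, and
  the factor on the left is a unit.\<close>

lemma nakayama: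
  assumes P: "opsub Y P" and x: "x \<in> carrier N" and t: "t \<in> mm" and a: "a \<in> GS 0"
    and e: "x = p \<boxplus> a \<boxdot> t \<boxdot> x" and p: "p \<in> P"
  shows "x \<in> P"
proof -
  obtain b where b: "b \<in> GS 0" "b \<otimes> (\<one> \<ominus> a \<otimes> t) = \<one>" using unit_one_minus[OF t a] by blast
  have c: "a \<in> carrier S" "t \<in> carrier S" "b \<in> carrier S" "p \<in> carrier N"
    using a b t p A0_carrier mm_carrier opsub_carrier[OF P] by blast+
  have "(\<one> \<ominus> a \<otimes> t) \<boxdot> x = x \<boxminus> a \<boxdot> t \<boxdot> x"
    using c x by (simp add: a_minus_def smult_l_distr smult_l_minus smult_assoc1)
  also have "\<dots> = p"
  proof -
    have "(p \<boxplus> a \<boxdot> t \<boxdot> x) \<boxminus> a \<boxdot> t \<boxdot> x = p"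
      using c x by (simp add: a_minus_def M.a_assoc M.r_neg)
    then show ?thesis using e by simp
  qed
  finally have "b \<boxdot> p = (b \<otimes> (\<one> \<ominus> a \<otimes> t)) \<boxdot> x" using c x by (simp add: smult_assoc1)
  then have "x = b \<boxdot> p" using b(2) x by simp
  then show ?thesis using opsub_A0[OF P b(1) p] by simp
qed

text \<open>\<open>(mcolon ^^ j) P\<close> is \<open>{x. mm\<^sup>j x \<subseteq> P}\<close>.\<close>

definition mcolon :: "'b set \<Rightarrow> 'b set" where
  "mcolon P = {x \<in> carrier N. \<forall>t \<in> mm. t \<boxdot> x \<in> P}"

lemma opsub_mcolon:
  assumes P: "opsub Y P" and Y: "Y \<subseteq> carrier S" shows "opsub Y (mcolon P)"
proof (rule opsubI)
  show "mcolon P \<subseteq> carrier N" unfolding mcolon_def by auto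
  show "\<zero>\<^bsub>N\<^esub> \<in> mcolon P" unfolding mcolon_def using opsub_zero[OF P] mm_carrier by simp
  show "x \<boxplus> z \<in> mcolon P" if "x \<in> mcolon P" "z \<in> mcolon P" for x z
    using that opsub_add[OF P] mm_carrier unfolding mcolon_def by (simp add: smult_r_distr)
  have *: "a \<boxdot> x \<in> mcolon P" if a: "a \<in> GS 0 \<union> Y" and x: "x \<in> mcolon P" for a x
  proof -
    have ac: "a \<in> carrier S" and xc: "x \<in> carrier N" using a x Y A0_carrier unfolding mcolon_def by auto
    have "t \<boxdot> a \<boxdot> x \<in> P" if t: "t \<in> mm" for t
    proof -
      have "t \<boxdot> x \<in> P" using x t unfolding mcolon_def by simp
      then have "a \<boxdot> t \<boxdot> x \<in> P" using P a unfolding opsub_def by blast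
      then show ?thesis using smult_comm[OF ac mm_carrier[OF t] xc] by simp
    qed
    then show ?thesis unfolding mcolon_def using ac xc by simp
  qed
  show "a \<boxdot> x \<in> mcolon P" if "a \<in> GS 0" "x \<in> mcolon P" for a x using *[of a x] that by simp
  show "a \<boxdot> x \<in> mcolon P" if "a \<in> Y" "x \<in> mcolon P" for a x using *[of a x] that by simp
qed

lemma mcolon_mono: "P \<subseteq> Q \<Longrightarrow> mcolon P \<subseteq> mcolon Q"
  unfolding mcolon_def by blast

lemma mcolon_increasing: "opsub Y P \<Longrightarrow> P \<subseteq> mcolon P"
  unfolding mcolon_def using opsub_A0 opsub_carrier mm_A0 by blast

lemma homog_mcolon: "homog P \<Longrightarrow> homog (mcolon P)"
  unfolding homog_def
proof (intro ballI allI)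
  fix x n assume P: "\<forall>x\<in>P. \<forall>n. hcomp n x \<in> P" and x: "x \<in> mcolon P"
  then have xc: "x \<in> carrier N" unfolding mcolon_def by simp
  have "t \<boxdot> hcomp n x \<in> P" if t: "t \<in> mm" for t
  proof -
    have "hcomp n (t \<boxdot> x) \<in> P" using P x t unfolding mcolon_def by simp
    then show ?thesis using hcomp_smult[OF mm_A0[OF t] xc, of n] by simp
  qed
  then show "hcomp n x \<in> mcolon P" unfolding mcolon_def using hcomp_carrier[OF xc] by simp
qed

lemma opsub_mcolon_pow: "opsub Y P \<Longrightarrow> Y \<subseteq> carrier S \<Longrightarrow> opsub Y ((mcolon ^^ j) P)"
  by (induction j) (auto intro: opsub_mcolon)

lemma homog_mcolon_pow: "homog P \<Longrightarrow> homog ((mcolon ^^ j) P)"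
  by (induction j) (auto intro: homog_mcolon)

lemma mcolon_pow_mono: "P \<subseteq> Q \<Longrightarrow> (mcolon ^^ j) P \<subseteq> (mcolon ^^ j) Q"
  by (induction j) (simp_all add: mcolon_mono)

lemma mcolon_pow_Suc: "opsub {} P \<Longrightarrow> (mcolon ^^ j) P \<subseteq> (mcolon ^^ Suc j) P"
  using mcolon_increasing[OF opsub_mcolon_pow[of "{}" P j]] by simp

lemma mcolon_pow_le: "opsub {} P \<Longrightarrow> i \<le> j \<Longrightarrow> (mcolon ^^ i) P \<subseteq> (mcolon ^^ j) P"
  using lift_Suc_mono_le[of "\<lambda>j. (mcolon ^^ j) P", OF mcolon_pow_Suc] by blast

lemma mcolon_pow_increasing: "opsub {} P \<Longrightarrow> P \<subseteq> (mcolon ^^ j) P"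
  using mcolon_pow_le[of P 0 j] by simp

lemma mcolon_pow_Int: "(mcolon ^^ j) (P \<inter> Q) = (mcolon ^^ j) P \<inter> (mcolon ^^ j) Q"
proof (induction j)
  case (Suc j)
  then show ?case unfolding funpow.simps comp_def Suc by (auto simp: mcolon_def)
qed simp

lemma mcolon_pow_smult:
  assumes s: "s \<in> carrier S" and Q: "opsub {} Q"
  shows "x \<in> carrier N \<Longrightarrow> x \<in> (mcolon ^^ j) {x \<in> carrier N. s \<boxdot> x \<in> Q} \<Longrightarrow> s \<boxdot> x \<in> (mcolon ^^ j) Q"
proof (induction j arbitrary: x)
  case (Suc j)
  have "t \<boxdot> s \<boxdot> x \<in> (mcolon ^^ j) Q" if t: "t \<in> mm" for t
  proof -
    have "s \<boxdot> t \<boxdot> x \<in> (mcolon ^^ j) Q"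
      using Suc.IH[of "t \<boxdot> x"] Suc.prems t mm_carrier[OF t] unfolding mcolon_def by simp
    then show ?thesis using smult_comm[OF mm_carrier[OF t] s Suc.prems(1)] by simp
  qed
  then show ?case unfolding funpow.simps comp_def mcolon_def[of "(mcolon ^^ j) Q"] using s Suc.prems(1) by simp
qed simp

text \<open>Finite length alone would give an exponent for each degree; the chain condition makes it
  uniform. The colons by powers of \<open>mm\<close> stabilise inside \<open>Q\<close>. If a piece
  of \<open>Q\<close> were not exhausted, a submodule of least length above the stable part would,
  by Nakayama, be carried into that part by \<open>mm\<close>, and so would already belong to the
  next colon.\<close>

theorem mcolon_pow_exhausts:
  assumes o: "opsub Y P" "opsub Y Q" and h: "homog P" "homog Q" and PQ: "P \<subseteq> Q" and Y: "Y \<subseteq> carrier S"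
    and n: "noeth Y P Q" and fin: "fin_quot P Q"
  shows "\<exists>k. Q \<subseteq> (mcolon ^^ k) P"
proof -
  define L where "L k = Q \<inter> (mcolon ^^ k) P" for k
  have oL: "opsub Y (L k)" for k
    unfolding L_def using opsub_Int[OF o(2) opsub_mcolon_pow[OF o(1) Y]] by simp
  have "\<exists>k. \<forall>i \<ge> k. L i = L k"
  proof (rule noethD[OF n oL])
    fix k
    show "P \<subseteq> L k" unfolding L_def using PQ mcolon_pow_increasing[OF opsub_base[OF o(1)], of k] by simp
    show "L k \<subseteq> Q" unfolding L_def by simp
    show "L k \<subseteq> L (Suc k)" unfolding L_def using mcolon_pow_Suc[OF opsub_base[OF o(1)], of k] by blast
  qed
  then obtain k where k: "\<And>i. i \<ge> k \<Longrightarrow> L i = L k" by blast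
  have PL: "P \<subseteq> L k" unfolding L_def using PQ mcolon_pow_increasing[OF opsub_base[OF o(1)], of k] by simp
  have socle: "x \<in> L k" if x: "x \<in> Q" "\<And>t. t \<in> mm \<Longrightarrow> t \<boxdot> x \<in> L k" for x
  proof -
    have "x \<in> (mcolon ^^ Suc k) P"
      using x opsub_carrier[OF o(2) x(1)] unfolding funpow.simps comp_def mcolon_def[of "(mcolon ^^ k) P"] L_def
      by simp
    then have "x \<in> L (Suc k)" unfolding L_def using x(1) by simp
    then show ?thesis using k[of "Suc k"] by simp
  qed
  have hL: "homog (L k)" unfolding L_def using homog_Int[OF h(2) homog_mcolon_pow[OF h(1)]] .
  have "Q \<inter> GN d \<subseteq> L k" for d
  proof (rule ccontr)
    assume "\<not> Q \<inter> GN d \<subseteq> L k"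
    define W where "W = L k \<inter> GN d"
    have oW: "opsub {} W" unfolding W_def using opsub_piece[OF oL] .
    have oQd: "opsub {} (Q \<inter> GN d)" using opsub_piece[OF o(2)] .
    let ?B = "\<lambda>L. opsub {} L \<and> W \<subset> L \<and> L \<subseteq> Q \<inter> GN d"
    have WQ: "W \<subseteq> Q \<inter> GN d" unfolding W_def L_def by blast
    have "?B (Q \<inter> GN d)" using oQd WQ \<open>\<not> Q \<inter> GN d \<subseteq> L k\<close> unfolding W_def by blast
    then have ex: "\<exists>l V. ?B V \<and> len W V = l" by blast
    define l where "l = (LEAST l. \<exists>V. ?B V \<and> len W V = l)"
    obtain U where U1: "?B U" and l: "len W U = l" using LeastI_ex[OF ex] unfolding l_def by blast
    have U2: "len W U \<le> len W V" if "?B V" for V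
      unfolding l l_def by (rule Least_le) (use that in blast)
    note U = U1 U2
    obtain z where z: "z \<in> U" "z \<notin> W" using U(1) by blast
    have zc: "z \<in> carrier N" "z \<in> Q" "z \<in> GN d" using U(1) z(1) GN_carrier by blast+
    have finU: "len W U \<noteq> \<infinity>"
    proof -
      have "len W U \<le> len (P \<inter> GN d) (Q \<inter> GN d)"
        using U(1) PL unfolding W_def by (intro len_mono opsub_piece[OF o(1)] oQd opsub_piece[OF oL]) auto
      then show ?thesis using fin unfolding fin_quot_def glen_def by (metis enat_ord_simps(5))
    qed
    have "t \<boxdot> z \<in> L k" if t: "t \<in> mm" for t
    proof (rule ccontr)
      assume tz: "t \<boxdot> z \<notin> L k"
      have tzc: "t \<boxdot> z \<in> carrier N" using zc mm_carrier[OF t] by simp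
      define V where "V = plus_cyclic W (GS 0) (t \<boxdot> z)"
      note V = plus_cyclic[OF generates_A0 oW tzc, folded V_def]
      have VU: "V \<subseteq> U" using V(4)[of U] U(1) opsub_A0[of "{}" U t z] mm_A0[OF t] z(1) by blast
      have "t \<boxdot> z \<notin> W" using tz unfolding W_def by simp
      then have BV: "?B V" using V(1-3) VU U(1) by blast
      \<comment> \<open>\<open>V\<close> competes with \<open>U\<close> for the least length above
        \<open>W\<close>. As that length is finite, additivity leaves \<open>len V U = 0\<close>, so
        \<open>U\<close> is generated over \<open>W\<close> by \<open>t \<boxdot> z\<close>.\<close>
      have "len W U = len W V + len V U" using len_add[OF oW V(1) _ V(2) VU] U(1) by blast
      then have "len V U = 0" using U(2)[OF BV] finU
        by (cases "len W V"; cases "len V U") (auto simp: zero_enat_def)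
      then have "V = U" using len_pos[OF V(1), of U] U(1) VU by (cases "V = U") auto
      then obtain p a where pa: "z = p \<boxplus> a \<boxdot> t \<boxdot> z" "p \<in> W" "a \<in> GS 0"
        using z(1) unfolding V_def plus_cyclic_def by blast
      then have "z \<in> W" using nakayama[OF oW zc(1) t pa(3) pa(1) pa(2)] by simp
      then show False using z(2) by simp
    qed
    then have "z \<in> L k" using socle[OF zc(2)] by blast
    then show False using z(2) zc(3) unfolding W_def by simp
  qed
  then have "Q \<subseteq> L k" using homog_subsetI[OF o(2) h(2) oL] by blast
  then show ?thesis unfolding L_def by blast
qed

section \<open>Exponents linear in the degree\<close>

definition mlinear :: "'b set \<Rightarrow> 'b set \<Rightarrow> bool" where
  "mlinear P Q \<longleftrightarrow> (\<exists>c. \<forall>n \<ge> 1. Q \<inter> GN n \<subseteq> (mcolon ^^ (c * nat n)) P)"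

lemma mlinear_trans:
  assumes P: "opsub {} P" and "mlinear P Q" "mlinear Q R" shows "mlinear P R"
proof -
  obtain c d where c: "\<And>n. n \<ge> 1 \<Longrightarrow> Q \<inter> GN n \<subseteq> (mcolon ^^ (c * nat n)) P"
    and d: "\<And>n. n \<ge> 1 \<Longrightarrow> R \<inter> GN n \<subseteq> (mcolon ^^ (d * nat n)) Q"
    using assms unfolding mlinear_def by blast
  have "R \<inter> GN n \<subseteq> (mcolon ^^ ((d + c) * nat n)) P" if n: "n \<ge> 1" for n
  proof -
    have "R \<inter> GN n \<subseteq> (mcolon ^^ (d * nat n)) (Q \<inter> GN n)"
      unfolding mcolon_pow_Int using d[OF n] mcolon_pow_increasing[OF opsub_GN, of n] by blast
    also have "\<dots> \<subseteq> (mcolon ^^ (d * nat n)) ((mcolon ^^ (c * nat n)) P)"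
      using mcolon_pow_mono[OF c[OF n]] .
    finally show ?thesis unfolding add_mult_distrib funpow_add comp_def .
  qed
  then show ?thesis unfolding mlinear_def by blast
qed

text \<open>A constant exponent counts as linear because \<open>k \<le> k * nat n\<close> from
  degree \<open>1\<close> on; \<open>mlinear\<close> starts at that degree for this reason.\<close>

lemma mlinear_of_pow:
  assumes P: "opsub {} P" and "Q \<subseteq> (mcolon ^^ k) P" shows "mlinear P Q"
  unfolding mlinear_def
proof (intro exI allI impI)
  fix n :: int assume "n \<ge> 1"
  then have "k * 1 \<le> k * nat n" by (intro mult_le_mono2) linarith
  then have "k \<le> k * nat n" by simp
  then show "Q \<inter> GN n \<subseteq> (mcolon ^^ (k * nat n)) P" using assms(2) mcolon_pow_le[OF P] by blast
qed

text \<open>Operators never lower the degree, so the elements without components below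
  \<open>- int b\<close> form a submodule. These submodules increase with \<open>b\<close>, and
  every element lies in one of them.\<close>

lemma noeth_bounded_below:
  assumes M: "opsub Y M" and Y: "Y \<subseteq> GS 1" and n: "noeth Y {\<zero>\<^bsub>N\<^esub>} M"
  shows "\<exists>b :: nat. \<forall>x \<in> M. \<forall>d < - int b. hcomp d x = \<zero>\<^bsub>N\<^esub>"
proof -
  note cM = opsub_carrier[OF M]
  define L where "L b = {x \<in> M. \<forall>d < - int b. hcomp d x = \<zero>\<^bsub>N\<^esub>}" for b :: nat
  have "\<exists>k. \<forall>i \<ge> k. L i = L k"
  proof (rule noethD[OF n])
    fix b
    show "opsub Y (L b)"
    proof (rule opsubI)
      show "L b \<subseteq> carrier N" unfolding L_def using cM by blast
      show "\<zero>\<^bsub>N\<^esub> \<in> L b" unfolding L_def using opsub_zero[OF M] by simp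
      show "x \<boxplus> z \<in> L b" if "x \<in> L b" "z \<in> L b" for x z
        using that opsub_add[OF M] cM unfolding L_def by (simp add: hcomp_add)
      show "a \<boxdot> x \<in> L b" if "a \<in> GS 0" "x \<in> L b" for a x
        using that opsub_A0[OF M] cM A0_carrier hcomp_smult[of a 0] unfolding L_def by simp
      show "a \<boxdot> x \<in> L b" if a: "a \<in> Y" and x: "x \<in> L b" for a x
      proof -
        have a1: "a \<in> GS 1" using a Y by blast
        show ?thesis
          using x opsub_op[OF M a] cM GS_carrier[OF a1] hcomp_smult[OF a1] unfolding L_def by simp
      qed
    qed
    show "{\<zero>\<^bsub>N\<^esub>} \<subseteq> L b" unfolding L_def using opsub_zero[OF M] by simp
    show "L b \<subseteq> M" "L b \<subseteq> L (Suc b)" unfolding L_def by auto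
  qed
  then obtain k where k: "\<And>i. i \<ge> k \<Longrightarrow> L i = L k" by blast
  have "hcomp d x = \<zero>\<^bsub>N\<^esub>" if x: "x \<in> M" and d: "d < - int k" for x d
  proof -
    have "finite {n. hcomp n x \<noteq> \<zero>\<^bsub>N\<^esub>}" using finite_hcomp[OF cM[OF x]] .
    then obtain B where B: "\<And>n. hcomp n x \<noteq> \<zero>\<^bsub>N\<^esub> \<Longrightarrow> B \<le> n"
      using finite_has_minimal[of "{n. hcomp n x \<noteq> \<zero>\<^bsub>N\<^esub>}"]
      by (metis (mono_tags, lifting) empty_iff linorder_le_cases mem_Collect_eq)
    have "hcomp e x = \<zero>\<^bsub>N\<^esub>" if e: "e < - int (max k (nat (- B)))" for e
    proof (rule ccontr)
      assume "hcomp e x \<noteq> \<zero>\<^bsub>N\<^esub>"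
      then have "B \<le> e" by (rule B)
      then show False using e by (simp add: max_def split: if_splits)
    qed
    then have "x \<in> L (max k (nat (- B)))" unfolding L_def using x by simp
    then have "x \<in> L k" using k[of "max k (nat (- B))"] by simp
    then show ?thesis using d unfolding L_def by simp
  qed
  then show ?thesis by blast
qed

text \<open>Only finitely many \<open>adjK y M i\<close> occur, so one exponent
  \<open>\<kappa>\<close> serves every step of the filtration after the first. Degree
  \<open>d\<close> of \<open>adj y M\<close> is reached within \<open>d + b\<close> such steps, and
  \<open>d + b \<le> (b + 1) * d\<close> for \<open>d \<ge> 1\<close>.\<close>

theorem mlinear_adj:
  assumes Y: "Y \<subseteq> GS 1" and y: "y \<in> GS 1" and M: "opsub Y M" "homog M"
    and n: "noeth Y {\<zero>\<^bsub>N\<^esub>} M" and fin: "fin_quot M (adj y M)"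
  shows "mlinear M (adj y M)"
proof -
  note gr = Y y M
  note ar = Y_carrier[OF gr] y_carrier[OF gr] M(1)
  note oF = opsub_adjF[OF ar]
  have "\<exists>\<kappa>. M \<subseteq> (mcolon ^^ \<kappa>) (adjK y M i)" if "i \<ge> 1" for i
  proof (rule mcolon_pow_exhausts[OF opsub_adjK[OF ar] M(1) homog_adjK[OF gr] M(2) adjK_subset[OF ar] ar(1)])
    show "noeth Y (adjK y M i) M"
      by (rule noeth_mono[OF n]) (use opsub_zero[OF opsub_adjK[OF ar]] in auto)
    show "fin_quot (adjK y M i) M" using fin_quot_adjK[OF gr fin that] .
  qed
  then obtain kap where kap: "\<And>i. i \<ge> 1 \<Longrightarrow> M \<subseteq> (mcolon ^^ (kap i)) (adjK y M i)" by metis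
  obtain k where k: "k \<ge> 1" "\<And>i. i \<ge> k \<Longrightarrow> adjK y M i = adjK y M k"
    using adjK_stable_pos[OF gr n] by blast
  define \<kappa> where "\<kappa> = Max (kap ` {..k})"
  have kapk: "kap i \<le> \<kappa>" if "i \<le> k" for i unfolding \<kappa>_def using that by simp
  have MK: "M \<subseteq> (mcolon ^^ \<kappa>) (adjK y M i)" if i: "i \<ge> 1" for i
  proof -
    define j where "j = min i k"
    have j: "adjK y M i = adjK y M j" "j \<le> k" "j \<ge> 1"
      using k(2)[of i] i k(1) unfolding j_def by (auto simp: min_def)
    show ?thesis
      unfolding j(1) using kap[OF j(3)] mcolon_pow_le[OF opsub_base[OF opsub_adjK[OF ar]] kapk[OF j(2)]] by blast
  qed
  have step: "adjF y M (Suc i) \<subseteq> (mcolon ^^ \<kappa>) (adjF y M i)" if i: "i \<ge> 1" for i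
  proof -
    have oR: "opsub Y ((mcolon ^^ \<kappa>) (adjF y M i))" using opsub_mcolon_pow[OF oF ar(1)] .
    have yi: "y [^] i \<in> carrier S" using ar(2) by simp
    have "(y [^] i) \<boxdot> m \<in> (mcolon ^^ \<kappa>) (adjF y M i)" if m: "m \<in> M" for m
    proof (rule mcolon_pow_smult[OF yi opsub_base[OF oF]])
      show mc: "m \<in> carrier N" using opsub_carrier[OF M(1) m] .
      have "adjK y M i \<subseteq> {x \<in> carrier N. (y [^] i) \<boxdot> x \<in> adjF y M i}"
        unfolding adjK_def pre_mult_def using opsub_carrier[OF M(1)] by blast
      then show "m \<in> (mcolon ^^ \<kappa>) {x \<in> carrier N. (y [^] i) \<boxdot> x \<in> adjF y M i}"
        using MK[OF i] m mcolon_pow_mono by blast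
    qed
    then show ?thesis
      unfolding adjF.simps using plus_mult_least[OF oR mcolon_pow_increasing[OF opsub_base[OF oF]]] by blast
  qed
  have FM: "adjF y M (Suc i) \<subseteq> (mcolon ^^ (\<kappa> * i)) M" for i
  proof (induction i)
    case 0 show ?case unfolding adjF_1[OF ar] by simp
  next
    case (Suc i)
    have "adjF y M (Suc (Suc i)) \<subseteq> (mcolon ^^ \<kappa>) (adjF y M (Suc i))" by (rule step) simp
    also have "\<dots> \<subseteq> (mcolon ^^ \<kappa>) ((mcolon ^^ (\<kappa> * i)) M)" using mcolon_pow_mono[OF Suc] .
    finally show ?case unfolding mult_Suc_right funpow_add comp_def .
  qed
  obtain b where b: "\<And>x d. x \<in> M \<Longrightarrow> d < - int b \<Longrightarrow> hcomp d x = \<zero>\<^bsub>N\<^esub>"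
    using noeth_bounded_below[OF M(1) Y n] by blast
  \<comment> \<open>In degree \<open>d\<close> the coefficient of \<open>y [^] i\<close> contributes
    only through its component of degree \<open>d - i\<close>. For \<open>i > d + b\<close> this is
    below the lowest degree of \<open>M\<close>, so the term vanishes.\<close>
  have low: "x \<in> adjF y M i \<Longrightarrow> x \<in> GN d \<Longrightarrow> x \<in> adjF y M (Suc (nat (d + int b)))" for x i d
  proof (induction i arbitrary: x)
    case 0 then show ?case using opsub_zero[OF oF] by (simp del: adjF.simps(2))
  next
    case (Suc i)
    show ?case
    proof (cases "i \<le> nat (d + int b)")
      case True
      then show ?thesis using Suc.prems(1) adjF_mono[OF ar, of "Suc i" "Suc (nat (d + int b))"] by auto
    next
      case False
      obtain f m where fm: "x = f \<boxplus> (y [^] i) \<boxdot> m" "f \<in> adjF y M i" "m \<in> M"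
        using Suc.prems unfolding adjF.simps plus_mult_def by blast
      have c: "f \<in> carrier N" "m \<in> carrier N" "y [^] i \<in> carrier S"
        using opsub_carrier[OF oF fm(2)] opsub_carrier[OF M(1) fm(3)] ar(2) by auto
      have "x = hcomp d x" using hcomp_homogeneous[OF Suc.prems(2), of d] by simp
      also have "\<dots> = hcomp d f \<boxplus> (y [^] i) \<boxdot> hcomp (d - int i) m"
        unfolding fm(1) using c hcomp_smult[OF GS_pow[OF y]] by (simp add: hcomp_add)
      also have "hcomp (d - int i) m = \<zero>\<^bsub>N\<^esub>" using False by (intro b[OF fm(3)]) linarith
      finally have "x = hcomp d f" using c hcomp_carrier by simp
      then have "x \<in> adjF y M i" using homogD[OF homog_adjF[OF gr] fm(2)] by simp
      then show ?thesis using Suc.IH Suc.prems(2) by blast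
    qed
  qed
  show ?thesis
    unfolding mlinear_def
  proof (intro exI allI impI)
    fix d :: int assume d: "d \<ge> 1"
    have "nat (d + int b) \<le> (b + 1) * nat d"
    proof -
      have "nat (d + int b) = nat d + b" using d by simp
      moreover have "b * 1 \<le> b * nat d" using d by (intro mult_le_mono2) simp
      ultimately show ?thesis by simp
    qed
    then have "\<kappa> * nat (d + int b) \<le> \<kappa> * (b + 1) * nat d" by (simp only: mult.assoc mult_le_mono2)
    then have "(mcolon ^^ (\<kappa> * nat (d + int b))) M \<subseteq> (mcolon ^^ (\<kappa> * (b + 1) * nat d)) M"
      using mcolon_pow_le[OF opsub_base[OF M(1)]] by blast
    moreover have "adj y M \<inter> GN d \<subseteq> (mcolon ^^ (\<kappa> * nat (d + int b))) M"
      using low FM unfolding adj_def by blast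
    ultimately show "adj y M \<inter> GN d \<subseteq> (mcolon ^^ (\<kappa> * (b + 1) * nat d)) M" by blast
  qed
qed

end

section \<open>Growth and Krull dimension\<close>

text \<open>\<open>growth e\<close> describes Hilbert functions of modules of dimension less than \<open>e\<close>; this index makes the
  modules of dimension \<open>0\<close>, whose Hilbert functions have finite support, the case \<open>e = 1\<close>.\<close>

fun growth :: "nat \<Rightarrow> (int \<Rightarrow> nat) \<Rightarrow> bool" where
  "growth 0 f \<longleftrightarrow> (\<forall>n. f n = 0)"
| "growth (Suc 0) f \<longleftrightarrow> finite {n. f n \<noteq> 0}"
| "growth (Suc (Suc e)) f \<longleftrightarrow>
     (\<exists>C B :: nat. \<forall>n. (n < - int B \<longrightarrow> f n = 0) \<and> f n \<le> C * (nat (n + int B) + 1) ^ e)"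

lemma growth_zero: "growth e (\<lambda>_. 0)"
  by (cases "(e, \<lambda>_ :: int. 0 :: nat)" rule: growth.cases) auto

lemma growth_add: "growth e f \<Longrightarrow> growth e g \<Longrightarrow> growth e (\<lambda>n. f n + g n)"
proof (cases "(e, f)" rule: growth.cases)
  case (2 h)
  assume a: "growth e f" "growth e g"
  have "{n. f n + g n \<noteq> 0} \<subseteq> {n. f n \<noteq> 0} \<union> {n. g n \<noteq> 0}" by auto
  then show ?thesis using a 2 by (auto intro: finite_subset)
next
  case (3 e' h)
  assume a: "growth e f" "growth e g"
  then obtain C B C' B' where
    f: "\<And>n. (n < - int B \<longrightarrow> f n = 0) \<and> f n \<le> C * (nat (n + int B) + 1) ^ e'" and
    g: "\<And>n. (n < - int B' \<longrightarrow> g n = 0) \<and> g n \<le> C' * (nat (n + int B') + 1) ^ e'"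
    using 3 by auto
  let ?B = "max B B'"
  have "(n < - int ?B \<longrightarrow> f n + g n = 0) \<and> f n + g n \<le> (C + C') * (nat (n + int ?B) + 1) ^ e'" for n
  proof
    show "n < - int ?B \<longrightarrow> f n + g n = 0" using f[of n] g[of n] by auto
    have "f n \<le> C * (nat (n + int ?B) + 1) ^ e'"
      by (rule order_trans[OF conjunct2[OF f]]) (intro mult_le_mono2 power_mono, auto)
    moreover have "g n \<le> C' * (nat (n + int ?B) + 1) ^ e'"
      by (rule order_trans[OF conjunct2[OF g]]) (intro mult_le_mono2 power_mono, auto)
    ultimately show "f n + g n \<le> (C + C') * (nat (n + int ?B) + 1) ^ e'" by (simp add: add_mult_distrib)
  qed
  then show ?thesis using 3 by (simp only: prod.inject growth.simps) blast
qed auto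

lemma growth_finite_support:
  assumes "finite {n. f n \<noteq> 0}" shows "growth (Suc (Suc e)) f"
proof -
  let ?F = "{n. f n \<noteq> 0}"
  define B where "B = Max (insert 0 ((\<lambda>n. nat (- n)) ` ?F))"
  define C where "C = (\<Sum>n \<in> ?F. f n)"
  have "(n < - int B \<longrightarrow> f n = 0) \<and> f n \<le> C * (nat (n + int B) + 1) ^ e" for n
  proof (cases "n \<in> ?F")
    case True
    have "nat (- n) \<le> B" unfolding B_def using assms True by (intro Max_ge) auto
    moreover have "f n \<le> C" unfolding C_def using assms True by (intro member_le_sum) auto
    moreover have "C * 1 \<le> C * (nat (n + int B) + 1) ^ e" by (intro mult_le_mono2) simp
    ultimately show ?thesis by linarith
  qed auto
  then show ?thesis unfolding growth.simps by blast
qed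

lemma growth_Suc: "growth e f \<Longrightarrow> growth (Suc e) f"
proof (cases "(e, f)" rule: growth.cases)
  case (2 h)
  assume "growth e f"
  then show ?thesis using growth_finite_support[of f 0] 2 by simp
next
  case (3 e' h)
  assume "growth e f"
  then obtain C B where f: "\<And>n. (n < - int B \<longrightarrow> f n = 0) \<and> f n \<le> C * (nat (n + int B) + 1) ^ e'"
    using 3 by auto
  have "(n < - int B \<longrightarrow> f n = 0) \<and> f n \<le> C * (nat (n + int B) + 1) ^ Suc e'" for n
  proof -
    have "C * (nat (n + int B) + 1) ^ e' \<le> C * (nat (n + int B) + 1) ^ Suc e'"
      by (intro mult_le_mono2 power_increasing) auto
    then show ?thesis using f[of n] by linarith
  qed
  then have "growth (Suc (Suc (Suc e'))) f" unfolding growth.simps by blast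
  then show ?thesis using 3 by simp
qed auto

text \<open>The vanishing below \<open>- int B\<close> in \<open>growth\<close> pays off here:
  whatever the lower limit \<open>b\<close>, at most \<open>n + B + 1\<close> summands count, so the
  exponent rises by one only. A finitely supported function has bounded partial sums.\<close>

lemma growth_sum:
  assumes g: "growth e g" shows "growth (Suc e) (\<lambda>n. \<Sum>k \<in> {b..n}. g k)"
proof (cases "(e, g)" rule: growth.cases)
  case (1 h)
  then have "(\<lambda>n. \<Sum>k \<in> {b..n}. g k) = (\<lambda>_. 0)" using g by auto
  then show ?thesis using growth_zero by simp
next
  case (2 h)
  then have fin: "finite {n. g n \<noteq> 0}" using g by simp
  define C where "C = (\<Sum>n \<in> {n. g n \<noteq> 0}. g n)"
  have "(n < - int (nat (- b)) \<longrightarrow> (\<Sum>k \<in> {b..n}. g k) = 0) \<and>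
      (\<Sum>k \<in> {b..n}. g k) \<le> C * (nat (n + int (nat (- b))) + 1) ^ 0" for n
  proof
    show "n < - int (nat (- b)) \<longrightarrow> (\<Sum>k \<in> {b..n}. g k) = 0" by auto
    have "(\<Sum>k \<in> {b..n}. g k) = (\<Sum>k \<in> {b..n} \<inter> {n. g n \<noteq> 0}. g k)"
      by (rule sum.mono_neutral_right) auto
    also have "\<dots> \<le> C" unfolding C_def using fin by (intro sum_mono2) auto
    finally show "(\<Sum>k \<in> {b..n}. g k) \<le> C * (nat (n + int (nat (- b))) + 1) ^ 0" by simp
  qed
  then have "growth (Suc (Suc 0)) (\<lambda>n. \<Sum>k \<in> {b..n}. g k)" unfolding growth.simps by blast
  then show ?thesis using 2 by simp
next
  case (3 e' h)
  then obtain C B where f: "\<And>n. (n < - int B \<longrightarrow> g n = 0) \<and> g n \<le> C * (nat (n + int B) + 1) ^ e'"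
    using g by auto
  have "(n < - int B \<longrightarrow> (\<Sum>k \<in> {b..n}. g k) = 0) \<and>
      (\<Sum>k \<in> {b..n}. g k) \<le> C * (nat (n + int B) + 1) ^ Suc e'" for n
  proof
    show "n < - int B \<longrightarrow> (\<Sum>k \<in> {b..n}. g k) = 0" using f by auto
    let ?m = "nat (n + int B) + 1"
    have "(\<Sum>k \<in> {b..n}. g k) = (\<Sum>k \<in> {b..n} \<inter> {- int B..n}. g k)"
      by (rule sum.mono_neutral_right) (use f in \<open>auto simp: not_le\<close>)
    also have "\<dots> \<le> (\<Sum>k \<in> {- int B..n}. g k)"
      by (rule sum_mono2) auto
    also have "\<dots> \<le> (\<Sum>k \<in> {- int B..n}. C * ?m ^ e')"
    proof (rule sum_mono)
      fix k assume k: "k \<in> {- int B..n}"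
      have "C * (nat (k + int B) + 1) ^ e' \<le> C * ?m ^ e'"
        using k by (intro mult_le_mono2 power_mono) auto
      then show "g k \<le> C * ?m ^ e'" using f[of k] by linarith
    qed
    also have "\<dots> = card {- int B..n} * (C * ?m ^ e')" by simp
    also have "\<dots> \<le> ?m * (C * ?m ^ e')" by (intro mult_le_mono1) auto
    finally show "(\<Sum>k \<in> {b..n}. g k) \<le> C * ?m ^ Suc e'" by (simp add: ac_simps)
  qed
  then have "growth (Suc (Suc (Suc e'))) (\<lambda>n. \<Sum>k \<in> {b..n}. g k)" unfolding growth.simps by blast
  then show ?thesis using 3 by simp
qed

lemma growth_mult:
  assumes g: "growth e g" shows "growth (Suc e) (\<lambda>n. Suc (c * nat n) * g n)"
proof (cases "(e, g)" rule: growth.cases)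
  case (2 h)
  then have "finite {n. Suc (c * nat n) * g n \<noteq> 0}" using g by simp
  then have "growth (Suc (Suc 0)) (\<lambda>n. Suc (c * nat n) * g n)" by (rule growth_finite_support)
  then show ?thesis using 2 by simp
next
  case (3 e' h)
  then obtain C B where f: "\<And>n. (n < - int B \<longrightarrow> g n = 0) \<and> g n \<le> C * (nat (n + int B) + 1) ^ e'"
    using g by auto
  have "(n < - int B \<longrightarrow> Suc (c * nat n) * g n = 0) \<and>
      Suc (c * nat n) * g n \<le> (Suc c * C) * (nat (n + int B) + 1) ^ Suc e'" for n
  proof
    show "n < - int B \<longrightarrow> Suc (c * nat n) * g n = 0" using f by auto
    let ?m = "nat (n + int B) + 1"
    have "c * nat n \<le> c * ?m" by (intro mult_le_mono2) auto
    then have "Suc (c * nat n) \<le> Suc c * ?m" by simp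
    then have "Suc (c * nat n) * g n \<le> (Suc c * ?m) * (C * ?m ^ e')"
      using f[of n] by (intro mult_le_mono) auto
    then show "Suc (c * nat n) * g n \<le> (Suc c * C) * ?m ^ Suc e'" by (simp only: power_Suc ac_simps)
  qed
  then have "growth (Suc (Suc (Suc e'))) (\<lambda>n. Suc (c * nat n) * g n)" unfolding growth.simps by blast
  then show ?thesis using 3 by simp
qed (use g in auto)

lemma growth_le: "growth i f \<Longrightarrow> i \<le> j \<Longrightarrow> growth j f"
  by (induction j) (auto simp: le_Suc_eq intro: growth_Suc)

text \<open>This says that \<open>Q\<close> is prime and that \<open>S / Q\<close> has dimension at
  least \<open>e\<close>. Fixing the lowest prime lets a chain be prolonged downwards.\<close>

definition prime_chain :: "('a, 'm) ring_scheme \<Rightarrow> nat \<Rightarrow> 'a set \<Rightarrow> bool" where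
  "prime_chain S e Q \<longleftrightarrow> (\<exists>p. p 0 = Q \<and> (\<forall>i \<le> e. primeideal (p i) S) \<and> (\<forall>i < e. p i \<subset> p (Suc i)))"

lemma prime_chain_Suc:
  assumes "primeideal Q S" "Q \<subset> Q'" "prime_chain S e Q'" shows "prime_chain S (Suc e) Q"
proof -
  obtain p where p: "p 0 = Q'" "\<forall>i \<le> e. primeideal (p i) S" "\<forall>i < e. p i \<subset> p (Suc i)"
    using assms(3) unfolding prime_chain_def by blast
  then show ?thesis
    unfolding prime_chain_def using assms(1,2)
    by (intro exI[of _ "case_nat Q p"]) (auto split: nat.splits simp: less_Suc_eq_0_disj)
qed

section \<open>Lengths under a linear power of \<open>mm\<close>\<close>

context local_graded_module
begin

text \<open>The lengths to be bounded are those of \<open>Q\<^sub>n / L\<close> with \<open>mm\<^bsup>cn+1\<^esup> Q\<^sub>n \<subseteq> L\<close>. The summand \<open>1\<close> in the exponent makes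
  the condition vacuous when \<open>mm Q \<subseteq> P\<close>.\<close>

definition dominated :: "nat \<Rightarrow> nat \<Rightarrow> 'b set \<Rightarrow> 'b set \<Rightarrow> bool" where
  "dominated c e P Q \<longleftrightarrow> (\<exists>f. growth e f \<and> (\<forall>n L. opsub {} L \<longrightarrow> P \<inter> GN n \<subseteq> L \<longrightarrow> L \<subseteq> Q \<inter> GN n \<longrightarrow>
     Q \<inter> GN n \<subseteq> (mcolon ^^ Suc (c * nat n)) L \<longrightarrow> len L (Q \<inter> GN n) \<le> enat (f n)))"

lemma dominatedI:
  assumes "growth e f" "\<And>n L. opsub {} L \<Longrightarrow> P \<inter> GN n \<subseteq> L \<Longrightarrow> L \<subseteq> Q \<inter> GN n \<Longrightarrow>
     Q \<inter> GN n \<subseteq> (mcolon ^^ Suc (c * nat n)) L \<Longrightarrow> len L (Q \<inter> GN n) \<le> enat (f n)"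
  shows "dominated c e P Q"
  unfolding dominated_def using assms by blast

lemma dominated_self: "dominated c e P P"
proof (rule dominatedI[OF growth_zero])
  fix n L assume L: "opsub {} L" "P \<inter> GN n \<subseteq> L" "L \<subseteq> P \<inter> GN n"
  then have "L = P \<inter> GN n" by simp
  then show "len L (P \<inter> GN n) \<le> enat 0" using len_self[OF L(1)] by (simp add: zero_enat_def)
qed

text \<open>A given \<open>L\<close> is split into its sum with the piece of \<open>Q\<close> and
  its intersection with it. Both again satisfy the condition on the exponent, because
  \<open>dominated\<close> admits every such submodule and not just one power of
  \<open>mm\<close>.\<close>

lemma dominated_trans:
  assumes o: "opsub Y1 P" "opsub Y2 Q" "opsub Y3 R" and sub: "P \<subseteq> Q" "Q \<subseteq> R"
    and d: "dominated c e P Q" "dominated c e Q R"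
  shows "dominated c e P R"
proof -
  obtain f where f: "growth e f" "\<And>n L. opsub {} L \<Longrightarrow> P \<inter> GN n \<subseteq> L \<Longrightarrow> L \<subseteq> Q \<inter> GN n \<Longrightarrow>
     Q \<inter> GN n \<subseteq> (mcolon ^^ Suc (c * nat n)) L \<Longrightarrow> len L (Q \<inter> GN n) \<le> enat (f n)"
    using d(1) unfolding dominated_def by blast
  obtain g where g: "growth e g" "\<And>n L. opsub {} L \<Longrightarrow> Q \<inter> GN n \<subseteq> L \<Longrightarrow> L \<subseteq> R \<inter> GN n \<Longrightarrow>
     R \<inter> GN n \<subseteq> (mcolon ^^ Suc (c * nat n)) L \<Longrightarrow> len L (R \<inter> GN n) \<le> enat (g n)"
    using d(2) unfolding dominated_def by blast
  show ?thesis
  proof (rule dominatedI[OF growth_add[OF f(1) g(1)]])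
    fix n L
    let ?j = "Suc (c * nat n)" and ?Q = "Q \<inter> GN n" and ?R = "R \<inter> GN n"
    assume L: "opsub {} L" "P \<inter> GN n \<subseteq> L" "L \<subseteq> ?R" "?R \<subseteq> (mcolon ^^ ?j) L"
    have oQ: "opsub {} ?Q" and oR: "opsub {} ?R" using opsub_piece[OF o(2)] opsub_piece[OF o(3)] .
    define U where "U = plus_mult L \<one> ?Q"
    have oU: "opsub {} U" unfolding U_def using opsub_plus_mult[OF L(1) oQ] by simp
    have LU: "L \<subseteq> U" unfolding U_def using plus_mult_left[OF L(1) oQ] by simp
    have QU: "?Q \<subseteq> U"
      unfolding U_def using plus_mult_right[OF L(1) oQ, of \<one>] opsub_carrier[OF oQ] by fastforce
    have UR: "U \<subseteq> ?R"
      unfolding U_def using plus_mult_least[OF oR L(3), of ?Q \<one>] sub(2) opsub_carrier[OF oQ] by auto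
    have pre: "pre_mult \<one> L ?Q = L \<inter> ?Q" unfolding pre_mult_def using opsub_carrier[OF oQ] by auto
    have "len U ?R \<le> enat (g n)"
      by (rule g(2)[OF oU QU UR]) (use L(4) mcolon_pow_mono[OF LU, of ?j] in blast)
    moreover have "len (L \<inter> ?Q) ?Q \<le> enat (f n)"
    proof (rule f(2))
      show "opsub {} (L \<inter> ?Q)" using opsub_Int[OF L(1) oQ] by simp
      show "P \<inter> GN n \<subseteq> L \<inter> ?Q" using L(2) sub(1) by blast
      show "L \<inter> ?Q \<subseteq> ?Q" by blast
      have "?Q \<subseteq> ?R" using sub(2) by blast
      then show "?Q \<subseteq> (mcolon ^^ ?j) (L \<inter> ?Q)"
        unfolding mcolon_pow_Int[of ?j L ?Q] using L(4) mcolon_pow_increasing[OF oQ, of ?j] by blast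
    qed
    moreover have "len L U = len (L \<inter> ?Q) ?Q"
      unfolding U_def pre[symmetric] using len_plus_mult[OF L(1) oQ] by simp
    moreover have "len L ?R = len L U + len U ?R" by (rule len_add[OF L(1) oU oR LU UR])
    ultimately show "len L ?R \<le> enat (f n + g n)" using add_mono[of "len L U" "enat (f n)" "len U ?R" "enat (g n)"] by simp
  qed
qed

text \<open>Split the length at \<open>L + tQ\<close>. The upper part is bounded by
  \<open>g\<close>; the lower part equals the length above the colon \<open>L : t\<close>, for which
  one power of \<open>mm\<close> less suffices. After at most \<open>Suc (c * nat n)\<close> rounds
  nothing is left.\<close>

lemma dominated_plus_mult_mm:
  assumes o: "opsub Y P" "opsub Y Q" and h: "homog P" "homog Q" and t: "t \<in> mm"
    and d: "dominated c e (plus_mult P t Q) Q"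
  shows "dominated c (Suc e) P Q"
proof -
  let ?R = "plus_mult P t Q"
  obtain g where g: "growth e g" "\<And>n L. opsub {} L \<Longrightarrow> ?R \<inter> GN n \<subseteq> L \<Longrightarrow> L \<subseteq> Q \<inter> GN n \<Longrightarrow>
     Q \<inter> GN n \<subseteq> (mcolon ^^ Suc (c * nat n)) L \<Longrightarrow> len L (Q \<inter> GN n) \<le> enat (g n)"
    using d unfolding dominated_def by blast
  note t0 = mm_A0[OF t] and tc = mm_carrier[OF t]
  show ?thesis
  proof (rule dominatedI[OF growth_mult[OF g(1), of c]])
    fix n L
    let ?Q = "Q \<inter> GN n"
    have oQ: "opsub {} ?Q" using opsub_piece[OF o(2)] .
    have tQ: "t \<boxdot> x \<in> ?Q" if "x \<in> ?Q" for x using opsub_A0[OF oQ t0 that] .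
    \<comment> \<open>The exponent \<open>j\<close> decreases in the induction; its upper bound
      keeps the estimate by \<open>g\<close>, made for the full exponent, applicable in every
      round.\<close>
    have main: "len L ?Q \<le> enat (j * g n)"
      if "j \<le> Suc (c * nat n)" "opsub {} L" "P \<inter> GN n \<subseteq> L" "L \<subseteq> ?Q" "?Q \<subseteq> (mcolon ^^ j) L" for j L
      using that
    proof (induction j arbitrary: L)
      case 0
      then have "L = ?Q" by auto
      then show ?case using len_self[OF 0(2)] by (simp add: zero_enat_def)
    next
      case (Suc j)
      note L = Suc.prems
      define U where "U = plus_mult L t ?Q"
      have oU: "opsub {} U" unfolding U_def using opsub_plus_mult[OF L(2) oQ tc] by simp
      have LU: "L \<subseteq> U" unfolding U_def using plus_mult_left[OF L(2) oQ tc] .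
      have UQ: "U \<subseteq> ?Q" unfolding U_def using plus_mult_least[OF oQ L(4), of ?Q t] tQ by blast
      have "len U ?Q \<le> enat (g n)"
      proof (rule g(2)[OF oU _ UQ])
        have "?R \<inter> GN n = plus_mult (P \<inter> GN n) t ?Q"
          using plus_mult_piece[OF h t0 o(1) o(2), of n] by simp
        then show "?R \<inter> GN n \<subseteq> U" unfolding U_def using plus_mult_mono[OF L(3) order_refl] by simp
        have "?Q \<subseteq> (mcolon ^^ Suc (c * nat n)) L"
          by (rule order_trans[OF L(5) mcolon_pow_le[OF L(2,1)]])
        then show "?Q \<subseteq> (mcolon ^^ Suc (c * nat n)) U"
          using mcolon_pow_mono[OF LU] by (rule order_trans)
      qed
      moreover have "len (pre_mult t L ?Q) ?Q \<le> enat (j * g n)"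
      proof (rule Suc.IH)
        show "j \<le> Suc (c * nat n)" using L(1) by simp
        show "opsub {} (pre_mult t L ?Q)" using opsub_pre_mult[OF L(2) oQ tc] by simp
        show "P \<inter> GN n \<subseteq> pre_mult t L ?Q"
          unfolding pre_mult_def using L(3,4) opsub_A0[OF L(2) t0] by blast
        show "pre_mult t L ?Q \<subseteq> ?Q" unfolding pre_mult_def by blast
        have "?Q \<subseteq> (mcolon ^^ j) (mcolon L) \<inter> (mcolon ^^ j) ?Q"
          using L(5) mcolon_pow_increasing[OF oQ] unfolding funpow_Suc_right comp_def by blast
        also have "\<dots> = (mcolon ^^ j) (mcolon L \<inter> ?Q)" unfolding mcolon_pow_Int ..
        also have "\<dots> \<subseteq> (mcolon ^^ j) (pre_mult t L ?Q)"
          by (rule mcolon_pow_mono) (use t in \<open>auto simp: mcolon_def pre_mult_def\<close>)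
        finally show "?Q \<subseteq> (mcolon ^^ j) (pre_mult t L ?Q)" .
      qed
      moreover have "len L U = len (pre_mult t L ?Q) ?Q"
        unfolding U_def by (rule len_plus_mult[OF L(2) oQ tc])
      moreover have "len L ?Q = len L U + len U ?Q" by (rule len_add[OF L(2) oU oQ LU UQ])
      ultimately have "len L ?Q \<le> enat (j * g n) + enat (g n)"
        using add_mono[of "len L U" "enat (j * g n)" "len U ?Q" "enat (g n)"] by simp
      then show ?case by (simp add: add.commute)
    qed
    assume "opsub {} L" "P \<inter> GN n \<subseteq> L" "L \<subseteq> ?Q" "?Q \<subseteq> (mcolon ^^ Suc (c * nat n)) L"
    then show "len L ?Q \<le> enat (Suc (c * nat n) * g n)" by (rule main[OF order_refl])
  qed
qed

text \<open>Since \<open>mm\<close> kills \<open>Q / P\<close>, it is enough to bound the full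
  length of each piece. Multiplication by \<open>a\<close> maps degree \<open>n\<close> to degree
  \<open>n + 1\<close> with cokernel of length at most \<open>g (n + 1)\<close>, so the length grows
  by at most that much per degree, starting from zero below \<open>b\<close>.\<close>

lemma dominated_plus_mult_degree_1:
  assumes o: "opsub Y P" "opsub Y Q" and h: "homog P" "homog Q" and PQ: "P \<subseteq> Q" and a: "a \<in> GS 1" "a \<in> Y"
    and Y: "Y \<subseteq> carrier S"
    and kill: "\<And>t x. t \<in> mm \<Longrightarrow> x \<in> Q \<Longrightarrow> t \<boxdot> x \<in> P"
    and low: "\<And>n. n < b \<Longrightarrow> P \<inter> GN n = Q \<inter> GN n"
    and d: "dominated c e (plus_mult P a Q) Q"
  shows "dominated c (Suc e) P Q"
proof -
  let ?R = "plus_mult P a Q"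
  note ac = GS_carrier[OF a(1)]
  have oR: "opsub Y ?R" using opsub_plus_mult[OF o ac Y] .
  have PR: "P \<subseteq> ?R" using plus_mult_left[OF o ac] .
  have RQ: "?R \<subseteq> Q" using plus_mult_least[OF o(2) PQ, of Q a] opsub_op[OF o(2) a(2)] by blast
  obtain g where g: "growth e g" "\<And>n L. opsub {} L \<Longrightarrow> ?R \<inter> GN n \<subseteq> L \<Longrightarrow> L \<subseteq> Q \<inter> GN n \<Longrightarrow>
     Q \<inter> GN n \<subseteq> (mcolon ^^ Suc (c * nat n)) L \<Longrightarrow> len L (Q \<inter> GN n) \<le> enat (g n)"
    using d unfolding dominated_def by blast
  have auto_kill: "Q \<inter> GN n \<subseteq> (mcolon ^^ Suc j) L" if L: "opsub {} L" "P \<inter> GN n \<subseteq> L" for n j L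
  proof -
    have "Q \<inter> GN n \<subseteq> mcolon L"
      unfolding mcolon_def
      using kill L(2) opsub_A0[OF opsub_GN] mm_A0 GN_carrier by blast
    also have "\<dots> \<subseteq> (mcolon ^^ Suc j) L" using mcolon_pow_le[OF L(1), of 1 "Suc j"] by simp
    finally show ?thesis .
  qed
  have gR: "glen ?R Q n \<le> enat (g n)" for n
    unfolding glen_def
  proof (rule g(2)[OF opsub_piece[OF oR] order_refl])
    show "?R \<inter> GN n \<subseteq> Q \<inter> GN n" using RQ by blast
    show "Q \<inter> GN n \<subseteq> (mcolon ^^ Suc (c * nat n)) (?R \<inter> GN n)"
      by (rule auto_kill[OF opsub_piece[OF oR]]) (use PR in blast)
  qed
  have PQ_len: "glen P Q n \<le> enat (\<Sum>k \<in> {b..n}. g k)" for n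
  proof (cases "n < b")
    case True
    then show ?thesis using glen_eq_0[OF o(1) low] by simp
  next
    case False
    \<comment> \<open>Starting one degree below \<open>b\<close> makes the base case an empty
      sum.\<close>
    then have "n \<ge> b - 1" by simp
    then show ?thesis
    proof (induction n rule: int_ge_induct)
      case base
      then show ?case using glen_eq_0[OF o(1) low, of "b - 1"] by simp
    next
      case (step n)
      have "glen P Q (n + 1) = glen P ?R (n + 1) + glen ?R Q (n + 1)"
        by (rule glen_add[OF o(1) oR o(2) PR RQ])
      moreover have "glen P ?R (n + 1) = glen (pre_mult a P Q) Q n"
        using glen_plus_mult[OF h a(1) o, of n] by (simp add: add.commute)
      moreover have "glen (pre_mult a P Q) Q n \<le> glen P Q n"
      proof (rule glen_mono[OF o(1) opsub_pre_mult[OF o ac Y] o(2) o(2)])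
        show "P \<subseteq> pre_mult a P Q" unfolding pre_mult_def using PQ opsub_op[OF o(1) a(2)] by blast
      qed (auto simp: pre_mult_def)
      ultimately have "glen P Q (n + 1) \<le> enat (\<Sum>k \<in> {b..n}. g k) + enat (g (n + 1))"
        using add_mono[OF order_trans[OF _ step.IH] gR[of "n + 1"]] by simp
      moreover have "{b..n + 1} = insert (n + 1) {b..n}" using step.hyps by auto
      then have "(\<Sum>k \<in> {b..n + 1}. g k) = (\<Sum>k \<in> {b..n}. g k) + g (n + 1)" by simp
      ultimately show ?case by simp
    qed
  qed
  show ?thesis
  proof (rule dominatedI[OF growth_sum[OF g(1), of b]])
    fix n L assume L: "opsub {} L" "P \<inter> GN n \<subseteq> L" "L \<subseteq> Q \<inter> GN n"
    have "len L (Q \<inter> GN n) \<le> glen P Q n"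
      unfolding glen_def using L by (intro len_mono opsub_piece[OF o(1)] opsub_piece[OF o(2)]) auto
    then show "len L (Q \<inter> GN n) \<le> enat (\<Sum>k \<in> {b..n}. g k)" using PQ_len[of n] by (rule order_trans)
  qed
qed

section \<open>Homogeneous primes and graded prime filtrations\<close>

context
  fixes Y
  assumes gen: "generates Y (carrier S)" and Y: "Y \<subseteq> GS 1" and noe: "noetherian_ring S"
begin

lemma Y_sub: "Y \<subseteq> carrier S"
  using generatesD(3)[OF gen] .

lemma opsub_smult: "opsub Y P \<Longrightarrow> s \<in> carrier S \<Longrightarrow> x \<in> P \<Longrightarrow> s \<boxdot> x \<in> P"
  using generatesD(6)[OF gen] .

text \<open>Instead of expanding coefficients, one checks that the elements whose components all
  stay in the module form a submodule containing \<open>P\<close> and \<open>x\<close>. The next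
  lemma works in the same way.\<close>

lemma homog_plus_cyclic:
  assumes P: "opsub Y P" "homog P" and x: "x \<in> GN d"
  shows "homog (plus_cyclic P (carrier S) x)"
proof -
  note xc = GN_carrier[OF x]
  note pc = plus_cyclic[OF gen P(1) xc]
  let ?Q = "plus_cyclic P (carrier S) x"
  note cQ = opsub_carrier[OF pc(1)]
  define H where "H = {z \<in> ?Q. \<forall>n. hcomp n z \<in> ?Q}"
  have oH: "opsub Y H"
  proof (rule opsubI)
    show "H \<subseteq> carrier N" unfolding H_def using cQ by blast
    show "\<zero>\<^bsub>N\<^esub> \<in> H" unfolding H_def using opsub_zero[OF pc(1)] by simp
    show "z \<boxplus> w \<in> H" if "z \<in> H" "w \<in> H" for z w
      using that opsub_add[OF pc(1)] cQ unfolding H_def by (simp add: hcomp_add)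
    show "a \<boxdot> z \<in> H" if "a \<in> GS 0" "z \<in> H" for a z
      using that opsub_A0[OF pc(1)] cQ hcomp_smult[of a 0] unfolding H_def by simp
    show "a \<boxdot> z \<in> H" if a: "a \<in> Y" and z: "z \<in> H" for a z
    proof -
      have a1: "a \<in> GS 1" using a Y by blast
      show ?thesis using z opsub_op[OF pc(1) a] cQ hcomp_smult[OF a1] unfolding H_def by simp
    qed
  qed
  have "P \<subseteq> H" unfolding H_def using pc(2) homogD[OF P(2)] by blast
  moreover have "x \<in> H"
    unfolding H_def using pc(3) hcomp_homogeneous[OF x] opsub_zero[OF pc(1)] by simp
  ultimately have "?Q \<subseteq> H" using pc(4)[OF oH] by blast
  then show ?thesis unfolding H_def homog_def by blast
qed

lemma plus_cyclic_low:
  assumes P: "opsub Y P" "homog P" and x: "x \<in> GN d" and n: "n < d"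
  shows "P \<inter> GN n = plus_cyclic P (carrier S) x \<inter> GN n"
proof
  note xc = GN_carrier[OF x]
  note pc = plus_cyclic[OF gen P(1) xc]
  let ?Q = "plus_cyclic P (carrier S) x"
  show "P \<inter> GN n \<subseteq> ?Q \<inter> GN n" using pc(2) by blast
  define H where "H = {z \<in> carrier N. \<forall>n < d. hcomp n z \<in> P}"
  have oH: "opsub Y H"
  proof (rule opsubI)
    show "H \<subseteq> carrier N" unfolding H_def by blast
    show "\<zero>\<^bsub>N\<^esub> \<in> H" unfolding H_def using opsub_zero[OF P(1)] by simp
    show "z \<boxplus> w \<in> H" if "z \<in> H" "w \<in> H" for z w
      using that opsub_add[OF P(1)] unfolding H_def by (simp add: hcomp_add)
    show "a \<boxdot> z \<in> H" if "a \<in> GS 0" "z \<in> H" for a z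
      using that opsub_A0[OF P(1)] A0_carrier hcomp_smult[of a 0] unfolding H_def by simp
    show "a \<boxdot> z \<in> H" if a: "a \<in> Y" and z: "z \<in> H" for a z
    proof -
      have a1: "a \<in> GS 1" using a Y by blast
      show ?thesis using z opsub_op[OF P(1) a] GS_carrier[OF a1] hcomp_smult[OF a1] unfolding H_def by simp
    qed
  qed
  have "P \<subseteq> H" unfolding H_def using homogD[OF P(2)] opsub_carrier[OF P(1)] by blast
  moreover have "x \<in> H" unfolding H_def using xc hcomp_homogeneous[OF x] opsub_zero[OF P(1)] by simp
  ultimately have QH: "?Q \<subseteq> H" using pc(4)[OF oH] by blast
  show "?Q \<inter> GN n \<subseteq> P \<inter> GN n"
  proof
    fix z assume z: "z \<in> ?Q \<inter> GN n"
    then have "hcomp n z \<in> P" using QH n unfolding H_def by blast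
    then show "z \<in> P \<inter> GN n" using hcomp_homogeneous[of z n n] z by simp
  qed
qed

lemma hcomp_smult_multiple:
  assumes x: "x \<in> GN d" and s: "s \<in> carrier S"
  shows "\<exists>r \<in> carrier S. hcomp n (s \<boxdot> x) = r \<boxdot> x"
proof -
  note xc = GN_carrier[OF x]
  obtain c where c: "\<And>k. c k \<in> GS k" "finite {k. c k \<noteq> \<zero>}" "s = finsum S c {k. c k \<noteq> \<zero>}"
    using GS_decomp[OF s] unfolding homog_decomp_def by blast
  note cc = GS_carrier[OF c(1)]
  have "finite F \<Longrightarrow> \<exists>r \<in> carrier S. hcomp n (finsum S c F \<boxdot> x) = r \<boxdot> x" for F
  proof (induction F rule: finite_induct)
    case empty
    then show ?case using xc by (intro bexI[of _ \<zero>]) auto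
  next
    case (insert k F)
    then obtain r where r: "r \<in> carrier S" "hcomp n (finsum S c F \<boxdot> x) = r \<boxdot> x" by blast
    define r' where "r' = (if n = int k + d then c k else \<zero>)"
    have r': "r' \<in> carrier S" unfolding r'_def using cc by simp
    have "hcomp n (c k \<boxdot> x) = r' \<boxdot> x"
      unfolding r'_def using hcomp_homogeneous[OF GN_smult[OF c(1) x]] xc by simp
    moreover have "finsum S c (insert k F) = c k \<oplus> finsum S c F"
      using insert.hyps cc by (intro R.finsum_insert) auto
    moreover have fc: "finsum S c F \<in> carrier S" using cc by (intro R.finsum_closed) auto
    ultimately have "hcomp n (finsum S c (insert k F) \<boxdot> x) = (r' \<oplus> r) \<boxdot> x"
      using xc r r' cc by (simp add: smult_l_distr hcomp_add)
    then show ?case using r r' by blast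
  qed
  then show ?thesis using c by blast
qed

lemma ideal_annS: "opsub Y P \<Longrightarrow> x \<in> carrier N \<Longrightarrow> ideal (ann (carrier S) P x) S"
  using ideal_ann[OF gen, of P x] by simp

text \<open>Choose an annihilator maximal among those of homogeneous elements outside
  \<open>L\<close>. Primeness has to be tested on arbitrary \<open>a\<close> and \<open>b\<close>,
  and \<open>z = b \<boxdot> x\<close> need not be homogeneous. But each component of
  \<open>z\<close> outside \<open>L\<close> is again a multiple of \<open>x\<close>, so by
  maximality it has the same annihilator, and leading terms can be compared.\<close>

lemma homogeneous_prime_annihilator:
  assumes L: "opsub Y L" "homog L" and Q: "opsub Y Q" "homog Q" and LQ: "L \<subseteq> Q" "L \<noteq> Q"
  shows "\<exists>d x. x \<in> Q \<and> x \<in> GN d \<and> x \<notin> L \<and> primeideal (ann (carrier S) L x) S"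
proof -
  let ?A = "ann (carrier S) L"
  let ?X = "{x \<in> Q - L. \<exists>d. x \<in> GN d}"
  note cL = opsub_carrier[OF L(1)] and cQ = opsub_carrier[OF Q(1)]
  have "\<not> (\<forall>n. Q \<inter> GN n \<subseteq> L)" using homog_subsetI[OF Q L(1)] LQ by blast
  then have "?X \<noteq> {}" by blast
  then have "\<exists>I \<in> ?A ` ?X. \<forall>J \<in> ?A ` ?X. I \<subseteq> J \<longrightarrow> J = I"
    using ideal_annS[OF L(1)] cQ by (intro noetherian_ring_maximal[OF noe]) auto
  then obtain I where I: "I \<in> ?A ` ?X" "\<forall>J \<in> ?A ` ?X. I \<subseteq> J \<longrightarrow> J = I" by (elim bexE)
  obtain x where xX: "x \<in> ?X" and Ix: "I = ?A x" using I(1) by (elim imageE)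
  obtain d where x: "x \<in> Q" "x \<notin> L" "x \<in> GN d" using xX by blast
  have max: "?A z = ?A x" if "z \<in> ?X" "?A x \<subseteq> ?A z" for z
    using I(2) that unfolding Ix ball_simps by blast
  note xc = GN_carrier[OF x(3)]
  have idl: "ideal (?A x) S" using ideal_annS[OF L(1) xc] .
  have "primeideal (?A x) S"
  proof (rule primeidealI[OF idl R.is_cring])
    have "\<one> \<notin> ?A x" unfolding ann_def using x xc by simp
    then show "carrier S \<noteq> ?A x" by blast
    fix a b assume a: "a \<in> carrier S" and b: "b \<in> carrier S" and ab: "a \<otimes> b \<in> ?A x"
    show "a \<in> ?A x \<or> b \<in> ?A x"
    proof (rule disjCI)
      assume bx: "b \<notin> ?A x"
      define z where "z = b \<boxdot> x"
      have zc: "z \<in> carrier N" unfolding z_def using b xc by simp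
      have zQ: "z \<in> Q" unfolding z_def using opsub_smult[OF Q(1) b x(1)] .
      have zL: "z \<notin> L" using bx b unfolding ann_def z_def by simp
      have az: "a \<boxdot> z \<in> L" using ab a b xc unfolding ann_def z_def by (simp add: smult_assoc1)
      have Az: "q \<boxdot> z \<in> L" if q: "q \<in> ?A x" for q
      proof -
        have "q \<in> carrier S" "q \<boxdot> x \<in> L" using q unfolding ann_def by auto
        then show ?thesis
          unfolding z_def using opsub_smult[OF L(1) b, of "q \<boxdot> x"] smult_comm[OF _ b xc, of q] by simp
      qed
      have comp: "?A (hcomp n z) = ?A x" if n: "hcomp n z \<notin> L" for n
      proof (rule max)
        show "hcomp n z \<in> ?X" using n homogD[OF Q(2) zQ] hcomp_GN[OF zc] by blast
        obtain r where r: "r \<in> carrier S" "hcomp n z = r \<boxdot> x"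
          using hcomp_smult_multiple[OF x(3) b] unfolding z_def by blast
        show "?A x \<subseteq> ?A (hcomp n z)"
        proof
          fix q assume q: "q \<in> ?A x"
          then have "q \<in> carrier S" "q \<boxdot> x \<in> L" unfolding ann_def by auto
          then show "q \<in> ?A (hcomp n z)"
            unfolding ann_def r(2)
            using opsub_smult[OF L(1) r(1), of "q \<boxdot> x"] smult_comm[OF _ r(1) xc, of q] by simp
        qed
      qed
      let ?B = "{n. hcomp n z \<notin> L}"
      have "?B \<subseteq> {n. hcomp n z \<noteq> \<zero>\<^bsub>N\<^esub>}" using opsub_zero[OF L(1)] by auto
      then have finB: "finite ?B" using finite_hcomp[OF zc] finite_subset by blast
      have neB: "?B \<noteq> {}" using mem_of_hcomp[OF L(1) zc] zL by blast
      \<comment> \<open>The top degree of \<open>z\<close> modulo \<open>L\<close>. If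
        \<open>i\<close> is the top degree of \<open>a\<close>, then modulo \<open>L\<close> only
        \<open>c i \<boxdot> hcomp m z\<close> remains in degree \<open>i + m\<close> of
        \<open>a \<boxdot> z\<close>. So \<open>c i\<close> annihilates \<open>x\<close>, and it can
        be removed from \<open>a\<close> before repeating the argument.\<close>
      define m where "m = Max ?B"
      have mB: "hcomp m z \<notin> L" using Max_in[OF finB neB] unfolding m_def by blast
      have mtop: "hcomp n z \<in> L" if "n > m" for n
        using Max_ge[OF finB, of n] that unfolding m_def by (metis mem_Collect_eq not_le)
      obtain c where c: "\<And>k. c k \<in> GS k" "finite {k. c k \<noteq> \<zero>}" "a = finsum S c {k. c k \<noteq> \<zero>}"
        using GS_decomp[OF a] unfolding homog_decomp_def by blast
      note cc = GS_carrier[OF c(1)]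
      have fc: "finsum S c F \<in> carrier S" for F using cc by (intro R.finsum_closed) auto
      have ins: "finsum S c (insert k F) = c k \<oplus> finsum S c F" if "finite F" "k \<notin> F" for k F
        using that cc by (intro R.finsum_insert) auto
      have lower: "finite F \<Longrightarrow> \<forall>k \<in> F. k < i \<Longrightarrow> hcomp (int i + m) (finsum S c F \<boxdot> z) \<in> L" for F i
      proof (induction F rule: finite_induct)
        case empty then show ?case using zc opsub_zero[OF L(1)] by simp
      next
        case (insert k F)
        have "hcomp (int i + m) (c k \<boxdot> z) = c k \<boxdot> hcomp (int i + m - int k) z"
          using hcomp_smult[OF c(1) zc] .
        moreover have "hcomp (int i + m - int k) z \<in> L" using insert.prems by (intro mtop) auto
        ultimately have "hcomp (int i + m) (c k \<boxdot> z) \<in> L" using opsub_smult[OF L(1) cc] by simp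
        moreover have "hcomp (int i + m) (finsum S c F \<boxdot> z) \<in> L" using insert by blast
        ultimately show ?case
          unfolding ins[OF insert.hyps(1,2)] using cc fc zc opsub_add[OF L(1)]
          by (simp add: smult_l_distr hcomp_add)
      qed
      have "finite F \<Longrightarrow> finsum S c F \<boxdot> z \<in> L \<Longrightarrow> finsum S c F \<in> ?A x" for F
      proof (induction F rule: finite_linorder_max_induct)
        case empty
        then show ?case unfolding ann_def using xc opsub_zero[OF L(1)] by simp
      next
        case (insert i F)
        have iF: "i \<notin> F" using insert.hyps(2) by blast
        note e = ins[OF insert.hyps(1) iF]
        have sum: "finsum S c (insert i F) \<boxdot> z = c i \<boxdot> z \<boxplus> finsum S c F \<boxdot> z"
          unfolding e using cc fc zc by (simp add: smult_l_distr)
        have "hcomp (int i + m) (finsum S c (insert i F) \<boxdot> z) \<in> L" using homogD[OF L(2) insert.prems] .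
        moreover have "hcomp (int i + m) (finsum S c (insert i F) \<boxdot> z) =
            hcomp (int i + m) (finsum S c F \<boxdot> z) \<boxplus> c i \<boxdot> hcomp m z"
          unfolding sum using cc fc zc hcomp_smult[OF c(1) zc, of "int i + m" i] hcomp_carrier
          by (simp add: hcomp_add M.a_comm)
        ultimately have "c i \<boxdot> hcomp m z \<in> L"
          using opsub_add_iff[OF L(1) lower[OF insert.hyps(1,2)]] cc hcomp_carrier[OF zc] by simp
        then have "c i \<in> ?A (hcomp m z)" unfolding ann_def using cc by blast
        then have ci: "c i \<in> ?A x" using comp[OF mB] by simp
        have "finsum S c F \<boxdot> z \<in> L"
          using opsub_add_iff[OF L(1) Az[OF ci]] insert.prems fc zc unfolding sum by simp
        then have "finsum S c F \<in> ?A x" using insert.IH by blast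
        then show ?case
          unfolding e using ci additive_subgroup.a_closed[OF ideal.axioms(1)[OF idl]] by blast
      qed
      then show "a \<in> ?A x" using az c(2) unfolding c(3)[symmetric] by (metis c(3))
    qed
  qed
  then show ?thesis using x by blast
qed

text \<open>Here the quotient is a module over the residue field of \<open>GS 0\<close>, generated
  by the class of \<open>x\<close> in degree \<open>d\<close>. Its length is at most one, which is
  the finite support demanded at growth index \<open>1\<close>.\<close>

lemma dominated_plus_cyclic_trivial:
  assumes P: "opsub Y P" "homog P" and x: "x \<in> GN d" and YA: "\<And>a. a \<in> mm \<union> Y \<Longrightarrow> a \<boxdot> x \<in> P"
  shows "dominated c (Suc 0) P (plus_cyclic P (carrier S) x)"
proof -
  note xc = GN_carrier[OF x]
  note pc = plus_cyclic[OF gen P(1) xc]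
  let ?Q = "plus_cyclic P (carrier S) x"
  have oP0: "opsub {} P" using opsub_base[OF P(1)] .
  note pc0 = plus_cyclic[OF generates_A0 oP0 xc]
  note c0 = opsub_carrier[OF pc0(1)] and cP = opsub_carrier[OF P(1)]
  \<comment> \<open>Coefficients from \<open>GS 0\<close> suffice because every operator in
    \<open>Y\<close> sends \<open>x\<close> into \<open>P\<close>.\<close>
  have "opsub Y (plus_cyclic P (GS 0) x)"
  proof (rule opsubI)
    show "plus_cyclic P (GS 0) x \<subseteq> carrier N" using c0 by blast
    show "\<zero>\<^bsub>N\<^esub> \<in> plus_cyclic P (GS 0) x" using opsub_zero[OF pc0(1)] .
    show "z \<boxplus> w \<in> plus_cyclic P (GS 0) x" if "z \<in> plus_cyclic P (GS 0) x" "w \<in> plus_cyclic P (GS 0) x" for z w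
      using opsub_add[OF pc0(1) that] .
    show "a \<boxdot> z \<in> plus_cyclic P (GS 0) x" if "a \<in> GS 0" "z \<in> plus_cyclic P (GS 0) x" for a z
      using opsub_A0[OF pc0(1) that] .
    show "a \<boxdot> z \<in> plus_cyclic P (GS 0) x" if a: "a \<in> Y" and z: "z \<in> plus_cyclic P (GS 0) x" for a z
    proof -
      obtain p s where ps: "z = p \<boxplus> s \<boxdot> x" "p \<in> P" "s \<in> GS 0" using z unfolding plus_cyclic_def by blast
      have ac: "a \<in> carrier S" using a Y_sub by blast
      have sc: "s \<in> carrier S" using A0_carrier[OF ps(3)] .
      have "a \<boxdot> z = a \<boxdot> p \<boxplus> s \<boxdot> a \<boxdot> x"
        unfolding ps(1) using ac sc xc cP[OF ps(2)] by (simp add: smult_r_distr smult_comm)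
      moreover have "a \<boxdot> p \<in> P" "s \<boxdot> a \<boxdot> x \<in> P"
        using opsub_op[OF P(1) a ps(2)] opsub_A0[OF P(1) ps(3)] YA[of a] a by blast+
      ultimately have "a \<boxdot> z \<in> P" using opsub_add[OF P(1)] by simp
      then show ?thesis using pc0(2) by blast
    qed
  qed
  then have Q0: "?Q \<subseteq> plus_cyclic P (GS 0) x" using pc(4) pc0(2,3) by blast
  have other: "?Q \<inter> GN n \<subseteq> P" if n: "n \<noteq> d" for n
  proof
    fix z assume z: "z \<in> ?Q \<inter> GN n"
    then obtain p s where ps: "z = p \<boxplus> s \<boxdot> x" "p \<in> P" "s \<in> GS 0"
      using Q0 unfolding plus_cyclic_def by blast
    have sx: "s \<boxdot> x \<in> GN d" using GN_smult[OF ps(3) x] by simp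
    have "z = hcomp n z" using hcomp_homogeneous[of z n n] z by simp
    also have "\<dots> = hcomp n p"
      unfolding ps(1) using cP[OF ps(2)] GN_carrier[OF sx] hcomp_homogeneous[OF sx, of n] n hcomp_carrier
      by (simp add: hcomp_add)
    finally show "z \<in> P" using homogD[OF P(2) ps(2)] by simp
  qed
  \<comment> \<open>An element outside \<open>P\<close> has a coefficient outside \<open>mm\<close>;
    this is a unit, and \<open>x\<close> can be recovered. So nothing lies strictly between the two
    pieces.\<close>
  have two: "B = P \<inter> GN d \<or> B = ?Q \<inter> GN d" if B: "opsub {} B" "P \<inter> GN d \<subseteq> B" "B \<subseteq> ?Q \<inter> GN d" for B
  proof (cases "B \<subseteq> P")
    case True then show ?thesis using B by blast
  next
    case False
    then obtain z where z: "z \<in> B" "z \<notin> P" by blast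
    then obtain p s where ps: "z = p \<boxplus> s \<boxdot> x" "p \<in> P" "s \<in> GS 0"
      using Q0 B(3) unfolding plus_cyclic_def by blast
    have sx: "s \<boxdot> x \<in> GN d" using GN_smult[OF ps(3) x] by simp
    have sxc: "s \<boxdot> x \<in> carrier N" using GN_carrier[OF sx] .
    have piece: "p \<in> GN d" if "p \<boxplus> s \<boxdot> x \<in> GN d" "s \<boxdot> x \<in> GN d" "p \<in> P" for p s
      using opsub_add_iff[OF opsub_GN that(2), of p] that(1) cP[OF that(3)] GN_carrier[OF that(2)]
      by (simp add: M.a_comm)
    have "p \<in> GN d" by (rule piece[OF _ sx ps(2)]) (use z B(3) ps(1) in blast)
    then have pB: "p \<in> B" using B(2) ps(2) by blast
    have sxB: "s \<boxdot> x \<in> B" using opsub_add_iff[OF B(1) pB sxc] z(1) ps(1) by blast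
    have "s \<notin> mm"
    proof
      assume "s \<in> mm"
      then have "s \<boxdot> x \<in> P" using YA by blast
      then show False using z(2) ps opsub_add[OF P(1)] by blast
    qed
    then obtain b where b: "b \<in> GS 0" "b \<otimes> s = \<one>" using unit_if_not_mm[OF ps(3)] by blast
    have "b \<boxdot> s \<boxdot> x = x"
      using smult_assoc1[of b s x] b A0_carrier[OF b(1)] A0_carrier[OF ps(3)] xc by simp
    then have xB: "x \<in> B" using opsub_A0[OF B(1) b(1) sxB] by simp
    have "?Q \<inter> GN d \<subseteq> B"
    proof
      fix w assume w: "w \<in> ?Q \<inter> GN d"
      then obtain p s where ps: "w = p \<boxplus> s \<boxdot> x" "p \<in> P" "s \<in> GS 0"
        using Q0 unfolding plus_cyclic_def by blast
      have sx: "s \<boxdot> x \<in> GN d" using GN_smult[OF ps(3) x] by simp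
      have "p \<in> GN d" by (rule piece[OF _ sx ps(2)]) (use w ps(1) in blast)
      then have "p \<in> B" using B(2) ps(2) by blast
      then show "w \<in> B" unfolding ps(1) using opsub_add[OF B(1)] opsub_A0[OF B(1) ps(3) xB] by blast
    qed
    then show ?thesis using B(3) by blast
  qed
  have len1: "len (P \<inter> GN d) (?Q \<inter> GN d) \<le> enat 1"
  proof (rule ccontr)
    assume "\<not> ?thesis"
    then have "enat 2 \<le> len (P \<inter> GN d) (?Q \<inter> GN d)"
      by (cases "len (P \<inter> GN d) (?Q \<inter> GN d)") auto
    moreover have "P \<inter> GN d \<subseteq> ?Q \<inter> GN d" using pc(2) by blast
    ultimately obtain k where k: "k \<ge> 2" "schain k (P \<inter> GN d) (?Q \<inter> GN d)"
      using len_ge_iff[OF opsub_piece[OF P(1)] opsub_piece[OF pc(1)]] by blast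
    obtain j where j: "k = Suc (Suc j)" using k(1) by (metis Suc_le_D numeral_2_eq_2 Suc_le_mono)
    obtain B where B: "schain (Suc j) (P \<inter> GN d) B" "B \<subset> ?Q \<inter> GN d"
      using k(2) unfolding j by (cases rule: schain.cases) auto
    obtain C where C: "schain j (P \<inter> GN d) C" "C \<subset> B"
      using B(1) by (cases rule: schain.cases) auto
    have "opsub {} B" "P \<inter> GN d \<subseteq> C" using schain_opsub[OF B(1)] schain_opsub[OF C(1)] by auto
    then show False using two[of B] B(2) C(2) by blast
  qed
  show ?thesis
  proof (rule dominatedI[where f = "\<lambda>n. if n = d then 1 else 0"])
    show "growth (Suc 0) (\<lambda>n. if n = d then 1 else 0)" by simp
    fix n L assume L: "opsub {} L" "P \<inter> GN n \<subseteq> L" "L \<subseteq> ?Q \<inter> GN n"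
    show "len L (?Q \<inter> GN n) \<le> enat (if n = d then 1 else 0)"
    proof (cases "n = d")
      case True
      have "len L (?Q \<inter> GN d) \<le> len (P \<inter> GN d) (?Q \<inter> GN d)"
        using L unfolding True by (intro len_mono opsub_piece[OF P(1)] opsub_piece[OF pc(1)]) auto
      then show ?thesis using len1 True by (simp add: order_trans)
    next
      case False
      have "L = ?Q \<inter> GN n" using other[OF False] L by blast
      then show ?thesis using len_self[OF L(1)] by simp
    qed
  qed
qed

text \<open>Noetherian induction replaces an explicit prime filtration: each cyclic extension by a
  homogeneous element with prime annihilator is one of its factors.\<close>

lemma dominated_devissage:
  assumes nQ: "noeth Y P Q" and P: "opsub Y P" "homog P" and Q: "opsub Y Q" "homog Q" and PQ: "P \<subseteq> Q"
    and cyc: "\<And>L x d. opsub Y L \<Longrightarrow> homog L \<Longrightarrow> P \<subseteq> L \<Longrightarrow> x \<in> Q \<Longrightarrow> x \<in> GN d \<Longrightarrow>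
       primeideal (ann (carrier S) L x) S \<Longrightarrow> dominated c e L (plus_cyclic L (carrier S) x)"
  shows "dominated c e P Q"
proof -
  have "homog P \<longrightarrow> dominated c e P Q"
    using nQ P(1) PQ
  proof (rule noeth_induct)
    fix L assume L: "opsub Y L" "P \<subseteq> L" "L \<subseteq> Q"
      and IH: "\<And>L'. opsub Y L' \<Longrightarrow> L \<subset> L' \<Longrightarrow> L' \<subseteq> Q \<Longrightarrow> homog L' \<longrightarrow> dominated c e L' Q"
    show "homog L \<longrightarrow> dominated c e L Q"
    proof
      assume hL: "homog L"
      show "dominated c e L Q"
      proof (cases "L = Q")
        case True then show ?thesis using dominated_self by simp
      next
        case False
        obtain d x where x: "x \<in> Q" "x \<in> GN d" "x \<notin> L" "primeideal (ann (carrier S) L x) S"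
          using homogeneous_prime_annihilator[OF L(1) hL Q L(3) False] by blast
        let ?L = "plus_cyclic L (carrier S) x"
        note pc = plus_cyclic[OF gen L(1) GN_carrier[OF x(2)]]
        have LQ: "?L \<subseteq> Q" using pc(4)[OF Q(1) L(3) x(1)] .
        have "dominated c e L ?L" using cyc[OF L(1) hL L(2) x(1,2,4)] .
        moreover have "L \<subset> ?L" using pc(2,3) x(3) by blast
        then have "dominated c e ?L Q" using IH[OF pc(1) _ LQ] homog_plus_cyclic[OF L(1) hL x(2)] by blast
        ultimately show ?thesis using dominated_trans[OF L(1) pc(1) Q(1) pc(2) LQ] by blast
      qed
    qed
  qed
  then show ?thesis using P(2) by blast
qed

text \<open>For the prime \<open>p = ann (carrier S) P x\<close>, the last assumption says that
  \<open>S / p\<close> has dimension less than \<open>e\<close>, matching the index of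
  \<open>growth\<close>. At \<open>e = 0\<close> it is contradictory, since \<open>p\<close> alone
  is a chain of length zero.\<close>

theorem dominated_cyclic:
  assumes nN: "noeth Y {\<zero>\<^bsub>N\<^esub>} (carrier N)"
    and "opsub Y P" "homog P" "x \<in> GN d" "primeideal (ann (carrier S) P x) S"
    and "\<not> prime_chain S e (ann (carrier S) P x)"
  shows "dominated c e P (plus_cyclic P (carrier S) x)"
  using assms(2-)
proof (induction e arbitrary: P x d)
  case 0
  have "prime_chain S 0 (ann (carrier S) P x)"
    unfolding prime_chain_def by (intro exI[of _ "\<lambda>_. ann (carrier S) P x"]) (use 0 in simp)
  then show ?case using 0 by blast
next
  case (Suc e)
  note P = Suc.prems(1,2) and x = Suc.prems(3)
  let ?A = "ann (carrier S) P x" and ?Q = "plus_cyclic P (carrier S) x"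
  note xc = GN_carrier[OF x]
  note pc = plus_cyclic[OF gen P(1) xc]
  have hQ: "homog ?Q" using homog_plus_cyclic[OF P x] .
  have kill: "q \<boxdot> z \<in> P" if q: "q \<in> ?A" and z: "z \<in> ?Q" for q z
  proof -
    obtain p s where ps: "z = p \<boxplus> s \<boxdot> x" "p \<in> P" "s \<in> carrier S" using z unfolding plus_cyclic_def by blast
    have qc: "q \<in> carrier S" "q \<boxdot> x \<in> P" using q unfolding ann_def by auto
    have "q \<boxdot> z = q \<boxdot> p \<boxplus> s \<boxdot> q \<boxdot> x"
      unfolding ps(1) using qc ps xc opsub_carrier[OF P(1) ps(2)] by (simp add: smult_r_distr smult_comm)
    then show ?thesis
      using opsub_add[OF P(1) opsub_smult[OF P(1) qc(1) ps(2)] opsub_smult[OF P(1) ps(3) qc(2)]] by simp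
  qed
  \<comment> \<open>Every prime annihilator met while filtering \<open>?Q / (P + a ?Q)\<close>
    contains both \<open>?A\<close> and \<open>a\<close>. It is strictly larger than
    \<open>?A\<close>, hence starts no chain of length \<open>e\<close>, and the induction
    hypothesis applies.\<close>
  have key: "dominated c e (plus_mult P a ?Q) ?Q"
    if a: "a \<in> GS k" "a \<notin> ?A" for a k
  proof -
    note ac = GS_carrier[OF a(1)]
    let ?R = "plus_mult P a ?Q"
    have oR: "opsub Y ?R" using opsub_plus_mult[OF P(1) pc(1) ac Y_sub] .
    have hR: "homog ?R" using homog_plus_mult[OF P(2) hQ a(1) P(1) pc(1)] .
    have PR: "P \<subseteq> ?R" using plus_mult_left[OF P(1) pc(1) ac] .
    have RQ: "?R \<subseteq> ?Q" using plus_mult_least[OF pc(1) pc(2), of ?Q a] opsub_smult[OF pc(1) ac] by blast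
    have nR: "noeth Y ?R ?Q"
      by (rule noeth_mono[OF nN]) (use opsub_zero[OF oR] opsub_subset[OF pc(1)] in auto)
    show ?thesis
    proof (rule dominated_devissage[OF nR oR hR pc(1) hQ RQ])
      fix L z d' assume L: "opsub Y L" "homog L" "?R \<subseteq> L" and z: "z \<in> ?Q" "z \<in> GN d'"
        and pr: "primeideal (ann (carrier S) L z) S"
      have "?A \<subseteq> ann (carrier S) L z"
      proof
        fix q assume q: "q \<in> ?A"
        then have "q \<boxdot> z \<in> L" using kill[OF q z(1)] PR L(3) by blast
        then show "q \<in> ann (carrier S) L z" using q unfolding ann_def by blast
      qed
      moreover have "a \<in> ann (carrier S) L z"
        unfolding ann_def using ac plus_mult_right[OF P(1) pc(1) ac z(1)] L(3) by blast
      ultimately have "?A \<subset> ann (carrier S) L z" using a(2) by blast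
      then have "\<not> prime_chain S e (ann (carrier S) L z)"
        using prime_chain_Suc[OF Suc.prems(4)] Suc.prems(5) by blast
      then show "dominated c e L (plus_cyclic L (carrier S) z)" using Suc.IH[OF L(1,2) z(2) pr] by blast
    qed
  qed
  \<comment> \<open>Elements of \<open>mm\<close> are tried first: division by an element of degree
    one is estimated only when \<open>mm\<close> already kills the module.\<close>
  consider t where "t \<in> mm" "t \<notin> ?A" | a where "a \<in> Y" "a \<notin> ?A" "mm \<subseteq> ?A" | "mm \<union> Y \<subseteq> ?A" by blast
  then show ?case
  proof cases
    case 1
    show ?thesis
      using dominated_plus_mult_mm[OF P(1) pc(1) P(2) hQ 1(1) key[OF mm_A0[OF 1(1)] 1(2)]] .
  next
    case 2
    have a1: "a \<in> GS 1" using 2(1) Y by blast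
    show ?thesis
    proof (rule dominated_plus_mult_degree_1[OF P(1) pc(1) P(2) hQ pc(2) a1 2(1) Y_sub])
      show "t \<boxdot> z \<in> P" if "t \<in> mm" "z \<in> ?Q" for t z using kill[OF _ that(2)] that(1) 2(3) by blast
      show "P \<inter> GN n = ?Q \<inter> GN n" if "n < d" for n using plus_cyclic_low[OF P x that] .
      show "dominated c e (plus_mult P a ?Q) ?Q" using key[OF a1 2(2)] .
    qed
  next
    case 3
    have "dominated c (Suc 0) P ?Q"
      by (rule dominated_plus_cyclic_trivial[OF P x]) (use 3 in \<open>auto simp: ann_def\<close>)
    then show ?thesis unfolding dominated_def using growth_le[of "Suc 0" _ "Suc e"] by blast
  qed
qed

text \<open>The domination of \<open>N\<close> over zero is used with \<open>L\<close> the piece of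
  \<open>M\<close> in degree \<open>n\<close>; by \<open>mlinear\<close> this piece contains a
  linear power of \<open>mm\<close> times the piece of \<open>N\<close>.\<close>

theorem glen_growth:
  assumes nN: "noeth Y {\<zero>\<^bsub>N\<^esub>} (carrier N)" and M: "opsub {} M" and lin: "mlinear M (carrier N)"
    and dim: "\<And>Q. \<not> prime_chain S e Q"
  shows "\<exists>f. growth e f \<and> (\<forall>n \<ge> 1. glen M (carrier N) n \<le> enat (f n))"
proof -
  obtain c where c: "\<And>n. n \<ge> 1 \<Longrightarrow> carrier N \<inter> GN n \<subseteq> (mcolon ^^ (c * nat n)) M"
    using lin unfolding mlinear_def by blast
  have "dominated c e {\<zero>\<^bsub>N\<^esub>} (carrier N)"
    by (rule dominated_devissage[OF nN opsub_zero_set[OF Y_sub] homog_zero_set opsub_carrier_set[OF Y_sub]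
          homog_carrier]) (use dominated_cyclic[OF nN] dim in simp_all)
  then obtain f where f: "growth e f" "\<And>n L. opsub {} L \<Longrightarrow> {\<zero>\<^bsub>N\<^esub>} \<inter> GN n \<subseteq> L \<Longrightarrow> L \<subseteq> carrier N \<inter> GN n \<Longrightarrow>
     carrier N \<inter> GN n \<subseteq> (mcolon ^^ Suc (c * nat n)) L \<Longrightarrow> len L (carrier N \<inter> GN n) \<le> enat (f n)"
    unfolding dominated_def by blast
  have "glen M (carrier N) n \<le> enat (f n)" if n: "n \<ge> 1" for n
    unfolding glen_def
  proof (rule f(2))
    show o: "opsub {} (M \<inter> GN n)" using opsub_piece[OF M] .
    show "{\<zero>\<^bsub>N\<^esub>} \<inter> GN n \<subseteq> M \<inter> GN n" using opsub_zero[OF o] by blast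
    show "M \<inter> GN n \<subseteq> carrier N \<inter> GN n" using opsub_subset[OF M] by blast
    have "carrier N \<inter> GN n \<subseteq> (mcolon ^^ (c * nat n)) (M \<inter> GN n)"
      unfolding mcolon_pow_Int using c[OF n] mcolon_pow_increasing[OF opsub_GN] by blast
    also have "\<dots> \<subseteq> (mcolon ^^ Suc (c * nat n)) (M \<inter> GN n)" using mcolon_pow_Suc[OF o] .
    finally show "carrier N \<inter> GN n \<subseteq> (mcolon ^^ Suc (c * nat n)) (M \<inter> GN n)" .
  qed
  then show ?thesis using f(1) by blast
qed

end

end

section \<open>Degree bounds\<close>

lemma poly_eventually_ge_lead_coeff:
  fixes p :: "'a :: linordered_field poly"
  assumes "lead_coeff p > 0"
  shows "\<exists>n. \<forall>x \<ge> n. poly p x \<ge> lead_coeff p"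
  using assms
proof (induction p)
  case (pCons a p)
  show ?case
  proof (cases "p = 0")
    case False
    have lc: "lead_coeff p > 0" using pCons.prems False by simp
    then obtain n where n: "\<And>x. x \<ge> n \<Longrightarrow> poly p x \<ge> lead_coeff p" using pCons.IH by blast
    have "poly (pCons a p) x \<ge> lead_coeff (pCons a p)" if x: "x \<ge> max n (1 + \<bar>a\<bar> / lead_coeff p)" for x
    proof -
      have "0 \<le> 1 + \<bar>a\<bar> / lead_coeff p" using lc by simp
      then have x0: "x \<ge> 0" using x by simp
      have "lead_coeff p + \<bar>a\<bar> = (1 + \<bar>a\<bar> / lead_coeff p) * lead_coeff p" using lc False by (simp add: distrib_right)
      also have "\<dots> \<le> x * lead_coeff p" using x lc by (intro mult_right_mono) auto
      also have "\<dots> \<le> x * poly p x" using n[of x] x x0 by (intro mult_left_mono) auto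
      finally show ?thesis using False by simp
    qed
    then show ?thesis by blast
  qed (use pCons in auto)
qed simp

text \<open>At index \<open>Suc (degree p)\<close> growth is of order at most
  \<open>degree p - 1\<close>, or of finite support if \<open>p\<close> is constant; either is too
  small. Nonnegativity rules out a negative leading coefficient.\<close>

lemma degree_le_if_growth:
  fixes p :: "rat poly"
  assumes p: "p \<noteq> 0" and g: "growth (Suc (degree p)) f"
    and le: "\<And>n. n \<ge> n0 \<Longrightarrow> 0 \<le> poly p (of_int n) \<and> poly p (of_int n) \<le> of_nat (f n)"
  shows False
proof -
  have int_ge: "\<exists>n \<ge> m. b \<le> rat_of_int n" for b and m :: int
    using ex_le_of_int[of b] by (metis le_max_iff_disj max.cobounded1 of_int_le_iff order_trans)
  have lc: "lead_coeff p > 0"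
  proof (rule ccontr)
    assume "\<not> ?thesis"
    then have "lead_coeff (- p) > 0" using p by (simp add: order_less_le)
    then obtain b where b: "\<And>x. x \<ge> b \<Longrightarrow> poly (- p) x \<ge> lead_coeff (- p)"
      using poly_eventually_ge_lead_coeff by blast
    obtain n where "n \<ge> n0" "b \<le> rat_of_int n" using int_ge by blast
    then show False using b[of "of_int n"] le[of n] \<open>lead_coeff (- p) > 0\<close> by simp
  qed
  show False
  proof (cases "degree p")
    case 0
    then have fin: "finite {n. f n \<noteq> 0}" using g by simp
    have "f n \<noteq> 0" if "n \<ge> n0" for n
    proof
      assume "f n = 0"
      then have "poly p (of_int n) = 0" using le[OF that] by simp
      moreover obtain c where "p = [:c:]" using 0 by (rule degree_eq_zeroE)
      ultimately show False using p by simp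
    qed
    then have "{n0..} \<subseteq> {n. f n \<noteq> 0}" by auto
    then show False using fin infinite_Ici[of n0] finite_subset by blast
  next
    case (Suc e)
    then obtain C B where f: "\<And>n. f n \<le> C * (nat (n + int B) + 1) ^ e" using g by auto
    \<comment> \<open>\<open>r\<close> majorises \<open>f\<close> at nonnegative integers and has
      degree at most \<open>e\<close>, so \<open>p - r\<close> inherits the positive leading
      coefficient of \<open>p\<close> and is eventually positive.\<close>
    define r where "r = smult (of_nat C) ([:of_nat B + 1, 1:] ^ e :: rat poly)"
    have dr: "degree r \<le> e"
      unfolding r_def by (rule order_trans[OF degree_smult_le]) (simp add: degree_linear_power)
    have "coeff (p - r) (degree p) = lead_coeff p" using dr Suc by (simp add: coeff_eq_0)
    moreover have "degree (p - r) = degree p"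
      using degree_add_eq_left[of "- r" p] dr Suc by simp
    ultimately have "lead_coeff (p - r) > 0" using lc by simp
    moreover then obtain b where b: "\<And>x. x \<ge> b \<Longrightarrow> poly (p - r) x \<ge> lead_coeff (p - r)"
      using poly_eventually_ge_lead_coeff by blast
    obtain n where n: "n \<ge> max n0 0" "b \<le> rat_of_int n" using int_ge by blast
    have "rat_of_nat (f n) \<le> poly r (of_int n)"
    proof -
      have "rat_of_nat (f n) \<le> rat_of_nat (C * (nat (n + int B) + 1) ^ e)" using f[of n] of_nat_mono by blast
      also have "\<dots> = of_nat C * (of_int n + of_nat B + 1) ^ e" using n(1) by (simp add: of_nat_nat add_ac)
      also have "\<dots> = poly r (of_int n)" unfolding r_def by (simp add: poly_power algebra_simps)
      finally show ?thesis .
    qed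
    then show False using b[OF n(2)] le[of n] n(1) \<open>lead_coeff (p - r) > 0\<close> by simp
  qed
qed

section \<open>Assembling the tower\<close>

text \<open>A non-unit generates a proper ideal; a maximal ideal above it, supplied by the
  noetherian condition, would have to be \<open>mm\<close>.\<close>

lemma local_noetherian_unit:
  assumes "cring A" "noetherian_ring A" and uniq: "\<And>J. maximalideal J A \<Longrightarrow> J = mm"
    and a: "a \<in> carrier A" "a \<notin> mm"
  shows "\<exists>b \<in> carrier A. b \<otimes>\<^bsub>A\<^esub> a = \<one>\<^bsub>A\<^esub>"
proof (rule ccontr)
  assume no: "\<not> ?thesis"
  interpret A: cring A by fact
  let ?F = "{I. ideal I A \<and> a \<in> I \<and> I \<noteq> carrier A}"
  have "\<one>\<^bsub>A\<^esub> \<notin> PIdl\<^bsub>A\<^esub> a" using no unfolding cgenideal_def by auto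
  then have "PIdl\<^bsub>A\<^esub> a \<in> ?F" using A.cgenideal_ideal[OF a(1)] A.cgenideal_self[OF a(1)] by auto
  then obtain I where I: "I \<in> ?F" "\<forall>J \<in> ?F. I \<subseteq> J \<longrightarrow> J = I"
    using noetherian_ring_maximal[OF assms(2), of ?F] by blast
  have "maximalideal I A"
  proof (rule maximalidealI)
    show "ideal I A" "carrier A \<noteq> I" using I by auto
    fix J assume J: "ideal J A" "I \<subseteq> J" "J \<subseteq> carrier A"
    then show "J = I \<or> J = carrier A" using I by blast
  qed
  then show False using uniq a(2) I(1) by blast
qed

context operator_module
begin

lemma generatesI:
  assumes T: "subring T S" and AY: "A0 \<union> Y \<subseteq> T" and eq: "T = generate_ring (S\<lparr>carrier := T\<rparr>) (A0 \<union> Y)"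
  shows "generates Y T"
proof -
  have "t \<boxdot> x \<in> P" if P: "opsub Y P" and t: "t \<in> T" and x: "x \<in> P" for P t x
  proof -
    have "t \<in> T \<and> (\<forall>x \<in> P. t \<boxdot> x \<in> P)" if "t \<in> generate_ring (S\<lparr>carrier := T\<rparr>) (A0 \<union> Y)" for t
      using that
    proof (induction rule: generate_ring.induct)
      case one
      then show ?case using subringE(3)[OF T] opsub_carrier[OF P] by simp
    next
      case (incl h)
      then show ?case using AY P unfolding opsub_def by blast
    next
      case (a_inv h)
      then show ?case
        using a_inv_subring[OF T] subringE(1,5)[OF T] opsub_uminus[OF P] opsub_carrier[OF P] smult_l_minus
        by (auto simp: subset_iff)
    next
      case (eng_add h1 h2)
      then show ?case
        using subringE(1,7)[OF T] opsub_add[OF P] opsub_carrier[OF P] smult_l_distr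
        by (auto simp: subset_iff)
    next
      case (eng_mult h1 h2)
      then show ?case
        using subringE(1,6)[OF T] opsub_carrier[OF P] smult_assoc1
        by (auto simp: subset_iff)
    qed
    then show ?thesis using t x eq by blast
  qed
  then show ?thesis unfolding generates_def using T AY by blast
qed

text \<open>Finite generation refers to the structure with carrier \<open>M\<close>, whereas the
  noetherian submodule \<open>P\<close> is built in \<open>N\<close>. The intersection
  \<open>P \<inter> M\<close> is a submodule in the former sense and contains the generators, so
  \<open>M \<subseteq> P\<close>.\<close>

lemma noeth_fin_gen_module:
  assumes g: "generates Y T" and noe: "noetherian_ring (S\<lparr>carrier := T\<rparr>)" and M: "opsub Y M"
    and fg: "fin_gen_module (S\<lparr>carrier := T\<rparr>) (N\<lparr>carrier := M\<rparr>)"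
  shows "noeth Y {\<zero>\<^bsub>N\<^esub>} M"
proof -
  obtain Z where Z: "finite Z" "Z \<subseteq> M" "M = \<Inter>{H. submodule H (S\<lparr>carrier := T\<rparr>) (N\<lparr>carrier := M\<rparr>) \<and> Z \<subseteq> H}"
    using fg unfolding fin_gen_module_def by auto
  obtain P where P: "opsub Y P" "Z \<subseteq> P" "noeth Y {\<zero>\<^bsub>N\<^esub>} P"
    using noeth_finitely_generated[OF g noe Z(1)] Z(2) opsub_subset[OF M] by blast
  let ?H = "P \<inter> M"
  have oH: "opsub Y ?H" using opsub_Int[OF P(1) M] by simp
  have "subgroup M (add_monoid N)" using M unfolding opsub_def by blast
  then have inv: "inv\<^bsub>add_monoid (N\<lparr>carrier := M\<rparr>)\<^esub> x = \<ominus>\<^bsub>N\<^esub> x" if "x \<in> M" for x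
    using group.m_inv_consistent[of "add_monoid N" M x] M.add.is_group that
    unfolding a_inv_def by auto
  have "subgroup ?H (add_monoid (N\<lparr>carrier := M\<rparr>))"
    using opsub_zero[OF oH] opsub_add[OF oH] opsub_uminus[OF oH] inv
    by (intro subgroup.intro) auto
  then have "submodule ?H (S\<lparr>carrier := T\<rparr>) (N\<lparr>carrier := M\<rparr>)"
    unfolding submodule_def submodule_axioms_def using generatesD(6)[OF g oH] by simp
  then have "M \<subseteq> ?H" using Z(2,3) P(2) by blast
  then show ?thesis
    by (intro noeth_mono[OF P(3)]) auto
qed

end

context graded_operator_module
begin

text \<open>The tower is climbed once for an arbitrary property \<open>\<Phi>\<close>, shared by the
  associated primes and the Hilbert functions. The operators of \<open>R\<close> are kept, so
  \<open>noeth_adj\<close> carries the chain condition along.\<close>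

lemma adjoin_all:
  assumes Z: "finite Z" "Z \<subseteq> GS 1" and Y: "finite Y" "Y \<subseteq> GS 1"
    and M: "opsub Y M" "homog M" "noeth Y {\<zero>\<^bsub>N\<^esub>} M" and base: "\<Phi> M"
    and step: "\<And>Y y M'. finite Y \<Longrightarrow> Y \<subseteq> GS 1 \<Longrightarrow> y \<in> GS 1 \<Longrightarrow> opsub Y M' \<Longrightarrow> homog M' \<Longrightarrow>
       noeth Y {\<zero>\<^bsub>N\<^esub>} M' \<Longrightarrow> M \<subseteq> M' \<Longrightarrow> \<Phi> M' \<Longrightarrow> \<Phi> (adj y M')"
  shows "\<exists>M'. opsub (Z \<union> Y) M' \<and> homog M' \<and> noeth (Z \<union> Y) {\<zero>\<^bsub>N\<^esub>} M' \<and> M \<subseteq> M' \<and> \<Phi> M'"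
  using Z
proof (induction Z rule: finite_induct)
  case empty
  then show ?case using M base by auto
next
  case (insert y Z)
  then obtain M' where M': "opsub (Z \<union> Y) M'" "homog M'" "noeth (Z \<union> Y) {\<zero>\<^bsub>N\<^esub>} M'" "M \<subseteq> M'" "\<Phi> M'" by auto
  have ZY: "finite (Z \<union> Y)" "Z \<union> Y \<subseteq> GS 1" and y: "y \<in> GS 1" using insert Y by auto
  note gr = ZY(2) y M'(1,2)
  note ar = Y_carrier[OF gr] y_carrier[OF gr] M'(1)
  have "opsub (insert y Z \<union> Y) (adj y M')" "noeth (insert y Z \<union> Y) {\<zero>\<^bsub>N\<^esub>} (adj y M')"
    using opsub_adj[OF ar] noeth_adj[OF ar M'(3)] by simp_all
  moreover have "homog (adj y M')" using homog_adj[OF gr] .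
  moreover have "M \<subseteq> adj y M'" using M'(4) M_adj[OF ar] by blast
  moreover have "\<Phi> (adj y M')" using step[OF ZY y M'] .
  ultimately show ?case by blast
qed

context
  fixes Z Y M
  assumes Z: "finite Z" "Z \<subseteq> GS 1" "generates Z (carrier S)" and Y: "finite Y" "Y \<subseteq> GS 1"
    and M: "opsub Y M" "homog M" "noeth Y {\<zero>\<^bsub>N\<^esub>} M"
    and nN: "noeth Z {\<zero>\<^bsub>N\<^esub>} (carrier N)"
begin

text \<open>At the top of the tower \<open>M'\<close> is stable under the generators of
  \<open>S\<close>, and the chain condition on \<open>N\<close> over \<open>S\<close> takes
  over.\<close>

lemma noeth_tower:
  assumes "opsub (Z \<union> Y) M'"
  shows "opsub Z M'" "opsub Z (carrier N)" "noeth Z M' (carrier N)" "M' \<subseteq> carrier N"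
proof -
  show oM': "opsub Z M'" using opsub_antimono[OF assms] by blast
  show "opsub Z (carrier N)" using opsub_carrier_set generatesD(3)[OF Z(3)] .
  show "M' \<subseteq> carrier N" using opsub_subset[OF assms] .
  show "noeth Z M' (carrier N)" by (rule noeth_mono[OF nN]) (use opsub_zero[OF oM'] in auto)
qed

theorem finite_assq_tower:
  assumes noe: "noetherian_ring (S\<lparr>carrier := GS 0\<rparr>)"
  shows "finite (assq M (carrier N))"
proof -
  have base: "finite (assq M M)"
  proof -
    have "assq M M = {}" using assqE[OF _ M(1)] by blast
    then show ?thesis by simp
  qed
  have "\<exists>M'. opsub (Z \<union> Y) M' \<and> homog M' \<and> noeth (Z \<union> Y) {\<zero>\<^bsub>N\<^esub>} M' \<and> M \<subseteq> M' \<and> finite (assq M M')"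
  proof (rule adjoin_all[where \<Phi> = "\<lambda>M'. finite (assq M M')", OF Z(1,2) Y M base])
    fix Y' y M'
    assume *: "finite Y'" "Y' \<subseteq> GS 1" "y \<in> GS 1" "opsub Y' M'" "homog M'" "noeth Y' {\<zero>\<^bsub>N\<^esub>} M'"
      "M \<subseteq> M'" "finite (assq M M')"
    note ar = Y_carrier[OF *(2-5)] y_carrier[OF *(2-5)] *(4)
    have "assq M (adj y M') \<subseteq> assq M M' \<union> assq M' (adj y M')"
      by (rule assq_split[OF opsub_base[OF M(1)] opsub_base[OF *(4)] opsub_base[OF opsub_adj[OF ar]] *(7) M_adj[OF ar]])
    moreover have "finite (assq M' (adj y M'))" using assq_adj[OF ar *(6) noe] .
    ultimately show "finite (assq M (adj y M'))" using *(8) finite_subset by blast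
  qed
  then obtain M' where M': "opsub (Z \<union> Y) M'" "M \<subseteq> M'" "finite (assq M M')" by blast
  note nt = noeth_tower[OF M'(1)]
  have "finite (assq M' (carrier N))"
    using finite_assq[OF noe generatesD(3)[OF Z(3)] nt(3,1,2,4)] .
  then show ?thesis
    using assq_split[OF opsub_base[OF M(1)] opsub_base[OF M'(1)] opsub_base[OF nt(2)] M'(2) nt(4)] M'(3)
      finite_subset by blast
qed

end

end

context local_graded_module
begin

text \<open>Both conclusions climb the tower together. In the last step, from \<open>M'\<close> to
  \<open>N\<close>, the Hilbert function is the classical one over \<open>S\<close>, and a constant
  exponent suffices.\<close>

theorem hilb_tower:
  assumes Z: "finite Z" "Z \<subseteq> GS 1" "generates Z (carrier S)" and Y: "finite Y" "Y \<subseteq> GS 1"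
    and M: "opsub Y M" "homog M" "noeth Y {\<zero>\<^bsub>N\<^esub>} M"
    and nN: "noeth Z {\<zero>\<^bsub>N\<^esub>} (carrier N)"
    and fin: "fin_quot M (carrier N)"
  shows "evpoly (hilb M (carrier N))" "mlinear M (carrier N)"
proof -
  note nt = noeth_tower[OF Z Y M nN]
  note oM = opsub_base[OF M(1)]
  have oN: "opsub {} (carrier N)" using opsub_carrier_set by simp
  have base: "evpoly (hilb M M) \<and> mlinear M M"
  proof
    have "hilb M M n = 0" for n unfolding hilb_def using glen_eq_0[OF M(1)] by (simp add: zero_enat_def)
    then show "evpoly (hilb M M)" by (intro evpoly_zero)
    show "mlinear M M" using mlinear_of_pow[OF oM, of M 0] by simp
  qed
  have "\<exists>M'. opsub (Z \<union> Y) M' \<and> homog M' \<and> noeth (Z \<union> Y) {\<zero>\<^bsub>N\<^esub>} M' \<and> M \<subseteq> M' \<and>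
      evpoly (hilb M M') \<and> mlinear M M'"
  proof (rule adjoin_all[where \<Phi> = "\<lambda>M'. evpoly (hilb M M') \<and> mlinear M M'", OF Z(1,2) Y M base])
    fix Y' y M'
    assume *: "finite Y'" "Y' \<subseteq> GS 1" "y \<in> GS 1" "opsub Y' M'" "homog M'" "noeth Y' {\<zero>\<^bsub>N\<^esub>} M'"
      "M \<subseteq> M'" and ev: "evpoly (hilb M M') \<and> mlinear M M'"
    note ar = Y_carrier[OF *(2-5)] y_carrier[OF *(2-5)] *(4)
    note oadj = opsub_adj[OF ar]
    have fin': "fin_quot M' (adj y M')"
      using fin_quot_sub[OF oM *(4) oadj oN *(7) M_adj[OF ar] opsub_subset[OF oadj] fin] .
    have "fin_quot M (adj y M')"
      using fin_quot_sub[OF oM oM oadj oN order_refl order_trans[OF *(7) M_adj[OF ar]] opsub_subset[OF oadj] fin] .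
    then have "hilb M (adj y M') n = hilb M M' n + hilb M' (adj y M') n" for n
      by (rule hilb_add[OF oM *(4) oadj *(7) M_adj[OF ar]])
    then have "evpoly (hilb M (adj y M'))"
      by (rule evpoly_cong[OF sym evpoly_add[OF conjunct1[OF ev] evpoly_hilb_adj[OF *(2-5) *(1) *(6) fin']]])
    moreover have "mlinear M (adj y M')"
      using mlinear_trans[OF oM conjunct2[OF ev] mlinear_adj[OF *(2-6) fin']] .
    ultimately show "evpoly (hilb M (adj y M')) \<and> mlinear M (adj y M')" ..
  qed
  then obtain M' where M': "opsub (Z \<union> Y) M'" "homog M'" "M \<subseteq> M'" "evpoly (hilb M M')" "mlinear M M'" by blast
  note nt' = nt[OF M'(1)]
  have fin': "fin_quot M' (carrier N)"
    using fin_quot_sub[OF oM M'(1) oN oN M'(3) nt'(4) order_refl fin] .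
  have "evpoly (hilb M' (carrier N))"
    using evpoly_hilb[OF Z(1,2) nt'(1,2) M'(2) homog_carrier nt'(4,3) fin'] .
  moreover have "hilb M (carrier N) n = hilb M M' n + hilb M' (carrier N) n" for n
    by (rule hilb_add[OF oM M'(1) oN M'(3) nt'(4) fin])
  ultimately show "evpoly (hilb M (carrier N))"
    using evpoly_cong[OF sym evpoly_add[OF M'(4)]] by blast
  obtain k where "carrier N \<subseteq> (mcolon ^^ k) M'"
    using mcolon_pow_exhausts[OF nt'(1,2) M'(2) homog_carrier nt'(4) generatesD(3)[OF Z(3)] nt'(3) fin'] by blast
  then have "mlinear M' (carrier N)" by (rule mlinear_of_pow[OF opsub_base[OF M'(1)]])
  then show "mlinear M (carrier N)" using mlinear_trans[OF oM M'(5)] by blast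
qed

end

section \<open>From the stated structures to submodules of \<open>N\<close>\<close>

lemma finsum_carrier_update:
  assumes N: "abelian_monoid N" "abelian_monoid (N\<lparr>carrier := M\<rparr>)" "M \<subseteq> carrier N"
    and "finite F" "\<And>n. n \<in> F \<Longrightarrow> c n \<in> M"
  shows "finsum (N\<lparr>carrier := M\<rparr>) c F = finsum N c F"
  using assms(4,5)
proof (induction F rule: finite_induct)
  case empty
  then show ?case
    by (simp add: abelian_monoid.finsum_empty[OF N(1)] abelian_monoid.finsum_empty[OF N(2)])
next
  case (insert n F)
  have "finsum (N\<lparr>carrier := M\<rparr>) c (insert n F) = c n \<oplus>\<^bsub>N\<lparr>carrier := M\<rparr>\<^esub> finsum (N\<lparr>carrier := M\<rparr>) c F"
    using insert by (intro abelian_monoid.finsum_insert[OF N(2)]) auto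
  moreover have "finsum N c (insert n F) = c n \<oplus>\<^bsub>N\<^esub> finsum N c F"
    using insert N(3) by (intro abelian_monoid.finsum_insert[OF N(1)]) auto
  ultimately show ?case using insert by simp
qed

theorem theorem5p1:
  fixes S :: "'a ring" and GS :: "nat \<Rightarrow> 'a set"
    and RC :: "'a set" and GR :: "nat \<Rightarrow> 'a set"
    and A :: "'a ring"
    and N :: "('a, 'b) module" and GN :: "int \<Rightarrow> 'b set"
    and MC :: "'b set" and GM :: "int \<Rightarrow> 'b set"
  assumes A_def: "A = S\<lparr>carrier := GS 0\<rparr>"
    and A_noeth: "noetherian_ring A"
    and S_std: "standard_graded S GS"
    and R_sub: "subring RC S"
    and R_std: "standard_graded (S\<lparr>carrier := RC\<rparr>) GR"
    and R_incl: "\<forall>n. GR n \<subseteq> GS n"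
    and R0: "GR 0 = GS 0"
    and N_gr: "graded_module S GS N GN"
    and N_fg: "fin_gen_module S N"
    and M_sub: "MC \<subseteq> carrier N"
    and M_gr: "graded_module (S\<lparr>carrier := RC\<rparr>) GR (N\<lparr>carrier := MC\<rparr>) GM"
    and M_fg: "fin_gen_module (S\<lparr>carrier := RC\<rparr>) (N\<lparr>carrier := MC\<rparr>)"
    and M_incl: "\<forall>n. GM n \<subseteq> GN n"
  shows "finite (ass_quot A N MC) \<and>
    (local_ring A \<longrightarrow> (\<forall>n. quot_length A N (GM n) (GN n) < \<infinity>) \<longrightarrow>
      (\<exists>P :: rat poly.
         (P \<noteq> 0 \<longrightarrow> enat (Suc (degree P)) \<le> krull_dim S) \<and>
         (\<exists>n0. \<forall>n \<ge> n0. \<exists>k. quot_length A N (GM n) (GN n) = enat k \<and>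
                              poly P (of_int n) = of_nat k)))"
proof -
  have gS: "graded_ring S GS" and noeS: "noetherian_ring S"
    using S_std unfolding standard_graded_def by auto
  have cringS: "cring S" using gS unfolding graded_ring_def by blast
  interpret S: cring S by (rule cringS)
  have GSsub: "subgroup (GS n) (add_monoid S)" for n using gS unfolding graded_ring_def by blast
  have GSc: "GS n \<subseteq> carrier S" for n using subgroup.subset[OF GSsub, of n] by simp
  have A0: "subring (GS 0) S"
    using S.ring_incl_imp_subring[OF GSc] noetherian_ring.axioms(1)[OF A_noeth] unfolding A_def by blast
  have modN: "module S N" using N_gr unfolding graded_module_def by blast
  interpret G: graded_operator_module S N GS GN
  proof -
    interpret module S N by (rule modN)
    show "graded_operator_module S N GS GN"
      unfolding graded_operator_module_def graded_operator_module_axioms_def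
        operator_module_def operator_module_axioms_def
    proof (intro conjI allI impI)
      show "module S N" by (rule modN)
      show "subring (GS 0) S" by (rule A0)
      show "a \<in> carrier S" if "a \<in> GS n" for n a using that GSc by blast
      show "a \<otimes>\<^bsub>S\<^esub> b \<in> GS (m + n)" if "a \<in> GS m" "b \<in> GS n" for m n a b
        using gS that unfolding graded_ring_def by blast
      show "\<exists>c. homog_decomp S GS a c" if "a \<in> carrier S" for a
        using gS that unfolding graded_ring_def by blast
      show "subgroup (GN n) (add_monoid N)" for n using N_gr unfolding graded_module_def by blast
      show "a \<odot>\<^bsub>N\<^esub> x \<in> GN (int m + n)" if "a \<in> GS m" "x \<in> GN n" for m n a x
        using N_gr that unfolding graded_module_def by blast
      show "\<exists>!c. homog_decomp N GN x c" if "x \<in> carrier N" for x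
        using N_gr that unfolding graded_module_def by blast
    qed
  qed
  obtain Z where Z: "finite Z" "Z \<subseteq> GS 1" "carrier S = generate_ring S (GS 0 \<union> Z)"
    using S_std unfolding standard_graded_def by blast
  have upd: "S\<lparr>carrier := carrier S\<rparr> = S" by simp
  have genZ: "G.generates Z (carrier S)"
  proof (rule G.generatesI)
    show "subring (carrier S) S" using S.carrier_is_subring .
    show "GS 0 \<union> Z \<subseteq> carrier S" using Z(2) GSc by blast
    show "carrier S = generate_ring (S\<lparr>carrier := carrier S\<rparr>) (GS 0 \<union> Z)"
      using Z(3) unfolding upd .
  qed
  obtain Y where Y: "finite Y" "Y \<subseteq> GR 1" "RC = generate_ring (S\<lparr>carrier := RC\<rparr>) (GR 0 \<union> Y)"
    using R_std unfolding standard_graded_def by auto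
  have Y1: "Y \<subseteq> GS 1" using Y(2) R_incl by blast
  have genY: "G.generates Y RC"
  proof (rule G.generatesI[OF R_sub])
    show eq: "RC = generate_ring (S\<lparr>carrier := RC\<rparr>) (GS 0 \<union> Y)" using Y(3) unfolding R0 .
    have "GS 0 \<union> Y \<subseteq> generate_ring (S\<lparr>carrier := RC\<rparr>) (GS 0 \<union> Y)"
      by (intro subsetI generate_ring.incl)
    then show "GS 0 \<union> Y \<subseteq> RC" unfolding eq[symmetric] .
  qed
  have noeR: "noetherian_ring (S\<lparr>carrier := RC\<rparr>)" using R_std unfolding standard_graded_def by blast
  have modM: "module (S\<lparr>carrier := RC\<rparr>) (N\<lparr>carrier := MC\<rparr>)" using M_gr unfolding graded_module_def by blast
  have agM: "abelian_group (N\<lparr>carrier := MC\<rparr>)" using modM unfolding module_def by blast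
  have sgM: "subgroup MC (add_monoid N)"
    using G.M.add.group_incl_imp_subgroup[OF M_sub] abelian_group.a_group[OF agM] by simp
  have oM: "G.opsub Y MC"
    unfolding G.opsub_def
    using sgM module.smult_closed[OF modM] G.generatesD(2,3)[OF genY] by auto
  \<comment> \<open>The decomposition of \<open>x\<close> in \<open>M\<close> is also one in
    \<open>N\<close>, so by uniqueness there the components taken in \<open>N\<close> lie in
    \<open>M\<close>. This makes \<open>MC\<close> homogeneous and gives
    \<open>GM n = MC \<inter> GN n\<close>.\<close>
  have decompM: "\<exists>c. homog_decomp N GN x c \<and> (\<forall>n. c n \<in> GM n)" if x: "x \<in> MC" for x
  proof -
    obtain c where c: "homog_decomp (N\<lparr>carrier := MC\<rparr>) GM x c"
      using M_gr x unfolding graded_module_def by auto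
    have cM: "c n \<in> GM n" for n using c unfolding homog_decomp_def by blast
    have "GM n \<subseteq> MC" for n
      using M_gr subgroup.subset[of "GM n" "add_monoid (N\<lparr>carrier := MC\<rparr>)"] unfolding graded_module_def by auto
    then have "finsum (N\<lparr>carrier := MC\<rparr>) c {n. c n \<noteq> \<zero>\<^bsub>N\<^esub>} = finsum N c {n. c n \<noteq> \<zero>\<^bsub>N\<^esub>}"
      using c cM unfolding homog_decomp_def
      by (intro finsum_carrier_update G.M.abelian_monoid_axioms abelian_group.axioms(1)[OF agM] M_sub) auto
    then have "homog_decomp N GN x c" using c cM M_incl unfolding homog_decomp_def by auto
    then show ?thesis using cM by blast
  qed
  have hcompM: "G.hcomp n x \<in> GM n" if x: "x \<in> MC" for n x
    using decompM[OF x] G.hcomp_eq[of x] x M_sub by (metis subsetD)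
  have GM_sub: "GM n \<subseteq> MC" for n
    using M_gr subgroup.subset[of "GM n" "add_monoid (N\<lparr>carrier := MC\<rparr>)"] unfolding graded_module_def by auto
  have hM: "G.homog MC" unfolding G.homog_def using hcompM GM_sub by blast
  have GM: "GM n = MC \<inter> GN n" for n
  proof
    show "GM n \<subseteq> MC \<inter> GN n" using GM_sub M_incl by blast
    show "MC \<inter> GN n \<subseteq> GM n"
    proof
      fix x assume x: "x \<in> MC \<inter> GN n"
      then show "x \<in> GM n" using hcompM[of x n] G.hcomp_homogeneous[of x n n] by simp
    qed
  qed
  have nM: "G.noeth Y {\<zero>\<^bsub>N\<^esub>} MC" using G.noeth_fin_gen_module[OF genY noeR oM M_fg] .
  have oN: "G.opsub Z (carrier N)" using G.opsub_carrier_set[OF G.generatesD(3)[OF genZ]] .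
  have nN: "G.noeth Z {\<zero>\<^bsub>N\<^esub>} (carrier N)"
    using G.noeth_fin_gen_module[OF genZ _ oN] noeS N_fg by simp
  have "ass_quot A N MC = G.assq MC (carrier N)"
    unfolding ass_quot_def G.assq_def G.ann_def A_def by simp
  then have part1: "finite (ass_quot A N MC)"
    using G.finite_assq_tower[OF Z(1,2) genZ Y(1) Y1 oM hM nM nN] A_noeth unfolding A_def by simp
  have len: "quot_length A N (GM n) (GN n) = G.glen MC (carrier N) n" for n
  proof -
    have "carrier N \<inter> GN n = GN n" using G.GN_carrier by blast
    then show ?thesis unfolding G.glen_def G.len_def A_def GM by simp
  qed
  have part2: "\<exists>P :: rat poly. (P \<noteq> 0 \<longrightarrow> enat (Suc (degree P)) \<le> krull_dim S) \<and>
         (\<exists>n0. \<forall>n \<ge> n0. \<exists>k. quot_length A N (GM n) (GN n) = enat k \<and> poly P (of_int n) = of_nat k)"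
    if loc: "local_ring A" and finl: "\<forall>n. quot_length A N (GM n) (GN n) < \<infinity>"
  proof -
    obtain mm where mm: "maximalideal mm A" and uniq: "\<And>J. maximalideal J A \<Longrightarrow> J = mm" and cA: "cring A"
      using loc unfolding local_ring_def by blast
    have idl: "ideal mm A" using maximalideal.axioms(1)[OF mm] .
    have mmA: "mm \<subseteq> GS 0"
      using additive_subgroup.a_subset[OF ideal.axioms(1)[OF idl]] unfolding A_def by simp
    have unit: "\<exists>b \<in> GS 0. b \<otimes>\<^bsub>S\<^esub> a = \<one>\<^bsub>S\<^esub>" if "a \<in> GS 0" "a \<notin> mm" for a
      using local_noetherian_unit[OF cA A_noeth uniq, of a] that unfolding A_def by simp
    interpret L: local_graded_module S N GS GN mm
    proof
      show "mm \<subseteq> GS 0" by (rule mmA)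
      show "\<exists>b \<in> GS 0. b \<otimes>\<^bsub>S\<^esub> a = \<one>\<^bsub>S\<^esub>" if "a \<in> GS 0" "a \<notin> mm" for a using unit[OF that] .
      show "\<exists>b \<in> GS 0. b \<otimes>\<^bsub>S\<^esub> (\<one>\<^bsub>S\<^esub> \<ominus>\<^bsub>S\<^esub> a \<otimes>\<^bsub>S\<^esub> t) = \<one>\<^bsub>S\<^esub>" if t: "t \<in> mm" and a: "a \<in> GS 0" for t a
      proof (rule unit)
        have at: "a \<otimes>\<^bsub>S\<^esub> t \<in> mm"
          using ideal.I_l_closed[OF idl t, of a] a unfolding A_def by simp
        have c: "a \<otimes>\<^bsub>S\<^esub> t \<in> GS 0" "a \<otimes>\<^bsub>S\<^esub> t \<in> carrier S" using at mmA GSc[of 0] by auto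
        show "\<one>\<^bsub>S\<^esub> \<ominus>\<^bsub>S\<^esub> a \<otimes>\<^bsub>S\<^esub> t \<in> GS 0"
          unfolding a_minus_def using subringE(3,5,7)[OF A0] c by blast
        show "\<one>\<^bsub>S\<^esub> \<ominus>\<^bsub>S\<^esub> a \<otimes>\<^bsub>S\<^esub> t \<notin> mm"
        proof
          assume "\<one>\<^bsub>S\<^esub> \<ominus>\<^bsub>S\<^esub> a \<otimes>\<^bsub>S\<^esub> t \<in> mm"
          then have "(\<one>\<^bsub>S\<^esub> \<ominus>\<^bsub>S\<^esub> a \<otimes>\<^bsub>S\<^esub> t) \<oplus>\<^bsub>A\<^esub> a \<otimes>\<^bsub>S\<^esub> t \<in> mm"
            using additive_subgroup.a_closed[OF ideal.axioms(1)[OF idl] _ at] by blast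
          moreover have "(\<one>\<^bsub>S\<^esub> \<ominus>\<^bsub>S\<^esub> a \<otimes>\<^bsub>S\<^esub> t) \<oplus>\<^bsub>A\<^esub> a \<otimes>\<^bsub>S\<^esub> t = \<one>\<^bsub>A\<^esub>"
            unfolding A_def using c by (simp add: a_minus_def S.a_assoc S.l_neg)
          ultimately have "mm = carrier A" using ideal.one_imp_carrier[OF idl] by simp
          then show False using maximalideal.I_notcarr[OF mm] by simp
        qed
      qed
    qed
    have fin: "G.fin_quot MC (carrier N)" unfolding G.fin_quot_def using finl len by (metis less_irrefl)
    note hilb = L.hilb_tower[OF Z(1,2) genZ Y(1) Y1 oM hM nM nN fin]
    obtain P n0 where P: "\<And>n. n \<ge> n0 \<Longrightarrow> G.hilb MC (carrier N) n = poly P (of_int n)"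
      using hilb(1) unfolding evpoly_def by blast
    \<comment> \<open>Arguing by contradiction fixes the finite index
      \<open>e = Suc (degree P)\<close>, and an infinite \<open>krull_dim S\<close> is covered as
      well.\<close>
    have "enat (Suc (degree P)) \<le> krull_dim S" if "P \<noteq> 0"
    proof (rule ccontr)
      assume small: "\<not> enat (Suc (degree P)) \<le> krull_dim S"
      have "\<not> prime_chain S (Suc (degree P)) Q" for Q
      proof
        assume "prime_chain S (Suc (degree P)) Q"
        then have "enat (Suc (degree P)) \<le> krull_dim S"
          unfolding krull_dim_def prime_chain_def by (intro Sup_upper) blast
        then show False using small by simp
      qed
      then obtain f where f: "growth (Suc (degree P)) f" "\<And>n. n \<ge> 1 \<Longrightarrow> G.glen MC (carrier N) n \<le> enat (f n)"
        using L.glen_growth[OF genZ Z(2) noeS nN G.opsub_base[OF oM] hilb(2)] by blast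
      show False
      proof (rule degree_le_if_growth[OF that f(1)])
        fix n assume n: "n \<ge> max n0 1"
        have "the_enat (G.glen MC (carrier N) n) \<le> f n"
          using f(2)[of n] n by (cases "G.glen MC (carrier N) n") auto
        then show "0 \<le> poly P (of_int n) \<and> poly P (of_int n) \<le> of_nat (f n)"
          using P[of n] n unfolding G.hilb_def by (metis le_max_iff_disj of_nat_0_le_iff of_nat_le_iff max.boundedE)
      qed
    qed
    moreover have "\<exists>k. quot_length A N (GM n) (GN n) = enat k \<and> poly P (of_int n) = of_nat k" if "n \<ge> n0" for n
    proof -
      obtain k where "G.glen MC (carrier N) n = enat k" using finl[rule_format, of n] unfolding len by auto
      then show ?thesis using P[OF that] unfolding len G.hilb_def by auto
    qed
    ultimately show ?thesis by blast
  qed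
  show ?thesis using part1 part2 by blast
qed

end
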